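(* Let $q\in\mathbb{C}$ with $0<|q|<1$. For generic $x,z,u\in\mathbb{C}^*$ the following eight identities hold: $$D_2(x,z,z^2;q)=-\frac{xz^3(q^2;q^2)_{\infty}^3\,\Theta(-q^2x^2z^3;q^2)\,\Theta(q^2;q^{4})}{\Theta(xz;q)\,\Theta(z^2;q^4)\,\Theta(-qx^2z^2;q^2)\,\Theta(qz;q^2)},$$ $$D_2(x,z,z^4;q)=-\frac{(q^2;q^2)_{\infty}(q^4;q^4)_{\infty}\,\Theta(-xz^2;q)\,\Theta(-xz^3;q)}{x\,\Theta(xz;q)\,\Theta(z^4;q^4)\,\Theta(-qx^2z^4;q^2)},$$ $$D_2(x,z,x^{-1};q)=-\frac{z(q;q)_{\infty}^3\,\Theta(-qxz^2;q^2)}{\Theta(xz;q)\,\Theta(-qx;q^2)\,\Theta(z;q)},$$ $$D_2(x,z,x^{-2};q)=-\frac{(q;q)_{\infty}^3\,\Theta(-xz^2;q^2)}{\Theta(xz;q)\,\Theta(-x;q^2)\,\Theta(z;q)},$$ $$D_2(u^3,z,u^{-4};q)=-\frac{(q^2;q^2)_{\infty}(q^4;q^4)_{\infty}\,\Theta(-u^2z;q)\,\Theta(u;q)\,\Theta(-zu;q)}{\Theta(u^3z;q)\,\Theta(u^{4};q^4)\,\Theta(-qu^2;q^2)\,\Theta(z;q)},$$ $$D_2(qz^{-2},z,z^3;q^3)=-\frac{q^{-1}z^2(q^3;q^3)_{\infty}^4(q^6;q^6)_{\infty}\,\Theta(z;q^4)}{(q;q)_{\infty}\,\Theta(q^2z;q^3)\,\Theta(z^3;q^{12})\,\Theta(-qz;q^6)\,\Theta(z;q^3)},$$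 $$D_2(q^2z^{-2},z,z^3;q^3)=-\frac{q^{-1}z(q^3;q^3)_{\infty}^4(q^6;q^6)_{\infty}\,\Theta(z;q^4)}{(q;q)_{\infty}\,\Theta(qz;q^3)\,\Theta(z^3;q^{12})\,\Theta(-q^5z;q^6)\,\Theta(z;q^3)},$$ $$D_2(x,z,-qx^{-2}z^{-2};q)=-\frac{x^{-1}(q^2;q^2)_{\infty}^3\,\Theta(-xz^2;q)}{\Theta(xz;q)\,\Theta(-q^3x^{2}z^{2};q^4)\,\Theta(z^{2};q^2)}.$$
   Context: $\mathbb{C}^*=\mathbb{C}\setminus\{0\}$. For $Q\in\mathbb{C}$ with $0<|Q|<1$ and $x\in\mathbb{C}$, $(x;Q)_\infty=\prod_{i\ge 0}(1-Q^i x)$. For $x\in\mathbb{C}^*$, $$\Theta(x;Q)=(x;Q)_\infty(Q/x;Q)_\infty(Q;Q)_\infty=\sum_{n=-\infty}^{\infty}(-1)^nQ^{\binom n2}x^n .$$ The Appell function is $$m(x,z;Q)=\frac{1}{\Theta(z;Q)}\sum_{r=-\infty}^{\infty}\frac{(-1)^rQ^{\binom r2}z^r}{1-Q^{r-1}xz},$$ defined when neither $z$ nor $xz$ is an integral power of $Q$. For any base $Q$, $$D_2(x,z,z';Q)=m(x,z;Q)-m(-Qx^2,z';Q^4)+Q^{-1}x\,m(-Q^{-1}x^2,z';Q^4).$$ "Generic" means that, in each identity, the parameters are such that all Appell functions occurring are defined and no denominator vanishes. *)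

theory Defs
  imports "HOL-Analysis.Analysis"
begin

definition qpoch_inf :: "complex \<Rightarrow> complex \<Rightarrow> complex" where
  "qpoch_inf x Q = (\<Prod>i. 1 - Q ^ i * x)"

definition Theta :: "complex \<Rightarrow> complex \<Rightarrow> complex" where
  "Theta x Q = qpoch_inf x Q * qpoch_inf (Q / x) Q * qpoch_inf Q Q"

text \<open>The integer \<open>r * (r - 1)\<close> is even, so the division in the exponent is exact and gives
  \<open>binom r 2\<close> also for negative \<open>r\<close>.\<close>

definition appell_m :: "complex \<Rightarrow> complex \<Rightarrow> complex \<Rightarrow> complex" where
  "appell_m x z Q =
     1 / Theta z Q *
     (\<Sum>\<^sub>\<infinity>r\<in>(UNIV :: int set).
        (-1) powi r * Q powi (r * (r - 1) div 2) * z powi r / (1 - Q powi (r - 1) * x * z))"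

definition appell_defined :: "complex \<Rightarrow> complex \<Rightarrow> complex \<Rightarrow> bool" where
  "appell_defined x z Q \<longleftrightarrow> (\<forall>k::int. z \<noteq> Q powi k) \<and> (\<forall>k::int. x * z \<noteq> Q powi k)"

definition D2 :: "complex \<Rightarrow> complex \<Rightarrow> complex \<Rightarrow> complex \<Rightarrow> complex" where
  "D2 x z z' Q =
     appell_m x z Q - appell_m (- Q * x\<^sup>2) z' (Q ^ 4)
       + inverse Q * x * appell_m (- inverse Q * x\<^sup>2) z' (Q ^ 4)"

text \<open>All three Appell functions occurring in \<open>D2 x z z' Q\<close> are defined.\<close>

definition D2_defined :: "complex \<Rightarrow> complex \<Rightarrow> complex \<Rightarrow> complex \<Rightarrow> bool" where
  "D2_defined x z z' Q \<longleftrightarrow>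
     appell_defined x z Q \<and>
     appell_defined (- Q * x\<^sup>2) z' (Q ^ 4) \<and>
     appell_defined (- inverse Q * x\<^sup>2) z' (Q ^ 4)"

end

theory Submission
  imports Defs "HOL-Complex_Analysis.Complex_Analysis"
begin

text \<open>
  Write \<open>\<theta>(x;q)\<close> for the theta function and \<open>J_n\<close> for \<open>(q^n;q^n)_\<infinity>\<close>.  Everything rests on counting
  zeros.  A holomorphic \<open>f\<close> on the punctured plane with \<open>x^n f(qx) = C f(x)\<close> is divisible by
  \<open>\<theta>(x/a;q)\<close> as soon as \<open>f(a) = 0\<close>, and the quotient has degree \<open>n - 1\<close>; in degree \<open>0\<close>,
  Liouville's theorem forces \<open>f\<close> to be \<open>c x^k\<close>.  Hence \<open>f\<close> vanishes identically once it has \<open>n + 1\<close>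
  zeros that are inequivalent modulo powers of \<open>q\<close> (\<open>theta_space_eq_0\<close>), or \<open>n\<close> of them together
  with a multiplier that is left over after the divisions and is not a power of \<open>q\<close>.  The theta
  identities that are not mere rearrangements of products are proved by exhibiting such zeros.

  The numerator of the Appell function \<open>m(x,z;q)\<close> is a series in \<open>z\<close> whose coefficients depend only on
  \<open>y = xz\<close>.  With \<open>y\<close> fixed it is holomorphic in \<open>z\<close> on the whole punctured plane and satisfies
  \<open>f_y(qz) = (q/y)(f_y(z) - S(z))\<close>, where \<open>S\<close> is the bilateral theta series.  In \<open>D_2(x,z,z';q)\<close> keep
  \<open>y = xz\<close> and \<open>t = z'/z\<^sup>2\<close> fixed and let \<open>z\<close> vary: the parameters \<open>Y = -q x\<^sup>2 z'\<close> and \<open>Y/q\<^sup>2\<close> of the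
  other two Appell functions are then constant as well.  So after multiplication by the theta
  functions in the denominators every term is holomorphic in \<open>z\<close>, and no poles in \<open>z\<close> have to be
  compared.  Let \<open>H\<close> be the difference of the two sides of \<open>appell_series_quadratic\<close>, the claimed
  evaluation of this combination by theta functions.  Under \<open>z \<mapsto> q\<^sup>2z\<close> the inhomogeneous terms cancel,
  because the ratio of \<open>S\<close> to \<open>\<theta>\<close> is the same for \<open>q\<close> and \<open>q^4\<close> (\<open>theta_ratio_power_4\<close>), so \<open>H\<close> has
  degree \<open>2\<close> for the nome \<open>q\<^sup>2\<close>.  It vanishes at \<open>z = 1\<close> and \<open>z = q\<close>, where only \<open>f_y(1)\<close> is needed, and
  \<open>\<theta>(y;q) f_y(1) = -J_1\<^sup>3\<close> (\<open>appell_series_1\<close>).  The multiplier left over is \<open>q\<^sup>2/Y\<close>, which is not a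
  power of \<open>q\<^sup>2\<close> because the Appell functions are defined; hence \<open>H = 0\<close>.

  The result, \<open>D2_eq\<close>, expresses \<open>D_2\<close> by two products of theta functions for arbitrary \<open>z'\<close>.  For
  \<open>z' = z\<^sup>2\<close> one of them contains \<open>\<theta>(1;q^4) = 0\<close>.  For \<open>z' = z^4\<close> and for \<open>(x, z') = (u\<^sup>3, u^{-4})\<close> the two
  combine by the product formula \<open>Theta_product\<close>, for \<open>z' = -q x^{-2} z^{-2}\<close> by the even-odd splitting
  \<open>Theta_even_odd_parts\<close>, and for the other four choices by one further theta relation each, the two
  identities for the nome \<open>q\<^sup>3\<close> sharing theirs.
\<close>

section \<open>Infinite products and theta functions\<close>

definition nome :: "complex \<Rightarrow> bool" where
  "nome q \<longleftrightarrow> 0 < norm q \<and> norm q < 1"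

lemma nome_nonzero: "nome q \<Longrightarrow> q \<noteq> 0"
  by (auto simp: nome_def)

lemma nome_power: "nome q \<Longrightarrow> 0 < n \<Longrightarrow> nome (q ^ n)"
  by (auto simp: nome_def norm_power power_less_one_iff)

lemma qpoch_summable:
  fixes q x :: complex
  assumes "norm q < 1" shows "summable (\<lambda>i. norm (q ^ i * x))"
  using assms summable_mult2[of "\<lambda>i. norm q ^ i" "norm x"]
  by (simp add: norm_mult norm_power summable_geometric)

lemma qpoch_has_prod:
  assumes "norm q < 1"
  shows "(\<lambda>i. 1 - q ^ i * x) has_prod qpoch_inf x q"
proof -
  have "abs_convergent_prod (\<lambda>i. 1 - q ^ i * x)"
    using qpoch_summable[OF assms, of x]
    by (intro summable_imp_abs_convergent_prod) (simp add: norm_minus_commute)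
  thus ?thesis unfolding qpoch_inf_def
    by (intro convergent_prod_has_prod abs_convergent_prod_imp_convergent_prod)
qed

lemma qpoch_LIMSEQ:
  assumes "norm q < 1"
  shows "(\<lambda>n. \<Prod>i<n. 1 - q ^ i * x) \<longlonglongrightarrow> qpoch_inf x q"
  by (rule has_prod_imp_tendsto'[OF qpoch_has_prod[OF assms]])

lemma qpoch_eq_0_iff:
  assumes "norm q < 1"
  shows "qpoch_inf x q = 0 \<longleftrightarrow> (\<exists>i. q ^ i * x = 1)"
  using has_prod_eq_0_iff[OF qpoch_has_prod[OF assms, of x]] by auto

lemma qpoch_step:
  assumes "norm q < 1"
  shows "qpoch_inf x q = (1 - x) * qpoch_inf (q * x) q"
proof -
  have "(\<lambda>n. \<Prod>i<Suc n. 1 - q ^ i * x) \<longlonglongrightarrow> qpoch_inf x q"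
    using qpoch_LIMSEQ[OF assms, of x] by (rule LIMSEQ_Suc)
  also have "(\<lambda>n. \<Prod>i<Suc n. 1 - q ^ i * x) = (\<lambda>n. (1 - x) * (\<Prod>i<n. 1 - q ^ i * (q * x)))"
    by (simp add: prod.lessThan_Suc_shift mult_ac del: prod.lessThan_Suc)
  finally show ?thesis
    using tendsto_mult[OF tendsto_const qpoch_LIMSEQ[OF assms, of "q * x"]] LIMSEQ_unique by blast
qed

lemma qpoch_split:
  assumes "norm q < 1" "0 < n"
  shows "qpoch_inf x q = (\<Prod>j<n. qpoch_inf (q ^ j * x) (q ^ n))"
proof -
  have n: "norm (q ^ n) < 1"
    using assms by (simp add: norm_power power_less_one_iff)
  have "(\<lambda>N. \<Prod>i<N * n. 1 - q ^ i * x) \<longlonglongrightarrow> qpoch_inf x q"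
  proof -
    have "strict_mono (\<lambda>N. N * n)" using assms by (simp add: strict_mono_def)
    from LIMSEQ_subseq_LIMSEQ[OF qpoch_LIMSEQ[OF assms(1), of x] this] show ?thesis
      by (simp add: o_def)
  qed
  also have "(\<lambda>N. \<Prod>i<N * n. 1 - q ^ i * x) =
      (\<lambda>N. \<Prod>j<n. \<Prod>i<N. 1 - (q ^ n) ^ i * (q ^ j * x))"
  proof
    fix N
    have "(\<Prod>i<N * n. 1 - q ^ i * x) = (\<Prod>m<N. \<Prod>i\<in>{m * n..<m * n + n}. 1 - q ^ i * x)"
      by (rule prod.nat_group[symmetric])
    also have "\<dots> = (\<Prod>m<N. \<Prod>j<n. 1 - (q ^ n) ^ m * (q ^ j * x))"
    proof (rule prod.cong[OF refl])
      fix m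
      have "(\<Prod>i\<in>{m * n..<m * n + n}. 1 - q ^ i * x) = (\<Prod>j\<in>{0..<n}. 1 - q ^ (j + m * n) * x)"
        using prod.shift_bounds_nat_ivl[of "\<lambda>i. 1 - q ^ i * x" 0 "m * n" n] by (simp add: add.commute)
      thus "(\<Prod>i\<in>{m * n..<m * n + n}. 1 - q ^ i * x) = (\<Prod>j<n. 1 - (q ^ n) ^ m * (q ^ j * x))"
        by (simp add: power_add power_mult[symmetric] mult_ac atLeast0LessThan)
    qed
    also have "\<dots> = (\<Prod>j<n. \<Prod>i<N. 1 - (q ^ n) ^ i * (q ^ j * x))"
      by (rule prod.swap)
    finally show "(\<Prod>i<N * n. 1 - q ^ i * x) = (\<Prod>j<n. \<Prod>i<N. 1 - (q ^ n) ^ i * (q ^ j * x))" .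
  qed
  finally have "(\<lambda>N. \<Prod>j<n. \<Prod>i<N. 1 - (q ^ n) ^ i * (q ^ j * x)) \<longlonglongrightarrow> qpoch_inf x q" .
  moreover have "(\<lambda>N. \<Prod>j<n. \<Prod>i<N. 1 - (q ^ n) ^ i * (q ^ j * x)) \<longlonglongrightarrow>
      (\<Prod>j<n. qpoch_inf (q ^ j * x) (q ^ n))"
    by (intro tendsto_prod qpoch_LIMSEQ n)
  ultimately show ?thesis by (rule LIMSEQ_unique)
qed

lemma qpoch_minus:
  assumes "norm q < 1"
  shows "qpoch_inf x q * qpoch_inf (- x) q = qpoch_inf (x\<^sup>2) (q\<^sup>2)"
proof -
  have "(\<lambda>n. (\<Prod>i<n. 1 - q ^ i * x) * (\<Prod>i<n. 1 - q ^ i * (- x))) \<longlonglongrightarrow> qpoch_inf x q * qpoch_inf (- x) q"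
    by (intro tendsto_mult qpoch_LIMSEQ assms)
  also have "(\<lambda>n. (\<Prod>i<n. 1 - q ^ i * x) * (\<Prod>i<n. 1 - q ^ i * (- x))) =
     (\<lambda>n. \<Prod>i<n. 1 - (q\<^sup>2) ^ i * x\<^sup>2)"
    by (simp add: prod.distrib[symmetric] algebra_simps power2_eq_square power_mult_distrib)
  finally show ?thesis
    using qpoch_LIMSEQ[of "q\<^sup>2" "x\<^sup>2"] assms LIMSEQ_unique
    by (force simp: norm_power power_less_one_iff)
qed

lemma qpoch_holomorphic:
  assumes "norm q < 1"
  shows "(\<lambda>x. qpoch_inf x q) holomorphic_on UNIV"
proof (rule holomorphic_uniform_sequence)
  fix x :: complex
  define K where "K = cball x 1"
  have "uniformly_convergent_on K (\<lambda>N x. \<Prod>i<N. 1 - q ^ i * x)"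
  proof (rule uniformly_convergent_on_prod')
    show "uniformly_convergent_on K (\<lambda>N x. \<Sum>i<N. norm ((1 - q ^ i * x) - 1))"
    proof (rule Weierstrass_m_test')
      show "norm (norm ((1 - q ^ i * y) - 1)) \<le> norm (q ^ i * of_real (norm x + 1))" if "y \<in> K" for i y
      proof -
        have "norm y \<le> norm x + 1"
          using that norm_triangle_sub[of y x] by (simp add: K_def dist_norm norm_minus_commute)
        thus ?thesis by (auto simp: norm_mult intro!: mult_left_mono)
      qed
      show "summable (\<lambda>i. norm (q ^ i * complex_of_real (norm x + 1)))"
        by (rule qpoch_summable[OF assms])
    qed
  qed (auto simp: K_def intro!: continuous_intros)
  then obtain g where g: "uniform_limit K (\<lambda>N x. \<Prod>i<N. 1 - q ^ i * x) g sequentially"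
    by (auto simp: uniformly_convergent_on_def)
  have "uniform_limit K (\<lambda>N x. \<Prod>i<N. 1 - q ^ i * x) (\<lambda>x. qpoch_inf x q) sequentially"
  proof (rule uniform_limit_cong'[THEN iffD1, OF _ _ g])
    show "g y = qpoch_inf y q" if "y \<in> K" for y
      using tendsto_uniform_limitI[OF g that] qpoch_LIMSEQ[OF assms, of y] LIMSEQ_unique by blast
  qed auto
  thus "\<exists>d>0. cball x d \<subseteq> UNIV \<and>
      uniform_limit (cball x d) (\<lambda>N x. \<Prod>i<N. 1 - q ^ i * x) (\<lambda>x. qpoch_inf x q) sequentially"
    unfolding K_def by (intro exI[of _ 1]) auto
qed (auto intro!: holomorphic_intros)

lemma qpoch_self_nonzero:
  assumes "nome q" shows "qpoch_inf q q \<noteq> 0"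
proof
  assume "qpoch_inf q q = 0"
  then obtain i where "q ^ i * q = 1" using assms qpoch_eq_0_iff by (auto simp: nome_def)
  hence "norm (q ^ Suc i) = 1" by (simp add: mult.commute)
  moreover have "norm (q ^ Suc i) < 1"
    using assms nome_power[of q "Suc i"] by (simp only: nome_def)
  ultimately show False by simp
qed

text \<open>Each of the two infinite products is shifted by one factor; the quotient \<open>(1 - 1/x)/(1 -
  x)\<close> of these factors is \<open>-1/x\<close>.\<close>

lemma Theta_shift:
  assumes "nome q" "x \<noteq> 0"
  shows "Theta (q * x) q = - Theta x q / x"
proof -
  have q: "norm q < 1" "q \<noteq> 0" using assms by (auto simp: nome_def)
  have "qpoch_inf (1 / x) q = (1 - 1 / x) * qpoch_inf (q / x) q"
    using qpoch_step[OF q(1), of "1 / x"] by simp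
  moreover have "qpoch_inf x q = (1 - x) * qpoch_inf (q * x) q"
    by (rule qpoch_step[OF q(1)])
  moreover have "q / (q * x) = 1 / x" using q by simp
  moreover have "1 - 1 / x = - (1 - x) / x" using assms by (simp add: field_simps)
  ultimately show ?thesis
    by (simp only: Theta_def) (simp add: algebra_simps)
qed

lemma Theta_flip:
  assumes "nome q" "x \<noteq> 0"
  shows "Theta (q / x) q = Theta x q"
  using assms by (simp add: Theta_def nome_def)

lemma Theta_inverse:
  assumes "nome q" "x \<noteq> 0"
  shows "Theta (1 / x) q = - Theta x q / x"
  using Theta_shift[of q "1 / x"] Theta_flip[of q x] assms by (simp add: field_simps)

lemma Theta_eq_0_iff:
  assumes "nome q" "x \<noteq> 0"
  shows "Theta x q = 0 \<longleftrightarrow> (\<exists>k::int. x = q powi k)"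
proof -
  have q: "norm q < 1" "q \<noteq> 0" using assms by (auto simp: nome_def)
  have "Theta x q = 0 \<longleftrightarrow> (\<exists>i::nat. q ^ i * x = 1) \<or> (\<exists>i::nat. q ^ i * (q / x) = 1)"
    using qpoch_self_nonzero[OF assms(1)] by (simp add: Theta_def qpoch_eq_0_iff[OF q(1)])
  also have "\<dots> \<longleftrightarrow> (\<exists>i::nat. x = q powi (- int i)) \<or> (\<exists>i::nat. x = q powi (int (Suc i)))"
    using assms q by (auto simp: power_int_minus field_simps simp del: of_nat_Suc)
  also have "\<dots> \<longleftrightarrow> (\<exists>k::int. x = q powi k)"
  proof -
    have "(\<exists>i::nat. k = - int i) \<or> (\<exists>i::nat. k = int (Suc i))" for k :: int
      by (metis int_cases2 not0_implies_Suc of_nat_0 minus_zero)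
    thus ?thesis by metis
  qed
  finally show ?thesis .
qed

lemma Theta_holomorphic:
  assumes "nome q"
  shows "(\<lambda>x. Theta x q) holomorphic_on - {0}"
proof -
  have q: "norm q < 1" using assms by (auto simp: nome_def)
  have "((\<lambda>x. qpoch_inf x q) \<circ> (\<lambda>x. q / x)) holomorphic_on - {0}"
    by (rule holomorphic_on_compose_gen[OF _ qpoch_holomorphic[OF q]]) (auto intro!: holomorphic_intros)
  moreover have "(\<lambda>x. qpoch_inf x q) holomorphic_on - {0}"
    using qpoch_holomorphic[OF q] by (rule holomorphic_on_subset) auto
  ultimately show ?thesis
    unfolding Theta_def o_def by (intro holomorphic_intros)
qed

lemma Theta_holomorphic_compose:
  assumes "nome q" "f holomorphic_on A" "\<And>x. x \<in> A \<Longrightarrow> f x \<noteq> 0"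
  shows "(\<lambda>x. Theta (f x) q) holomorphic_on A"
proof -
  have "f ` A \<subseteq> - {0}" using assms(3) by auto
  from holomorphic_on_compose_gen[OF assms(2) Theta_holomorphic[OF assms(1)] this]
  show ?thesis by (simp add: o_def)
qed

text \<open>The exponents of the infinite products are sorted by their residue modulo \<open>n\<close>.\<close>

lemma Theta_dissection:
  assumes "nome q" "x \<noteq> 0" "0 < n"
  shows "Theta x q * qpoch_inf (q ^ n) (q ^ n) ^ n =
    (\<Prod>j<n. Theta (q ^ j * x) (q ^ n)) * qpoch_inf q q"
proof -
  have q: "norm q < 1" "q \<noteq> 0" using assms by (auto simp: nome_def)
  have "qpoch_inf (q / x) q = (\<Prod>j<n. qpoch_inf (q ^ (n - Suc j) * (q / x)) (q ^ n))"
    using qpoch_split[OF q(1) assms(3), of "q / x"]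
      prod.nat_diff_reindex[of "\<lambda>j. qpoch_inf (q ^ j * (q / x)) (q ^ n)" n] by simp
  also have "\<dots> = (\<Prod>j<n. qpoch_inf (q ^ n / (q ^ j * x)) (q ^ n))"
  proof (rule prod.cong[OF refl])
    fix j assume "j \<in> {..<n}"
    hence "q ^ n = q ^ (n - Suc j) * q * q ^ j"
      by (metis Suc_diff_Suc diff_add le_add_diff_inverse2 lessThan_iff less_or_eq_imp_le
          mult.commute power_Suc power_add)
    hence "q ^ (n - Suc j) * (q / x) = q ^ n / (q ^ j * x)"
      using q assms(2) by (simp add: field_simps)
    thus "qpoch_inf (q ^ (n - Suc j) * (q / x)) (q ^ n) = qpoch_inf (q ^ n / (q ^ j * x)) (q ^ n)"
      by simp
  qed
  finally have "Theta x q = (\<Prod>j<n. qpoch_inf (q ^ j * x) (q ^ n)) *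
      (\<Prod>j<n. qpoch_inf (q ^ n / (q ^ j * x)) (q ^ n)) * qpoch_inf q q"
    using qpoch_split[OF q(1) assms(3), of x] by (simp only: Theta_def)
  moreover have "(\<Prod>j<n. Theta (q ^ j * x) (q ^ n)) = (\<Prod>j<n. qpoch_inf (q ^ j * x) (q ^ n)) *
      (\<Prod>j<n. qpoch_inf (q ^ n / (q ^ j * x)) (q ^ n)) * qpoch_inf (q ^ n) (q ^ n) ^ n"
    by (simp only: Theta_def prod.distrib prod_constant card_lessThan)
  ultimately show ?thesis by (simp only: mult_ac)
qed

lemma Theta_dissection_2:
  assumes "nome q" "x \<noteq> 0"
  shows "Theta x q * qpoch_inf (q\<^sup>2) (q\<^sup>2) ^ 2 =
    Theta x (q\<^sup>2) * Theta (q * x) (q\<^sup>2) * qpoch_inf q q"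
proof -
  have *: "(\<Prod>j<2. f j) = f 0 * f (1::nat)" for f :: "nat \<Rightarrow> complex"
    by (simp add: numeral_2_eq_2)
  show ?thesis using Theta_dissection[OF assms, of 2] unfolding * by simp
qed

text \<open>Pair the factor \<open>1 - q^i x\<close> with \<open>1 + q^i x\<close>.\<close>

lemma Theta_times_Theta_minus:
  assumes "nome q" "x \<noteq> 0"
  shows "Theta x q * Theta (- x) q * qpoch_inf (q\<^sup>2) (q\<^sup>2) =
    Theta (x\<^sup>2) (q\<^sup>2) * qpoch_inf q q ^ 2"
proof -
  have q: "norm q < 1" "q \<noteq> 0" using assms by (auto simp: nome_def)
  have "qpoch_inf x q * qpoch_inf (- x) q = qpoch_inf (x\<^sup>2) (q\<^sup>2)"
       "qpoch_inf (q / x) q * qpoch_inf (- (q / x)) q = qpoch_inf (q\<^sup>2 / x\<^sup>2) (q\<^sup>2)"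
    using qpoch_minus[OF q(1), of x] qpoch_minus[OF q(1), of "q / x"] by (auto simp: power_divide)
  hence "Theta x q * Theta (- x) q * qpoch_inf (q\<^sup>2) (q\<^sup>2) =
      (qpoch_inf (x\<^sup>2) (q\<^sup>2) * qpoch_inf (q\<^sup>2 / x\<^sup>2) (q\<^sup>2) * qpoch_inf (q\<^sup>2) (q\<^sup>2)) * qpoch_inf q q ^ 2"
    by (simp add: Theta_def power2_eq_square mult_ac)
  thus ?thesis by (simp only: Theta_def)
qed

section \<open>Quasi-periodic holomorphic functions\<close>

lemma nome_powi_norm_eq_1:
  assumes "nome q" "norm (q powi k) = 1"
  shows "k = 0"
proof -
  have "norm q powr of_int k = 1"
    using assms by (simp add: norm_power_int powr_real_of_int' nome_def)
  thus ?thesis using assms by (simp add: nome_def powr_eq_one_iff_gen)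
qed

lemma Theta_unit_circle_nonzero:
  assumes "nome q" "norm x = 1" "x \<noteq> 1"
  shows "Theta x q \<noteq> 0"
proof
  assume "Theta x q = 0"
  then obtain k :: int where k: "x = q powi k"
    using Theta_eq_0_iff[OF assms(1), of x] assms(2) by fastforce
  thus False using nome_powi_norm_eq_1[OF assms(1), of k] assms by simp
qed

text \<open>The degree-zero case. Choose a real \<open>a\<close> with \<open>|q|^a = |c|\<close>; then \<open>|h(x)| |x|^{-a}\<close> is
  invariant under \<open>x \<mapsto> qx\<close>, hence bounded by its values on a compact annulus. Its pull-back
  along \<open>exp\<close> is the modulus of the entire function \<open>h(exp w) exp(-aw)\<close>, which is therefore
  constant, and periodicity under \<open>2\<pi>\<i>\<close> makes \<open>a\<close> an integer.\<close>

lemma multiplicative_Liouville: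
  assumes q: "nome q" and hol: "h holomorphic_on - {0}"
    and shift: "\<And>x. x \<noteq> 0 \<Longrightarrow> h (q * x) = c * h x"
  obtains C k where "\<And>x. x \<noteq> 0 \<Longrightarrow> h x = C * x powi k" "C = 0 \<or> c = q powi k"
proof (cases "c = 0")
  case True
  have "h x = 0" if "x \<noteq> 0" for x
    using shift[of "x / q"] that nome_nonzero[OF q] True by simp
  thus ?thesis using that[of 0] by simp
next
  case False
  have q': "0 < norm q" "norm q < 1" "q \<noteq> 0" using q by (auto simp: nome_def)
  hence lnq: "ln (norm q) < 0" by simp
  define a where "a = ln (norm c) / ln (norm q)"
  have qa: "norm q powr a = norm c"
    using q' lnq False by (simp add: a_def powr_def)
  define G where "G = (\<lambda>x. norm (h x) * norm x powr (- a))"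
  have G_shift: "G (q * x) = G x" if "x \<noteq> 0" for x
    using shift[OF that] q' False
    by (simp add: G_def norm_mult powr_mult powr_minus qa field_simps)
  have G_powi: "G (q powi k * x) = G x" if "x \<noteq> 0" for x k
  proof (induction k rule: int_induct[of _ 0])
    case (step1 i)
    thus ?case using G_shift[of "q powi i * x"] that q' by (simp add: power_int_add_1' mult.assoc)
  next
    case (step2 i)
    have "q * (q powi (i - 1) * x) = q powi i * x"
      using q' by (simp add: power_int_diff field_simps)
    hence "G (q powi (i - 1) * x) = G (q powi i * x)"
      using G_shift[of "q powi (i - 1) * x"] that q' by (metis mult_eq_0_iff power_int_eq_0_iff)
    thus ?case using step2 by simp
  qed simp
  define K where "K = {x::complex. norm q \<le> norm x \<and> norm x \<le> 1}"
  have "compact K"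
  proof -
    have "K = cball 0 1 - ball 0 (norm q)" by (auto simp: K_def dist_norm)
    thus ?thesis by (simp add: compact_diff)
  qed
  moreover have "continuous_on K G"
    unfolding G_def
    using holomorphic_on_imp_continuous_on[OF hol] q'
    by (intro continuous_intros) (auto simp: K_def elim!: continuous_on_subset)
  ultimately have "bounded (G ` K)"
    by (intro compact_imp_bounded compact_continuous_image)
  then obtain B where B: "\<And>x. x \<in> K \<Longrightarrow> norm (G x) \<le> B"
    by (auto simp: bounded_iff)
  have G_bound: "norm (G x) \<le> B" if "x \<noteq> 0" for x
  proof -
    define t where "t = ln (norm x) / ln (norm q)"
    define k where "k = - \<lfloor>t\<rfloor>"
    have "norm x = norm q powr t" using that lnq q' by (simp add: t_def powr_def)
    hence *: "norm (q powi k * x) = norm q powr (of_int k + t)"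
      using q' by (simp add: norm_mult norm_power_int powr_add powr_real_of_int')
    have "0 \<le> of_int k + t" "of_int k + t \<le> 1" unfolding k_def by linarith+
    hence "q powi k * x \<in> K"
      using q' powr_mono'[of "of_int k + t" 1 "norm q"] powr_mono'[of 0 "of_int k + t" "norm q"]
      by (auto simp: K_def *)
    thus ?thesis using B G_powi[OF that] by metis
  qed
  define F where "F = (\<lambda>w. h (exp w) * exp (- of_real a * w))"
  have F_norm: "norm (F w) = G (exp w)" for w
    by (simp add: F_def G_def norm_mult powr_def)
  have "h \<circ> exp holomorphic_on UNIV"
    by (rule holomorphic_on_compose_gen[OF _ hol]) (auto intro!: holomorphic_intros)
  hence "F holomorphic_on UNIV"
    unfolding F_def o_def by (intro holomorphic_intros)
  moreover have "bounded (range F)"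
    using G_bound[of "exp _"] unfolding bounded_iff by (auto simp: F_norm intro!: exI[of _ B])
       (metis abs_le_D1 exp_not_eq_zero)
  ultimately have "F constant_on UNIV" by (rule Liouville_theorem)
  then obtain C where C: "\<And>w. F w = C" by (auto simp: constant_on_def)
  have h_exp: "h (exp w) = C * exp (of_real a * w)" for w
    using C[of w] by (simp add: F_def exp_minus field_simps)
  show ?thesis
  proof (cases "C = 0")
    case True
    have "h x = 0" if "x \<noteq> 0" for x using h_exp[of "Ln x"] that True by simp
    thus ?thesis using that[of 0] by simp
  next
    case nz: False
    have "exp (of_real a * (2 * of_real pi * \<i>)) = 1"
      using h_exp[of "2 * of_real pi * \<i>"] h_exp[of 0] nz by simp
    then obtain k where "a = of_int k"
    proof -
      assume "exp (of_real a * (2 * of_real pi * \<i>)) = 1"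
      then obtain n :: int where "a * (2 * pi) = of_int (2 * n) * pi"
        by (auto simp: exp_eq_1)
      hence "a = of_int n" by simp
      thus ?thesis using that by blast
    qed
    have *: "h x = C * x powi k" if "x \<noteq> 0" for x
    proof -
      have "exp (of_int k * Ln x) = x powi k" using exp_power_int[of "Ln x" k] that by (simp add: mult.commute)
      thus ?thesis using h_exp[of "Ln x"] that by (simp add: \<open>a = of_int k\<close>)
    qed
    have "c = q powi k" using shift[of 1] *[of 1] *[of q] q' nz by simp
    thus ?thesis using that * by blast
  qed
qed

text \<open>Near a common zero the quotient equals the quotient of the two difference quotients, which
  are holomorphic.\<close>

lemma holomorphic_divide_simple_zeros:
  fixes f g :: "complex \<Rightarrow> complex"
  assumes S: "open S" and f: "f holomorphic_on S" and g: "g holomorphic_on S"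
    and zeros: "\<And>a. a \<in> S \<Longrightarrow> g a = 0 \<Longrightarrow> f a = 0 \<and> deriv g a \<noteq> 0"
  shows "\<exists>h. h holomorphic_on S \<and> (\<forall>x\<in>S. f x = g x * h x)"
proof (intro exI conjI ballI)
  define h where "h = (\<lambda>x. if g x = 0 then deriv f x / deriv g x else f x / g x)"
  show "f x = g x * h x" if "x \<in> S" for x using zeros[OF that] by (simp add: h_def)
  show "h holomorphic_on S"
  proof (rule holomorphic_on_open[OF S, THEN iffD2], safe)
    fix a assume a: "a \<in> S"
    define d where "d = (\<lambda>u z. if z = a then deriv u a else (u z - u a) / (z - a) :: complex)"
    have cont_g: "isCont g a"
      using holomorphic_on_imp_continuous_on[OF g] S a continuous_on_eq_continuous_at by blast
    have ev: "\<forall>\<^sub>F z in nhds a. z \<in> S" using S a by (rule eventually_nhds_in_open)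
    have diffS: "u field_differentiable at a" if "u holomorphic_on S" for u
      using that S a holomorphic_on_imp_differentiable_at by blast
    have nz: "\<forall>\<^sub>F z in nhds a. u z \<noteq> 0" if "isCont u a" "u a \<noteq> 0" for u :: "complex \<Rightarrow> complex"
      using tendsto_imp_eventually_ne[OF isContD[OF that(1)] that(2)] that(2)
      by (simp add: eventually_nhds_conv_at)
    show "\<exists>f'. (h has_field_derivative f') (at a)"
    proof (cases "g a = 0")
      case True
      have fa: "f a = 0" and g': "deriv g a \<noteq> 0" using zeros[OF a True] by auto
      have d: "d f holomorphic_on S" "d g holomorphic_on S"
        unfolding d_def using pole_lemma_open f g S by blast+
      have "isCont (d g) a"
        using holomorphic_on_imp_continuous_on[OF d(2)] S a continuous_on_eq_continuous_at by blast
      hence "\<forall>\<^sub>F z in nhds a. d g z \<noteq> 0"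
        using g' by (intro nz) (auto simp: d_def)
      hence "\<forall>\<^sub>F z in nhds a. d f z / d g z = h z"
        by eventually_elim (auto simp: d_def h_def True fa split: if_splits)
      moreover have "(\<lambda>z. d f z / d g z) field_differentiable at a"
        using diffS[OF d(1)] diffS[OF d(2)] g' by (intro field_differentiable_divide) (auto simp: d_def)
      ultimately show ?thesis
        unfolding field_differentiable_def using DERIV_cong_ev[OF refl _ refl] by metis
    next
      case False
      hence "\<forall>\<^sub>F z in nhds a. g z \<noteq> 0"
        using cont_g by (intro nz) auto
      hence "\<forall>\<^sub>F z in nhds a. f z / g z = h z"
        by eventually_elim (auto simp: h_def)
      moreover have "(\<lambda>z. f z / g z) field_differentiable at a"
        using diffS[OF f] diffS[OF g] False by (intro field_differentiable_divide) auto
      ultimately show ?thesis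
        unfolding field_differentiable_def using DERIV_cong_ev[OF refl _ refl] by metis
    qed
  qed
qed


text \<open>Splitting off the factor at \<open>1\<close> gives both the simplicity of that zero and the residue
  needed for \<open>appell_series_1\<close>.\<close>

lemma Theta_factor_1:
  assumes "nome q"
  obtains \<psi> where "\<psi> holomorphic_on - {0}" "\<psi> 1 = qpoch_inf q q ^ 3"
    "\<And>x. Theta x q = (1 - x) * \<psi> x"
proof
  define \<psi> where "\<psi> = (\<lambda>x. qpoch_inf (q * x) q * qpoch_inf (q / x) q * qpoch_inf q q)"
  have q: "norm q < 1" using assms by (auto simp: nome_def)
  show "\<psi> 1 = qpoch_inf q q ^ 3" by (simp add: \<psi>_def power3_eq_cube)
  show "Theta x q = (1 - x) * \<psi> x" for x
    using qpoch_step[OF q, of x] by (simp add: Theta_def \<psi>_def)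
  have "((\<lambda>x. qpoch_inf x q) \<circ> (\<lambda>x. q / x)) holomorphic_on - {0}"
    by (rule holomorphic_on_compose_gen[OF _ qpoch_holomorphic[OF q]]) (auto intro!: holomorphic_intros)
  moreover have "((\<lambda>x. qpoch_inf x q) \<circ> (\<lambda>x. q * x)) holomorphic_on - {0}"
    by (rule holomorphic_on_compose_gen[OF _ qpoch_holomorphic[OF q]]) (auto intro!: holomorphic_intros)
  ultimately show "\<psi> holomorphic_on - {0}"
    unfolding \<psi>_def o_def by (intro holomorphic_intros)
qed

lemma Theta_1 [simp]: "norm q < 1 \<Longrightarrow> Theta 1 q = 0"
  using qpoch_step[of q 1] by (simp add: Theta_def)

text \<open>Differentiate \<open>\<theta>(qx) = -\<theta>(x)/x\<close> at a zero; this transports simplicity from the zero \<open>1\<close> to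
  all powers of \<open>q\<close>.\<close>

lemma Theta_deriv_shift:
  assumes q: "nome q" and x: "x \<noteq> 0" "Theta x q = 0"
  shows "deriv (\<lambda>x. Theta x q) (q * x) * q = - deriv (\<lambda>x. Theta x q) x / x"
proof -
  define T where "T = (\<lambda>x. Theta x q)"
  have q0: "q \<noteq> 0" using nome_nonzero[OF q] .
  have der: "(T has_field_derivative deriv T y) (at y)" if "y \<noteq> 0" for y
    unfolding T_def using Theta_holomorphic[OF q] that
    by (intro holomorphic_derivI[of _ "- {0}"]) auto
  have "((\<lambda>y. T (q * y)) has_field_derivative deriv T (q * x) * q) (at x)"
    by (rule DERIV_chain2[where f = T and g = "\<lambda>y. q * y"])
      (use q0 x in \<open>auto intro!: derivative_eq_intros der\<close>)
  note d1 = this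
  have d2: "((\<lambda>y. - T y / y) has_field_derivative - deriv T x / x) (at x)"
    using x q0 by (auto intro!: derivative_eq_intros der[unfolded T_def] simp: T_def field_simps)
  have ev: "\<forall>\<^sub>F y in nhds x. T (q * y) = - T y / y"
    using t1_space_nhds[OF x(1)] by eventually_elim (simp add: T_def Theta_shift[OF q])
  have "((\<lambda>y. - T y / y) has_field_derivative deriv T (q * x) * q) (at x)"
    using d1 DERIV_cong_ev[OF refl ev refl] by simp
  from DERIV_unique[OF this d2] have "deriv T (q * x) * q = - deriv T x / x" .
  thus ?thesis by (simp add: T_def)
qed

lemma Theta_simple_zero:
  assumes q: "nome q" and "x \<noteq> 0" "Theta x q = 0"
  shows "deriv (\<lambda>x. Theta x q) x \<noteq> 0"
proof -
  have q0: "q \<noteq> 0" using nome_nonzero[OF q] .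
  obtain k :: int where k: "x = q powi k" using Theta_eq_0_iff[OF q] assms by blast
  have zero: "Theta (q powi k) q = 0" for k :: int
    using Theta_eq_0_iff[OF q, of "q powi k"] q0 by auto
  have "deriv (\<lambda>x. Theta x q) (q powi k) \<noteq> 0"
  proof (induction k rule: int_induct[of _ 0])
    case base
    obtain \<psi> where \<psi>: "\<psi> holomorphic_on - {0}" "\<psi> 1 = qpoch_inf q q ^ 3"
        "\<And>x. Theta x q = (1 - x) * \<psi> x"
      using Theta_factor_1[OF q] by blast
    have "(\<psi> has_field_derivative deriv \<psi> 1) (at 1)"
      by (rule holomorphic_derivI[OF \<psi>(1)]) auto
    hence "((\<lambda>x. (1 - x) * \<psi> x) has_field_derivative - \<psi> 1) (at 1)"
      by (auto intro!: derivative_eq_intros)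
    hence "deriv (\<lambda>x. Theta x q) 1 = - \<psi> 1" using \<psi>(3) DERIV_imp_deriv by simp
    thus ?case using \<psi>(2) qpoch_self_nonzero[OF q] by simp
  next
    case (step1 i)
    thus ?case using Theta_deriv_shift[OF q _ zero[of i]] q0
      by (auto simp: power_int_add_1')
  next
    case (step2 i)
    have "q * q powi (i - 1) = q powi i" using q0 by (simp add: power_int_diff)
    thus ?case using step2 Theta_deriv_shift[OF q _ zero[of "i - 1"]] q0 by auto
  qed
  thus ?thesis using k by simp
qed

text \<open>A zero \<open>a\<close> of \<open>f\<close> repeats at all \<open>q^k a\<close>, which are exactly the zeros of \<open>\<theta>(x/a;q)\<close>, and
  those are simple; so the quotient is holomorphic. Its functional equation holds where
  \<open>\<theta>(x/a;q)\<close> does not vanish, and extends by analytic continuation.\<close>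

lemma theta_division:
  assumes q: "nome q" and hol: "f holomorphic_on - {0}"
    and shift: "\<And>x. x \<noteq> 0 \<Longrightarrow> x ^ Suc n * f (q * x) = C * f x"
    and a: "a \<noteq> 0" "f a = 0"
  obtains h where "h holomorphic_on - {0}" "\<And>x. x \<noteq> 0 \<Longrightarrow> f x = Theta (x / a) q * h x"
    "\<And>x. x \<noteq> 0 \<Longrightarrow> x ^ n * h (q * x) = - (C / a) * h x"
proof -
  have q0: "q \<noteq> 0" using nome_nonzero[OF q] .
  define g where "g = (\<lambda>x. Theta (x / a) q)"
  have g: "g holomorphic_on - {0}"
    unfolding g_def using a by (intro Theta_holomorphic_compose[OF q]) (auto intro!: holomorphic_intros)
  have f0: "f (q powi k * a) = 0" for k
  proof (cases "C = 0")
    case True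
    have "f x = 0" if "x \<noteq> 0" for x
      using shift[of "x / q"] that q0 True by simp
    thus ?thesis using a q0 by simp
  next
    case False
    show ?thesis
    proof (induction k rule: int_induct[of _ 0])
      case base thus ?case using a by simp
    next
      case (step1 i)
      thus ?case using shift[of "q powi i * a"] a q0 by (simp add: power_int_add_1' mult.assoc)
    next
      case (step2 i)
      have eq: "q * (q powi (i - 1) * a) = q powi i * a"
        using q0 by (simp add: power_int_diff field_simps)
      show ?case using shift[of "q powi (i - 1) * a", unfolded eq] step2 a q0 False by simp
    qed
  qed
  have zeros: "f x = 0 \<and> deriv g x \<noteq> 0" if "x \<in> - {0}" "g x = 0" for x
  proof
    have x: "x / a \<noteq> 0" "Theta (x / a) q = 0" using that a by (auto simp: g_def)
    then obtain k :: int where "x / a = q powi k" using Theta_eq_0_iff[OF q] by blast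
    hence "x = q powi k * a" using a by (simp add: field_simps)
    thus "f x = 0" using f0 by simp
    have "((\<lambda>x. Theta x q) has_field_derivative deriv (\<lambda>x. Theta x q) (x / a)) (at (x / a))"
      using x Theta_holomorphic[OF q] by (intro holomorphic_derivI[of _ "- {0}"]) auto
    hence "(g has_field_derivative deriv (\<lambda>x. Theta x q) (x / a) * (1 / a)) (at x)"
      unfolding g_def
      by (rule DERIV_chain2[where f = "\<lambda>x. Theta x q" and g = "\<lambda>x. x / a"])
        (use a in \<open>auto intro!: derivative_eq_intros\<close>)
    thus "deriv g x \<noteq> 0" using Theta_simple_zero[OF q x] a by (simp add: DERIV_imp_deriv)
  qed
  have "open (- {0 :: complex})" by auto
  hence "\<exists>h. h holomorphic_on - {0} \<and> (\<forall>x\<in>- {0}. f x = g x * h x)"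
    by (rule holomorphic_divide_simple_zeros[OF _ hol g]) (rule zeros)
  then obtain h where h: "h holomorphic_on - {0}" "\<And>x. x \<in> - {0} \<Longrightarrow> f x = g x * h x"
    by (elim exE conjE) (rule that, assumption, erule bspec)
  define D where "D = (\<lambda>x. x ^ n * h (q * x) + C / a * h x)"
  have "D x = 0" if "x \<noteq> 0" for x
  proof (rule analytic_continuation_open[of "{x \<in> - {0}. g x \<noteq> 0}" "- {0}" D "\<lambda>_. 0"])
    have "open ((- {0}) \<inter> g -` (- {0}))"
      by (rule continuous_open_preimage[OF holomorphic_on_imp_continuous_on[OF g]]) auto
    also have "(- {0}) \<inter> g -` (- {0}) = {x \<in> - {0}. g x \<noteq> 0}" by auto
    finally show "open {x \<in> - {0}. g x \<noteq> 0}" .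
    have "Theta (- 1) q \<noteq> 0"
      by (rule Theta_unit_circle_nonzero[OF q]) auto
    hence "- a \<in> {x \<in> - {0}. g x \<noteq> 0}" using a by (simp add: g_def)
    thus "{x \<in> - {0}. g x \<noteq> 0} \<noteq> {}" by blast
    show "connected (- {0 :: complex})" by (rule connected_punctured_universe) simp
    have "(h \<circ> (\<lambda>x. q * x)) holomorphic_on - {0}"
      by (rule holomorphic_on_compose_gen[OF _ h(1)]) (use q0 in \<open>auto intro!: holomorphic_intros\<close>)
    thus "D holomorphic_on - {0}"
      unfolding D_def using h(1) a by (intro holomorphic_intros) (auto simp: o_def)
    fix x assume x: "x \<in> {x \<in> - {0}. g x \<noteq> 0}"
    have "g (q * x) = - g x * a / x"
      using Theta_shift[OF q, of "x / a"] x a by (simp add: g_def)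
    hence "x ^ Suc n * (- g x * a / x * h (q * x)) = C * (g x * h x)"
      using shift[of x] h(2)[of x] h(2)[of "q * x"] x q0 by simp
    hence "g x * (- a * (x ^ n * h (q * x))) = g x * (C * h x)"
      using x by (simp add: field_simps)
    hence "- a * (x ^ n * h (q * x)) = C * h x" using x by (subst (asm) mult_left_cancel) auto
    hence "C * h x + a * (x ^ n * h (q * x)) = 0" by (simp add: eq_neg_iff_add_eq_0[symmetric])
    thus "D x = 0" using a by (simp add: D_def field_simps)
  qed (use that in auto)
  hence "x ^ n * h (q * x) = - (C / a) * h x" if "x \<noteq> 0" for x
    using that by (simp add: D_def add_eq_0_iff2)
  thus ?thesis using that h by (auto simp: g_def)
qed

text \<open>The tool for proving theta identities: one zero is divided out at a time, and the nonzero
  values of \<open>\<theta>(b/a;q)\<close> express that the zeros in the list are inequivalent, so that the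
  remaining ones survive each division. The last zero kills the monomial left over in degree
  \<open>0\<close>.\<close>

lemma theta_space_eq_0:
  assumes q: "nome q" and "f holomorphic_on - {0}"
    and "\<And>x. x \<noteq> 0 \<Longrightarrow> x ^ n * f (q * x) = C * f x"
    and "length as = Suc n" "\<And>a. a \<in> set as \<Longrightarrow> a \<noteq> 0 \<and> f a = 0"
    and "sorted_wrt (\<lambda>a b. Theta (b / a) q \<noteq> 0) as" and "x \<noteq> 0"
  shows "f x = 0"
  using assms(2-)
proof (induction n arbitrary: f C as x)
  case 0
  obtain a where a: "a \<noteq> 0" "f a = 0" using 0 by (metis length_Suc_conv list.set_intros(1))
  have "f (q * x) = C * f x" if "x \<noteq> 0" for x using 0(2)[OF that] by simp
  then obtain D k where "\<And>x. x \<noteq> 0 \<Longrightarrow> f x = D * x powi k"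
    using multiplicative_Liouville[OF q 0(1)] by metis
  thus ?case using a 0(6) by (metis mult_eq_0_iff power_int_eq_0_iff)
next
  case (Suc n)
  then obtain a bs where as: "as = a # bs" by (cases as) auto
  hence a: "a \<noteq> 0" "f a = 0" using Suc.prems by auto
  obtain h where h: "h holomorphic_on - {0}" "\<And>x. x \<noteq> 0 \<Longrightarrow> f x = Theta (x / a) q * h x"
    "\<And>x. x \<noteq> 0 \<Longrightarrow> x ^ n * h (q * x) = - (C / a) * h x"
    using theta_division[OF q Suc.prems(1,2) a] by metis
  have "h x = 0"
  proof (rule Suc.IH[OF h(1,3)])
    show "length bs = Suc n" "sorted_wrt (\<lambda>a b. Theta (b / a) q \<noteq> 0) bs"
      using Suc.prems as by auto
    show "b \<noteq> 0 \<and> h b = 0" if "b \<in> set bs" for b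
      using that Suc.prems(4)[of b] Suc.prems(5) h(2)[of b] as by auto
  qed (use Suc.prems in auto)
  thus ?case using h(2) Suc.prems by simp
qed

section \<open>Identities between theta functions\<close>

lemma Theta_shiftI:
  assumes "nome q" "x \<noteq> 0" "y = q * x" shows "Theta y q = - Theta x q / x"
  using Theta_shift assms by simp

lemma Theta_flipI:
  assumes "nome q" "x \<noteq> 0" "y * x = q" shows "Theta y q = Theta x q"
proof -
  have "y = q / x" using assms by (simp add: field_simps)
  thus ?thesis using Theta_flip assms by simp
qed

lemma Theta_inverseI:
  assumes "nome q" "x \<noteq> 0" "y * x = 1" shows "Theta y q = - Theta x q / x"
proof -
  have "y = 1 / x" using assms by (simp add: field_simps)
  thus ?thesis using Theta_inverse assms by simp
qed

lemma Theta_self: "nome q \<Longrightarrow> Theta q q = 0"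
  using Theta_shiftI[of q 1 q] by (simp add: nome_def)

text \<open>Used to see that explicit points such as \<open>q\<^sup>3\<close> and \<open>q\<^sup>6\<close> are inequivalent for the nome
  \<open>q^12\<close>: comparing absolute values, \<open>c q^m\<close> could be a power of \<open>q^n\<close> only if \<open>n\<close> divided \<open>m\<close>.\<close>

lemma Theta_power_nonzero:
  assumes q: "nome q" and "norm c = 1" "0 < n" "\<not> n dvd m"
  shows "Theta (c * q ^ m) (q ^ n) \<noteq> 0"
proof
  assume 0: "Theta (c * q ^ m) (q ^ n) = 0"
  have q0: "q \<noteq> 0" using nome_nonzero[OF q] .
  have "c \<noteq> 0" using assms(2) by auto
  then obtain k :: int where "c * q ^ m = (q ^ n) powi k"
    using Theta_eq_0_iff[OF nome_power[OF q assms(3)], of "c * q ^ m"] 0 q0 by auto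
  also have "\<dots> = q powi (int n * k)" by (simp add: power_int_mult)
  finally have "norm (q ^ m) = norm (q powi (int n * k))"
    using assms(2) by (metis mult_1 norm_mult)
  hence "norm (q powi (int n * k - int m)) = 1"
    using q0 by (simp add: norm_power_int norm_power power_int_diff norm_divide)
  from nome_powi_norm_eq_1[OF q this] have "int m = int n * k" by simp
  hence "int n dvd int m" by simp
  thus False using assms(4) by simp
qed

lemma qpoch_dissection_2:
  assumes "norm q < 1"
  shows "qpoch_inf x q = qpoch_inf x (q\<^sup>2) * qpoch_inf (q * x) (q\<^sup>2)"
proof -
  have "{..<2::nat} = {0, 1}" by auto
  thus ?thesis using qpoch_split[OF assms, of 2 x] by simp
qed

lemma Theta_nome_square:
  assumes "nome q"
  shows "Theta q (q\<^sup>2) * qpoch_inf (q\<^sup>2) (q\<^sup>2) = qpoch_inf q q ^ 2"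
proof -
  have q: "norm q < 1" "q \<noteq> 0" using assms by (auto simp: nome_def)
  have "qpoch_inf q q = qpoch_inf q (q\<^sup>2) * qpoch_inf (q\<^sup>2) (q\<^sup>2)"
    using qpoch_dissection_2[OF q(1), of q] by (simp flip: power2_eq_square)
  moreover have "q\<^sup>2 / q = q" using q by (simp add: power2_eq_square)
  ultimately show ?thesis by (simp add: Theta_def power2_eq_square mult_ac)
qed

text \<open>Both sides have degree \<open>1\<close> and agree at \<open>1\<close>. A second common value is found at \<open>w\<^sup>2 = -q\<close>,
  where the odd part vanishes and the remaining equation is an identity between infinite
  products.\<close>

lemma Theta_even_odd_parts:
  assumes q: "nome q" and w: "w \<noteq> 0"
  shows "Theta w q = Theta (- (q * w\<^sup>2)) (q ^ 4) - w * Theta (- (q ^ 3 * w\<^sup>2)) (q ^ 4)"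
proof -
  have q': "norm q < 1" "q \<noteq> 0" using q by (auto simp: nome_def)
  have q4: "nome (q ^ 4)" by (rule nome_power[OF q]) simp
  define f where
    "f = (\<lambda>w. Theta w q - Theta (- (q * w\<^sup>2)) (q ^ 4) + w * Theta (- (q ^ 3 * w\<^sup>2)) (q ^ 4))"
  \<comment> \<open>The odd part vanishes at \<open>s\<close>, because \<open>\<theta>(q^4;q^4) = 0\<close>.\<close>
  define s where "s = csqrt (- q)"
  have s: "s\<^sup>2 = - q" "s \<noteq> 0" using q' by (auto simp: s_def)
  have "f w = 0"
  proof (rule theta_space_eq_0[OF q, where f = f and n = 1 and C = "- 1" and as = "[1, s]"])
    show "f holomorphic_on - {0}"
      unfolding f_def using q' by (intro holomorphic_intros Theta_holomorphic_compose q q4) auto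
    show "x ^ 1 * f (q * x) = - 1 * f x" if x: "x \<noteq> 0" for x
    proof -
      have e1: "Theta (q * x) q = - Theta x q / x" by (rule Theta_shift[OF q x])
      have e2: "- (q * (q * x)\<^sup>2) = - (q ^ 3 * x\<^sup>2)" by (simp add: power_numeral_reduce)
      have e3: "Theta (- (q ^ 3 * (q * x)\<^sup>2)) (q ^ 4) = - Theta (- (q * x\<^sup>2)) (q ^ 4) / (- (q * x\<^sup>2))"
        by (rule Theta_shiftI[OF q4]) (use q' x in \<open>auto simp: power_numeral_reduce\<close>)
      show ?thesis
        using x q' unfolding f_def e1 e3 unfolding e2 by (simp add: field_simps power2_eq_square)
    qed
    have "f 1 = 0"
    proof -
      have "Theta (- (q ^ 3)) (q ^ 4) = Theta (- q) (q ^ 4)"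
        by (rule Theta_flipI[OF q4]) (use q' in \<open>auto simp: power_numeral_reduce\<close>)
      thus ?thesis using q' by (simp add: f_def)
    qed
    moreover have "f s = 0"
    proof -
      have n2: "norm (q\<^sup>2) < 1" using q' by (simp add: norm_power power_less_one_iff)
      have J1: "qpoch_inf q q = qpoch_inf q (q\<^sup>2) * qpoch_inf (q\<^sup>2) (q\<^sup>2)"
        using qpoch_dissection_2[OF q'(1), of q] by (simp flip: power2_eq_square)
      have J2: "qpoch_inf (q\<^sup>2) (q\<^sup>2) = qpoch_inf (q\<^sup>2) (q ^ 4) * qpoch_inf (q ^ 4) (q ^ 4)"
        using qpoch_dissection_2[OF n2, of "q\<^sup>2"] by (simp flip: power_mult power_add)
      have odd: "qpoch_inf q (q\<^sup>2) * qpoch_inf (- q) (q\<^sup>2) = qpoch_inf (q\<^sup>2) (q ^ 4)"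
        using qpoch_minus[OF n2, of q] by (simp flip: power_mult)
      have "q / s = - s" using s by (simp add: field_simps power2_eq_square)
      hence "Theta s q = qpoch_inf (- q) (q\<^sup>2) * qpoch_inf q q"
        using qpoch_minus[OF q'(1), of s] s by (simp add: Theta_def)
      also have "\<dots> = qpoch_inf (q\<^sup>2) (q ^ 4) * qpoch_inf (q\<^sup>2) (q ^ 4) * qpoch_inf (q ^ 4) (q ^ 4)"
        unfolding J1 J2 odd[symmetric] by (simp add: mult_ac)
      also have "\<dots> = Theta (q\<^sup>2) (q ^ 4)"
        using q' by (simp add: Theta_def power_numeral_reduce)
      finally have "Theta s q = Theta (q\<^sup>2) (q ^ 4)" .
      moreover have "- (q * s\<^sup>2) = q\<^sup>2" "- (q ^ 3 * s\<^sup>2) = q ^ 4"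
        using s by (simp_all add: power_numeral_reduce)
      ultimately show ?thesis using Theta_self[OF q4] by (simp add: f_def)
    qed
    ultimately show "a \<noteq> 0 \<and> f a = 0" if "a \<in> set [1, s]" for a using that s by auto
    have "Theta s q \<noteq> 0"
    proof
      assume "Theta s q = 0"
      then obtain k :: int where "s = q powi k" using Theta_eq_0_iff[OF q s(2)] by blast
      hence "- q = (q powi k)\<^sup>2" using s by simp
      hence "- q = q powi (2 * k)" by (simp add: power_int_power power_int_power' mult.commute)
      hence "- 1 = q powi (2 * k - 1)" using q' by (simp add: power_int_diff field_simps)
      hence "norm (q powi (2 * k - 1)) = 1" by (metis norm_minus_cancel norm_one)
      from nome_powi_norm_eq_1[OF q this] show False by presburger
    qed
    thus "sorted_wrt (\<lambda>a b. Theta (b / a) q \<noteq> 0) [1, s]" by simp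
  qed (use w in auto)
  thus ?thesis by (simp add: f_def algebra_simps)
qed

text \<open>The difference \<open>F\<close> of the two sides has degree \<open>1\<close> in \<open>b\<close> and vanishes at \<open>b = 1\<close> and \<open>b =
  -a\<close>, but these two may be equivalent. They are not for \<open>a = \<i>\<close>; since \<open>F\<close> is symmetric, this
  supplies for every \<open>a\<close> the second zero \<open>b = \<i>\<close>.\<close>

lemma Theta_product:
  assumes q: "nome q" and a: "a \<noteq> 0" and b: "b \<noteq> 0"
  shows "Theta a q * Theta b q =
    Theta (- (a * b)) (q\<^sup>2) * Theta (- (q * b / a)) (q\<^sup>2) -
    a * Theta (- (q * a * b)) (q\<^sup>2) * Theta (- (b / a)) (q\<^sup>2)"
proof -
  have q': "norm q < 1" "q \<noteq> 0" using q by (auto simp: nome_def)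
  have q2: "nome (q\<^sup>2)" by (rule nome_power[OF q]) simp
  define F where "F = (\<lambda>a b. Theta a q * Theta b q -
    Theta (- (a * b)) (q\<^sup>2) * Theta (- (q * b / a)) (q\<^sup>2) +
    a * Theta (- (q * a * b)) (q\<^sup>2) * Theta (- (b / a)) (q\<^sup>2))"
  have sym: "F a b = F b a" if "a \<noteq> 0" "b \<noteq> 0" for a b
  proof -
    have "Theta (- (q * a / b)) (q\<^sup>2) = Theta (- (q * b / a)) (q\<^sup>2)"
      by (rule Theta_flipI[OF q2]) (use q' that in \<open>auto simp: power2_eq_square\<close>)
    moreover have "Theta (- (a / b)) (q\<^sup>2) = - Theta (- (b / a)) (q\<^sup>2) / (- (b / a))"
      by (rule Theta_inverseI[OF q2]) (use q' that in auto)
    ultimately show ?thesis using that by (simp add: F_def mult_ac)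
  qed
  have vanish: "F a b = 0"
    if a: "a \<noteq> 0" and c: "c \<noteq> 0" "F a c = 0" "Theta c q \<noteq> 0" and b: "b \<noteq> 0" for a b c
  proof (rule theta_space_eq_0[OF q, where f = "F a" and n = 1 and C = "- 1" and as = "[1, c]"])
    show "F a holomorphic_on - {0}"
      unfolding F_def using q' a by (intro holomorphic_intros Theta_holomorphic_compose q q2) auto
    show "x ^ 1 * F a (q * x) = - 1 * F a x" if x: "x \<noteq> 0" for x
    proof -
      have e1: "Theta (q * x) q = - Theta x q / x" by (rule Theta_shift[OF q x])
      have e2: "Theta (- (q * (q * x) / a)) (q\<^sup>2) = - Theta (- (x / a)) (q\<^sup>2) / (- (x / a))"
        by (rule Theta_shiftI[OF q2]) (use q' x a in \<open>auto simp: power2_eq_square\<close>)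
      have e3: "Theta (- (q * a * (q * x))) (q\<^sup>2) = - Theta (- (a * x)) (q\<^sup>2) / (- (a * x))"
        by (rule Theta_shiftI[OF q2]) (use q' x a in \<open>auto simp: power2_eq_square\<close>)
      have e4: "- (a * (q * x)) = - (q * a * x)" by simp
      show ?thesis using x a q' unfolding F_def e1 e2 e3 e4 by (simp add: field_simps)
    qed
    have "F a 1 = 0"
    proof -
      have "Theta (- (q / a)) (q\<^sup>2) = Theta (- (q * a)) (q\<^sup>2)"
        by (rule Theta_flipI[OF q2]) (use q' a in \<open>auto simp: power2_eq_square\<close>)
      moreover have "Theta (- (1 / a)) (q\<^sup>2) = - Theta (- a) (q\<^sup>2) / (- a)"
        by (rule Theta_inverseI[OF q2]) (use a in auto)
      ultimately show ?thesis using q' a by (simp add: F_def)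
    qed
    thus "x \<noteq> 0 \<and> F a x = 0" if "x \<in> set [1, c]" for x using that c by auto
    show "sorted_wrt (\<lambda>a b. Theta (b / a) q \<noteq> 0) [1, c]" using c by simp
  qed (use b in auto)
  have diag: "F a (- a) = 0" if "a \<noteq> 0" for a
  proof -
    have J: "qpoch_inf (q\<^sup>2) (q\<^sup>2) \<noteq> 0" by (rule qpoch_self_nonzero[OF q2])
    have "Theta a q * Theta (- a) q * qpoch_inf (q\<^sup>2) (q\<^sup>2) =
        Theta (a\<^sup>2) (q\<^sup>2) * (Theta q (q\<^sup>2) * qpoch_inf (q\<^sup>2) (q\<^sup>2))"
      using Theta_times_Theta_minus[OF q that] Theta_nome_square[OF q] by simp
    hence "Theta a q * Theta (- a) q = Theta (a\<^sup>2) (q\<^sup>2) * Theta q (q\<^sup>2)" using J by simp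
    thus ?thesis using that q2 by (simp add: F_def power2_eq_square nome_def)
  qed
  have "F \<i> c = 0" if "c \<noteq> 0" for c
    using vanish[of \<i> "- \<i>" c] diag[of \<i>] that Theta_unit_circle_nonzero[OF q, of "- \<i>"]
    by (force simp: complex_eq_iff)
  hence "F a \<i> = 0" using sym[of a \<i>] a by simp
  hence "F a b = 0"
    using vanish[of a \<i> b] a b Theta_unit_circle_nonzero[OF q, of \<i>] by (force simp: complex_eq_iff)
  thus ?thesis by (simp add: F_def algebra_simps)
qed


text \<open>Degree \<open>2\<close> in \<open>z\<close>: replacing \<open>z\<close> by \<open>qz\<close> interchanges the two products on the left, up to
  a common factor. Besides \<open>z = 1\<close>, the zeros used are the two points with \<open>q x z\<^sup>2 = -1\<close>, where
  the right-hand side vanishes and the two products on the left coincide. The hypothesis makes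
  them inequivalent to \<open>1\<close>.\<close>

lemma Theta_mixed_nome_relation:
  assumes q: "nome q" and x: "x \<noteq> 0" and z: "z \<noteq> 0" and nz: "Theta (- (q * x)) (q\<^sup>2) \<noteq> 0"
  shows "Theta (- (q * x * z)) (q\<^sup>2) * Theta (x * z\<^sup>2) (q ^ 4) * Theta (q * z) (q\<^sup>2) -
      Theta (- (x * z)) (q\<^sup>2) * Theta (q\<^sup>2 * x * z\<^sup>2) (q ^ 4) * Theta z (q\<^sup>2) =
    z * Theta q (q\<^sup>2) * Theta x (q ^ 4) * Theta (- (q * x * z\<^sup>2)) (q\<^sup>2)"
proof -
  have q': "norm q < 1" "q \<noteq> 0" using q by (auto simp: nome_def)
  have q2: "nome (q\<^sup>2)" and q4: "nome (q ^ 4)" by (rule nome_power[OF q], simp)+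
  define f where "f = (\<lambda>z. Theta (- (q * x * z)) (q\<^sup>2) * Theta (x * z\<^sup>2) (q ^ 4) * Theta (q * z) (q\<^sup>2) -
      Theta (- (x * z)) (q\<^sup>2) * Theta (q\<^sup>2 * x * z\<^sup>2) (q ^ 4) * Theta z (q\<^sup>2) -
    z * Theta q (q\<^sup>2) * Theta x (q ^ 4) * Theta (- (q * x * z\<^sup>2)) (q\<^sup>2))"
  \<comment> \<open>The right-hand side vanishes at \<open>\<plusminus>s\<close>, because \<open>\<theta>(1;q\<^sup>2) = 0\<close>.\<close>
  define s where "s = csqrt (- 1 / (q * x))"
  have "s\<^sup>2 = - 1 / (q * x)" by (simp add: s_def)
  hence s: "s\<^sup>2 * (q * x) = - 1" "s \<noteq> 0" using q' x by auto
  have "f z = 0"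
  proof (rule theta_space_eq_0[OF q, where f = f and n = 2 and C = "1 / x" and as = "[1, s, - s]"])
    show "f holomorphic_on - {0}"
      unfolding f_def using q' x by (intro holomorphic_intros Theta_holomorphic_compose q2 q4) auto
    show "y ^ 2 * f (q * y) = 1 / x * f y" if y: "y \<noteq> 0" for y
    proof -
      have e1: "Theta (- (q * x * (q * y))) (q\<^sup>2) = - Theta (- (x * y)) (q\<^sup>2) / (- (x * y))"
        by (rule Theta_shiftI[OF q2]) (use x y in \<open>auto simp: power2_eq_square\<close>)
      have e2: "x * (q * y)\<^sup>2 = q\<^sup>2 * x * y\<^sup>2" by (simp add: power_mult_distrib)
      have e3: "Theta (q * (q * y)) (q\<^sup>2) = - Theta y (q\<^sup>2) / y"
        by (rule Theta_shiftI[OF q2]) (use y in \<open>auto simp: power2_eq_square\<close>)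
      have e4: "- (x * (q * y)) = - (q * x * y)" by simp
      have e5: "Theta (q\<^sup>2 * x * (q * y)\<^sup>2) (q ^ 4) = - Theta (x * y\<^sup>2) (q ^ 4) / (x * y\<^sup>2)"
        by (rule Theta_shiftI[OF q4]) (use x y in \<open>auto simp: power_numeral_reduce\<close>)
      have e6: "Theta (- (q * x * (q * y)\<^sup>2)) (q\<^sup>2) = - Theta (- (q * x * y\<^sup>2)) (q\<^sup>2) / (- (q * x * y\<^sup>2))"
        by (rule Theta_shiftI[OF q2]) (use q' x y in \<open>auto simp: power_mult_distrib\<close>)
      show ?thesis
        using x y q' unfolding f_def e1 e3 e5 e6 unfolding e2 e4 by (simp add: field_simps power2_eq_square)
    qed
    have f1: "f 1 = 0" using q2 by (simp add: f_def nome_def)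
    have fs: "f t = 0" if t: "t\<^sup>2 * (q * x) = - 1" for t
    proof -
      have t0: "t \<noteq> 0" using t by auto
      have x_eq: "x = - 1 / (q * t\<^sup>2)" using t q' t0 by (simp add: field_simps)
      have a1: "- (q * x * t) = 1 / t" and a2: "x * t\<^sup>2 = - 1 / q" and a3: "- (x * t) = 1 / (q * t)"
        and a4: "q\<^sup>2 * x * t\<^sup>2 = - q" and a5: "- (q * x * t\<^sup>2) = 1"
        unfolding x_eq using t0 q' by (simp_all add: field_simps power2_eq_square)
      have b1: "Theta (1 / t) (q\<^sup>2) = - Theta t (q\<^sup>2) / t"
        by (rule Theta_inverse[OF q2 t0])
      have b2: "Theta (1 / (q * t)) (q\<^sup>2) = - Theta (q * t) (q\<^sup>2) / (q * t)"
        by (rule Theta_inverse[OF q2]) (use t0 q' in auto)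
      have "Theta (- 1 / q) (q ^ 4) = - Theta (- q) (q ^ 4) / (- q)"
        by (rule Theta_inverseI[OF q4]) (use q' in auto)
      hence b3: "Theta (- 1 / q) (q ^ 4) = Theta (- q) (q ^ 4) / q" by simp
      have b4: "Theta 1 (q\<^sup>2) = 0" using q2 by (simp add: nome_def)
      show ?thesis
        unfolding f_def a1 a2 a3 a4 a5 b1 b2 b3 b4 using t0 q' by (simp add: field_simps)
    qed
    show "y \<noteq> 0 \<and> f y = 0" if "y \<in> set [1, s, - s]" for y
      using that f1 fs[of s] fs[of "- s"] s by auto
    have nzs: "Theta t q \<noteq> 0" if t: "t\<^sup>2 * (q * x) = - 1" for t
    proof
      assume *: "Theta t q = 0"
      have t0: "t \<noteq> 0" using t by auto
      obtain k :: int where k: "t = q powi k" using Theta_eq_0_iff[OF q t0] * by blast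
      have "- (q * x) = 1 / t\<^sup>2" using t t0 by (simp add: field_simps)
      also have "t\<^sup>2 = (q\<^sup>2) powi k" by (simp add: k power_int_power power_int_power' mult.commute)
      finally have "- (q * x) = (q\<^sup>2) powi (- k)" using q' by (simp add: power_int_minus field_simps)
      thus False using nz Theta_eq_0_iff[OF q2, of "- (q * x)"] q' x by auto
    qed
    have "Theta (- s / s) q \<noteq> 0" using Theta_unit_circle_nonzero[OF q, of "- 1"] s by simp
    thus "sorted_wrt (\<lambda>a b. Theta (b / a) q \<noteq> 0) [1, s, - s]"
      using nzs[of s] nzs[of "- s"] s by simp
  qed (use z in auto)
  thus ?thesis by (simp add: f_def)
qed

text \<open>An instance of Weierstrass's three-term relation. Degree \<open>2\<close> in \<open>x\<close> for the nome \<open>q\<^sup>2\<close>; at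
  each of the zeros \<open>x = \<plusminus>1/z\<close> and \<open>x = q/z\<close> one of the three terms drops out.\<close>

lemma Theta_three_term_relation:
  assumes q: "nome q" and x: "x \<noteq> 0" and z: "z \<noteq> 0"
  shows "Theta (- (q * z)) (q\<^sup>2) * Theta (q * z) (q\<^sup>2) * Theta (x * z) (q\<^sup>2) * Theta (- (x * z)) (q\<^sup>2) -
      x * Theta (- z) (q\<^sup>2) * Theta z (q\<^sup>2) * Theta (q * x * z) (q\<^sup>2) * Theta (- (q * x * z)) (q\<^sup>2) =
    Theta q (q\<^sup>2) * Theta (- q) (q\<^sup>2) * Theta x (q\<^sup>2) * Theta (- (x * z\<^sup>2)) (q\<^sup>2)"
proof -
  have q': "norm q < 1" "q \<noteq> 0" using q by (auto simp: nome_def)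
  have q2: "nome (q\<^sup>2)" by (rule nome_power[OF q]) simp
  define f where "f = (\<lambda>x.
      Theta (- (q * z)) (q\<^sup>2) * Theta (q * z) (q\<^sup>2) * Theta (x * z) (q\<^sup>2) * Theta (- (x * z)) (q\<^sup>2) -
      x * Theta (- z) (q\<^sup>2) * Theta z (q\<^sup>2) * Theta (q * x * z) (q\<^sup>2) * Theta (- (q * x * z)) (q\<^sup>2) -
    Theta q (q\<^sup>2) * Theta (- q) (q\<^sup>2) * Theta x (q\<^sup>2) * Theta (- (x * z\<^sup>2)) (q\<^sup>2))"
  have "f x = 0"
  proof (rule theta_space_eq_0[OF q2, where f = f and n = 2 and C = "- 1 / z\<^sup>2" and as = "[1 / z, - 1 / z, q / z]"])
    show "f holomorphic_on - {0}"
      unfolding f_def using q' z by (intro holomorphic_intros Theta_holomorphic_compose q2) auto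
    show "y ^ 2 * f (q\<^sup>2 * y) = - 1 / z\<^sup>2 * f y" if y: "y \<noteq> 0" for y
    proof -
      have e1: "Theta (q\<^sup>2 * y * z) (q\<^sup>2) = - Theta (y * z) (q\<^sup>2) / (y * z)"
        by (rule Theta_shiftI[OF q2]) (use z y in auto)
      have e2: "Theta (- (q\<^sup>2 * y * z)) (q\<^sup>2) = - Theta (- (y * z)) (q\<^sup>2) / (- (y * z))"
        by (rule Theta_shiftI[OF q2]) (use z y in auto)
      have e3: "Theta (q * (q\<^sup>2 * y) * z) (q\<^sup>2) = - Theta (q * y * z) (q\<^sup>2) / (q * y * z)"
        by (rule Theta_shiftI[OF q2]) (use q' z y in auto)
      have e4: "Theta (- (q * (q\<^sup>2 * y) * z)) (q\<^sup>2) = - Theta (- (q * y * z)) (q\<^sup>2) / (- (q * y * z))"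
        by (rule Theta_shiftI[OF q2]) (use q' z y in auto)
      have e5: "Theta (q\<^sup>2 * y) (q\<^sup>2) = - Theta y (q\<^sup>2) / y"
        by (rule Theta_shift[OF q2 y])
      have e6: "Theta (- (q\<^sup>2 * y * z\<^sup>2)) (q\<^sup>2) = - Theta (- (y * z\<^sup>2)) (q\<^sup>2) / (- (y * z\<^sup>2))"
        by (rule Theta_shiftI[OF q2]) (use z y in auto)
      show ?thesis
        using z y q' unfolding f_def e1 e2 e3 e4 e5 e6 by (simp add: field_simps power2_eq_square)
    qed
    have n1: "Theta 1 (q\<^sup>2) = 0" using q2 by (simp add: nome_def)
    have "f (1 / z) = 0"
    proof -
      have b1: "Theta (1 / z) (q\<^sup>2) = - Theta z (q\<^sup>2) / z"
        by (rule Theta_inverse[OF q2 z])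
      have a: "1 / z * z = 1" "q * (1 / z) * z = q" "1 / z * z\<^sup>2 = z"
        using z by (simp_all add: power2_eq_square)
      show ?thesis
        unfolding f_def a b1 n1 using z by simp
    qed
    moreover have "f (- 1 / z) = 0"
    proof -
      have b1: "Theta (- 1 / z) (q\<^sup>2) = - Theta (- z) (q\<^sup>2) / (- z)"
        by (rule Theta_inverseI[OF q2]) (use z in auto)
      have a: "- 1 / z * z = - 1" "q * (- 1 / z) * z = - q" "- 1 / z * z\<^sup>2 = - z"
        using z by (simp_all add: power2_eq_square)
      show ?thesis
        unfolding f_def a b1 using z n1 by simp
    qed
    moreover have "f (q / z) = 0"
    proof -
      have b1: "Theta (q / z) (q\<^sup>2) = Theta (q * z) (q\<^sup>2)"
        by (rule Theta_flipI[OF q2]) (use z q' in \<open>auto simp: power2_eq_square\<close>)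
      have a: "q / z * z = q" "q * (q / z) * z = q\<^sup>2" "q / z * z\<^sup>2 = q * z"
        using z by (simp_all add: power2_eq_square)
      show ?thesis
        unfolding f_def a b1 Theta_self[OF q2] by simp
    qed
    ultimately show "y \<noteq> 0 \<and> f y = 0" if "y \<in> set [1 / z, - 1 / z, q / z]" for y
      using that z q' by auto
    have "Theta q (q\<^sup>2) \<noteq> 0" "Theta (- q) (q\<^sup>2) \<noteq> 0"
      using Theta_power_nonzero[OF q, of 1 2 1] Theta_power_nonzero[OF q, of "- 1" 2 1] by auto
    thus "sorted_wrt (\<lambda>a b. Theta (b / a) (q\<^sup>2) \<noteq> 0) [1 / z, - 1 / z, q / z]"
      using Theta_unit_circle_nonzero[OF q2, of "- 1"] z by simp
  qed (use x in auto)
  thus ?thesis by (simp add: f_def)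
qed


text \<open>The formula \<open>(-a;p)_\<infinity> = (a\<^sup>2;p\<^sup>2)_\<infinity> / (a;p)_\<infinity>\<close>, with the denominator dissected to the nome
  \<open>p\<^sup>2\<close>.\<close>

lemma qpoch_minus_quotient:
  assumes q: "nome q" and m: "0 < m" "m < n"
  shows "qpoch_inf (- (q ^ m)) (q ^ n) * (qpoch_inf (q ^ m) (q ^ (2 * n)) * qpoch_inf (q ^ (n + m)) (q ^ (2 * n))) =
    qpoch_inf (q ^ (2 * m)) (q ^ (2 * n))"
proof -
  have n: "norm (q ^ n) < 1" using nome_power[OF q, of n] m by (simp add: nome_def)
  have "(q ^ n)\<^sup>2 = q ^ (2 * n)" "(q ^ m)\<^sup>2 = q ^ (2 * m)" by (simp_all add: mult.commute flip: power_mult)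
  thus ?thesis
    using qpoch_minus[OF n, of "q ^ m"] qpoch_dissection_2[OF n, of "q ^ m"]
    by (simp add: power_add mult_ac)
qed

text \<open>Degree \<open>2\<close> in \<open>z\<close> for the nome \<open>q^12\<close>. At the zeros \<open>q\<^sup>3\<close>, \<open>q\<^sup>6\<close>, \<open>q\<^sup>9\<close> one of the three
  terms drops out, and what remains is an identity between infinite products; these are compared
  after writing all of them in terms of \<open>P k = (q^k; q^12)_\<infinity>\<close>.\<close>

lemma Theta_nome_12_relation:
  assumes q: "nome q" and z: "z \<noteq> 0"
  shows "qpoch_inf q q * qpoch_inf (q ^ 6) (q ^ 6) * qpoch_inf (q ^ 12) (q ^ 12) *
      (q * Theta (- q) (q ^ 6) * Theta (q ^ 3 * z) (q ^ 12) * Theta (q ^ 9 * z) (q ^ 12) +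
       Theta (- (q ^ 2)) (q ^ 6) * Theta (q ^ 6 * z) (q ^ 12) ^ 2) =
    qpoch_inf (q ^ 3) (q ^ 3) ^ 3 * qpoch_inf (q ^ 4) (q ^ 4) *
      Theta (q ^ 4 * z) (q ^ 12) * Theta (q ^ 8 * z) (q ^ 12)"
proof -
  have q': "norm q < 1" "q \<noteq> 0" using q by (auto simp: nome_def)
  have q12: "nome (q ^ 12)" by (rule nome_power[OF q]) simp
  define P where "P = (\<lambda>k. qpoch_inf (q ^ k) (q ^ 12))"
  have P_nz: "P k \<noteq> 0" if "0 < k" for k
  proof
    assume "P k = 0"
    then obtain i where "(q ^ 12) ^ i * q ^ k = 1"
      using qpoch_eq_0_iff[of "q ^ 12"] q12 by (auto simp: P_def nome_def)
    hence "norm (q ^ (12 * i + k)) = 1" by (simp add: power_add power_mult)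
    moreover have "norm (q ^ (12 * i + k)) < 1"
      using nome_power[OF q, of "12 * i + k"] that unfolding nome_def by simp
    ultimately show False by simp
  qed
  have J: "qpoch_inf (q ^ d) (q ^ d) = (\<Prod>j<n. P (d * Suc j))" if "d * n = 12" "0 < d" "0 < n" for d n
  proof -
    have "norm (q ^ d) < 1" using nome_power[OF q that(2)] by (simp add: nome_def)
    from qpoch_split[OF this that(3), of "q ^ d"] show ?thesis
      using that(1) by (simp add: P_def power_add flip: power_mult) (simp add: mult.commute)
  qed
  have J1: "qpoch_inf q q = P 1 * P 2 * P 3 * P 4 * P 5 * P 6 * P 7 * P 8 * P 9 * P 10 * P 11 * P 12"
    using J[of 1 12] by (simp add: eval_nat_numeral mult_ac)
  have J3: "qpoch_inf (q ^ 3) (q ^ 3) = P 3 * P 6 * P 9 * P 12"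
    using J[of 3 4] by (simp add: eval_nat_numeral mult_ac)
  have J4: "qpoch_inf (q ^ 4) (q ^ 4) = P 4 * P 8 * P 12"
    using J[of 4 3] by (simp add: eval_nat_numeral mult_ac)
  have J6: "qpoch_inf (q ^ 6) (q ^ 6) = P 6 * P 12"
    using J[of 6 2] by (simp add: eval_nat_numeral mult_ac)
  have J12: "qpoch_inf (q ^ 12) (q ^ 12) = P 12" by (simp add: P_def)
  have Th: "Theta (q ^ k) (q ^ 12) = P k * P (12 - k) * P 12" if "k \<le> 12" for k
  proof -
    have "q ^ 12 / q ^ k = q ^ (12 - k)" using that q' by (simp add: power_diff)
    thus ?thesis by (simp add: Theta_def P_def)
  qed
  have minus: "qpoch_inf (- (q ^ m)) (q ^ 6) * (P m * P (6 + m)) = P (2 * m)" if "0 < m" "m < 6" for m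
    using qpoch_minus_quotient[OF q that] by (simp add: P_def)
  define A where "A = Theta (- q) (q ^ 6)"
  define B where "B = Theta (- (q ^ 2)) (q ^ 6)"
  have A: "A * (P 1 * P 5 * P 7 * P 11) = P 2 * P 10 * P 6 * P 12"
  proof -
    have "q ^ 6 / (- q) = - (q ^ 5)" using q' by (simp add: power_numeral_reduce)
    hence "A * (P 1 * P 5 * P 7 * P 11) = (qpoch_inf (- (q ^ 1)) (q ^ 6) * (P 1 * P (6 + 1))) *
        (qpoch_inf (- (q ^ 5)) (q ^ 6) * (P 5 * P (6 + 5))) * (P 6 * P 12)"
      by (simp add: A_def Theta_def J6 mult_ac)
    also have "\<dots> = P (2 * 1) * P (2 * 5) * (P 6 * P 12)"
      using minus[of 1] minus[of 5] by simp
    finally show ?thesis by (simp add: mult_ac)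
  qed
  have B: "B * (P 2 * P 10) = P 6 * P 12"
  proof -
    have "q ^ 6 / (- (q ^ 2)) = - (q ^ 4)" using q' by (simp add: power_numeral_reduce)
    hence "B * (P 2 * P 10) * (P 4 * P 8) = (qpoch_inf (- (q ^ 2)) (q ^ 6) * (P 2 * P (6 + 2))) *
        (qpoch_inf (- (q ^ 4)) (q ^ 6) * (P 4 * P (6 + 4))) * (P 6 * P 12)"
      by (simp add: B_def Theta_def J6 mult_ac)
    also have "\<dots> = P (2 * 2) * P (2 * 4) * (P 6 * P 12)"
      using minus[of 2] minus[of 4] by simp
    finally have "(P 4 * P 8) * (B * (P 2 * P 10)) = (P 4 * P 8) * (P 6 * P 12)" by (simp add: mult_ac)
    thus ?thesis using P_nz[of 4] P_nz[of 8] by simp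
  qed
  \<comment> \<open>This is \<open>J_3\<^sup>3 J_4 / (J_1 J_6 J_12)\<close> after cancellation.\<close>
  define K where "K = P 3 ^ 2 * P 6 * P 9 ^ 2 * P 12 / (P 1 * P 2 * P 5 * P 7 * P 10 * P 11)"
  have nz: "P 1 \<noteq> 0" "P 2 \<noteq> 0" "P 3 \<noteq> 0" "P 4 \<noteq> 0" "P 5 \<noteq> 0" "P 6 \<noteq> 0" "P 7 \<noteq> 0"
    "P 8 \<noteq> 0" "P 9 \<noteq> 0" "P 10 \<noteq> 0" "P 11 \<noteq> 0" "P 12 \<noteq> 0"
    by (simp_all add: P_nz)
  have A': "A = P 2 * P 10 * P 6 * P 12 / (P 1 * P 5 * P 7 * P 11)"
    using A nz by (simp add: field_simps)
  have B': "B = P 6 * P 12 / (P 2 * P 10)"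
    using B nz by (simp add: field_simps)
  have K: "qpoch_inf q q * qpoch_inf (q ^ 6) (q ^ 6) * qpoch_inf (q ^ 12) (q ^ 12) * K =
      qpoch_inf (q ^ 3) (q ^ 3) ^ 3 * qpoch_inf (q ^ 4) (q ^ 4)"
    unfolding J1 J3 J4 J6 J12 K_def using nz by (simp add: field_simps power2_eq_square power3_eq_cube)
  have T: "Theta q (q ^ 12) = P 1 * P 11 * P 12" "Theta (q ^ 2) (q ^ 12) = P 2 * P 10 * P 12"
    "Theta (q ^ 3) (q ^ 12) = P 3 * P 9 * P 12" "Theta (q ^ 5) (q ^ 12) = P 5 * P 7 * P 12"
    using Th[of 1] Th[of 2] Th[of 3] Th[of 5] by simp_all
  have A_K: "A * Theta (q ^ 3) (q ^ 12) ^ 2 = K * Theta (q ^ 2) (q ^ 12) ^ 2"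
    unfolding A' K_def T using nz by (simp add: field_simps power2_eq_square)
  have B_K: "B * Theta (q ^ 3) (q ^ 12) ^ 2 = K * Theta (q ^ 5) (q ^ 12) * Theta q (q ^ 12)"
    unfolding B' K_def T using nz by (simp add: field_simps power2_eq_square)
  have mirror: "Theta (q ^ k) (q ^ 12) = Theta (q ^ (12 - k)) (q ^ 12)" if "k \<le> 12" for k
    using Th[OF that] Th[of "12 - k"] that by (simp add: mult_ac)
  have beyond: "Theta (q ^ (12 + k)) (q ^ 12) = - Theta (q ^ k) (q ^ 12) / q ^ k" for k
    by (rule Theta_shiftI[OF q12]) (use q' in \<open>auto simp: power_add\<close>)
  define f where "f = (\<lambda>z. q * A * Theta (q ^ 3 * z) (q ^ 12) * Theta (q ^ 9 * z) (q ^ 12) +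
       B * Theta (q ^ 6 * z) (q ^ 12) ^ 2 - K * Theta (q ^ 4 * z) (q ^ 12) * Theta (q ^ 8 * z) (q ^ 12))"
  have "f z = 0"
  proof (rule theta_space_eq_0[OF q12, where f = f and n = 2 and C = "1 / q ^ 12" and as = "[q ^ 3, q ^ 6, q ^ 9]"])
    show "f holomorphic_on - {0}"
      unfolding f_def using q' by (intro holomorphic_intros Theta_holomorphic_compose q12) auto
    show "y ^ 2 * f (q ^ 12 * y) = 1 / q ^ 12 * f y" if y: "y \<noteq> 0" for y
    proof -
      have e: "Theta (q ^ k * (q ^ 12 * y)) (q ^ 12) = - Theta (q ^ k * y) (q ^ 12) / (q ^ k * y)" for k
        by (rule Theta_shiftI[OF q12]) (use y q' in auto)
      have "q ^ 3 * q ^ 9 = q ^ 12" "q ^ 6 * q ^ 6 = q ^ 12" "q ^ 4 * q ^ 8 = q ^ 12"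
        by (simp_all flip: power_add)
      thus ?thesis
        unfolding f_def e using y q' by (simp add: field_simps power2_eq_square)
    qed
    have "f (q ^ 6) = 0"
    proof -
      have a: "q ^ 3 * q ^ 6 = q ^ 9" "q ^ 9 * q ^ 6 = q ^ (12 + 3)" "q ^ 6 * q ^ 6 = q ^ 12"
        "q ^ 4 * q ^ 6 = q ^ 10" "q ^ 8 * q ^ 6 = q ^ (12 + 2)" by (simp_all flip: power_add)
      have "f (q ^ 6) = - (A * Theta (q ^ 3) (q ^ 12) ^ 2 - K * Theta (q ^ 2) (q ^ 12) ^ 2) / q\<^sup>2"
        unfolding f_def a beyond Theta_self[OF q12] using mirror[of 9] mirror[of 10] q'
        by (simp add: field_simps power2_eq_square power3_eq_cube)
      thus ?thesis using A_K by simp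
    qed
    moreover have "f (q ^ 3) = 0"
    proof -
      have a: "q ^ 3 * q ^ 3 = q ^ 6" "q ^ 9 * q ^ 3 = q ^ 12" "q ^ 6 * q ^ 3 = q ^ 9"
        "q ^ 4 * q ^ 3 = q ^ 7" "q ^ 8 * q ^ 3 = q ^ 11" by (simp_all flip: power_add)
      have "f (q ^ 3) = B * Theta (q ^ 3) (q ^ 12) ^ 2 - K * Theta (q ^ 5) (q ^ 12) * Theta q (q ^ 12)"
        unfolding f_def a Theta_self[OF q12] using mirror[of 9] mirror[of 7] mirror[of 11] by simp
      thus ?thesis using B_K by simp
    qed
    moreover have "f (q ^ 9) = 0"
    proof -
      have a: "q ^ 3 * q ^ 9 = q ^ 12" "q ^ 9 * q ^ 9 = q ^ (12 + 6)" "q ^ 6 * q ^ 9 = q ^ (12 + 3)"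
        "q ^ 4 * q ^ 9 = q ^ (12 + 1)" "q ^ 8 * q ^ 9 = q ^ (12 + 5)" by (simp_all flip: power_add)
      have "q ^ 3 * q ^ 3 = q * q ^ 5" by (simp flip: power_add power_Suc)
      hence "f (q ^ 9) = (B * Theta (q ^ 3) (q ^ 12) ^ 2 - K * Theta (q ^ 5) (q ^ 12) * Theta q (q ^ 12)) / (q * q ^ 5)"
        unfolding f_def a beyond Theta_self[OF q12] using q'
        by (simp add: power2_eq_square diff_divide_distrib mult_ac)
      thus ?thesis using B_K by simp
    qed
    ultimately show "y \<noteq> 0 \<and> f y = 0" if "y \<in> set [q ^ 3, q ^ 6, q ^ 9]" for y
      using that q' by auto
    have "q ^ 6 / q ^ 3 = 1 * q ^ 3" "q ^ 9 / q ^ 3 = 1 * q ^ 6" "q ^ 9 / q ^ 6 = 1 * q ^ 3"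
      using q' by (simp_all add: field_simps flip: power_add)
    thus "sorted_wrt (\<lambda>a b. Theta (b / a) (q ^ 12) \<noteq> 0) [q ^ 3, q ^ 6, q ^ 9]"
      using Theta_power_nonzero[OF q, of 1 12 3] Theta_power_nonzero[OF q, of 1 12 6] by simp
  qed (use z in auto)
  hence eq: "q * A * Theta (q ^ 3 * z) (q ^ 12) * Theta (q ^ 9 * z) (q ^ 12) +
       B * Theta (q ^ 6 * z) (q ^ 12) ^ 2 = K * Theta (q ^ 4 * z) (q ^ 12) * Theta (q ^ 8 * z) (q ^ 12)"
    by (simp add: f_def)
  show ?thesis
    unfolding A_def[symmetric] B_def[symmetric] eq K[symmetric] by (simp only: mult_ac)
qed

section \<open>Bilateral theta series\<close>

lemma summable_gaussian_nat:
  fixes t \<rho> :: real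
  assumes t: "0 < t" "t < 1" and \<rho>: "0 < \<rho>"
  shows "summable (\<lambda>n::nat. t ^ (n * (n - 1) div 2) * \<rho> ^ n)"
proof -
  have "(\<lambda>n. t ^ n * \<rho>) \<longlonglongrightarrow> 0 * \<rho>"
    using t by (intro tendsto_mult LIMSEQ_realpow_zero) auto
  hence "\<forall>\<^sub>F n in sequentially. t ^ n * \<rho> < 1 / 2"
    by (intro order_tendstoD) auto
  then obtain N where N: "\<And>n. n \<ge> N \<Longrightarrow> t ^ n * \<rho> < 1 / 2"
    by (auto simp: eventually_sequentially)
  show ?thesis
  proof (rule summable_ratio_test[of "1 / 2" N])
    fix n assume n: "N \<le> n"
    have "Suc n * (Suc n - 1) div 2 = n * (n - 1) div 2 + n"
      by (cases n) (simp_all add: algebra_simps)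
    hence "norm (t ^ (Suc n * (Suc n - 1) div 2) * \<rho> ^ Suc n) =
        (t ^ n * \<rho>) * norm (t ^ (n * (n - 1) div 2) * \<rho> ^ n)"
      using t \<rho> by (simp add: power_add)
    also have "\<dots> \<le> 1 / 2 * norm (t ^ (n * (n - 1) div 2) * \<rho> ^ n)"
      using N[OF n] by (intro mult_right_mono) auto
    finally show "norm (t ^ (Suc n * (Suc n - 1) div 2) * \<rho> ^ Suc n) \<le>
      1 / 2 * norm (t ^ (n * (n - 1) div 2) * \<rho> ^ n)" .
  qed simp
qed

text \<open>The factor \<open>\<rho> powi \<bar>r\<bar>\<close> dominates \<open>z powi r\<close> on a whole annulus, so this is the majorant
  for all the bilateral series below.\<close>

lemma summable_on_gaussian:
  fixes t \<rho> :: real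
  assumes t: "0 < t" "t < 1" and \<rho>: "0 < \<rho>"
  shows "(\<lambda>r::int. t powi (r * (r - 1) div 2) * \<rho> powi \<bar>r\<bar>) summable_on UNIV"
proof -
  let ?f = "\<lambda>r::int. t powi (r * (r - 1) div 2) * \<rho> powi \<bar>r\<bar>"
  let ?g = "\<lambda>n::nat. t ^ (n * (n - 1) div 2) * \<rho> ^ n"
  have g: "?g summable_on UNIV"
    using summable_gaussian_nat[OF assms] t \<rho> by (subst summable_on_UNIV_nonneg_real_iff) auto
  have pos: "?f (int n) = ?g n" for n
  proof -
    have "int n * (int n - 1) div 2 = int (n * (n - 1) div 2)"
      by (cases n) (simp_all add: zdiv_int distrib_right)
    thus ?thesis by simp
  qed
  have neg: "?f (- int n) \<le> ?g n" for n
  proof -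
    have "(- int n) * (- int n - 1) div 2 = int (n * (n + 1) div 2)"
      by (simp add: zdiv_int algebra_simps)
    hence "?f (- int n) = t ^ (n * (n + 1) div 2) * \<rho> ^ n" by simp
    also have "\<dots> \<le> ?g n"
      using t \<rho> by (intro mult_right_mono power_decreasing div_le_mono mult_le_mono) auto
    finally show ?thesis .
  qed
  have "(\<lambda>n. ?f (- int n)) summable_on UNIV"
    by (rule summable_on_comparison_test[OF g]) (use neg t \<rho> in auto)
  hence 1: "?f summable_on range (\<lambda>n. - int n)"
    by (subst summable_on_reindex) (auto simp: inj_on_def o_def)
  have "(\<lambda>n. ?f (int n)) summable_on UNIV" using g by (simp only: pos)
  hence 2: "?f summable_on range int"
    by (subst summable_on_reindex) (auto simp: inj_on_def o_def)
  have "range (\<lambda>n. - int n) \<union> range int = UNIV"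
  proof -
    have "r \<in> range (\<lambda>n. - int n) \<union> range int" for r :: int
      by (cases r rule: int_cases2) auto
    thus ?thesis by blast
  qed
  thus ?thesis using summable_on_union[OF 1 2] by simp
qed

lemma infsum_holomorphic:
  fixes f :: "'a \<Rightarrow> complex \<Rightarrow> complex"
  assumes S: "open S" and hol: "\<And>r. r \<in> I \<Longrightarrow> f r holomorphic_on S"
    and bound: "\<And>z. z \<in> S \<Longrightarrow> \<exists>e M. 0 < e \<and> cball z e \<subseteq> S \<and> M summable_on I \<and>
      (\<forall>r\<in>I. \<forall>w\<in>cball z e. norm (f r w) \<le> M r)"
  shows "(\<lambda>z. \<Sum>\<^sub>\<infinity>r\<in>I. f r z) holomorphic_on S"
proof -
  have "\<exists>e>0. (\<lambda>z. \<Sum>\<^sub>\<infinity>r\<in>I. f r z) holomorphic_on ball z e" if z: "z \<in> S" for z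
  proof -
    obtain e M where e: "0 < e" "cball z e \<subseteq> S" "M summable_on I"
      "\<And>r w. r \<in> I \<Longrightarrow> w \<in> cball z e \<Longrightarrow> norm (f r w) \<le> M r"
      using bound[OF z] by blast
    have lim: "uniform_limit (cball z e) (\<lambda>X w. \<Sum>r\<in>X. f r w) (\<lambda>w. \<Sum>\<^sub>\<infinity>r\<in>I. f r w)
        (finite_subsets_at_top I)"
      by (rule Weierstrass_m_test_general[OF e(4,3)])
    have "\<forall>\<^sub>F X in finite_subsets_at_top I. continuous_on (cball z e) (\<lambda>w. \<Sum>r\<in>X. f r w) \<and>
        (\<lambda>w. \<Sum>r\<in>X. f r w) holomorphic_on ball z e"
    proof (rule eventually_finite_subsets_at_top_weakI)
      fix X assume "finite X" "X \<subseteq> I"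
      hence "(\<lambda>w. \<Sum>r\<in>X. f r w) holomorphic_on S" using hol by (intro holomorphic_intros) auto
      thus "continuous_on (cball z e) (\<lambda>w. \<Sum>r\<in>X. f r w) \<and>
          (\<lambda>w. \<Sum>r\<in>X. f r w) holomorphic_on ball z e"
        using e(2) ball_subset_cball[of z e]
        by (meson holomorphic_on_imp_continuous_on holomorphic_on_subset order_trans)
    qed
    from holomorphic_uniform_limit[OF this lim] show ?thesis using e(1) by auto
  qed
  thus ?thesis
    using S by (metis holomorphic_on_def holomorphic_on_imp_differentiable_at open_ball
        centre_in_ball field_differentiable_at_within)
qed

lemma norm_powi_le:
  fixes z :: complex
  assumes "1 / \<rho> \<le> norm z" "norm z \<le> \<rho>" "0 < \<rho>"
  shows "norm (z powi r) \<le> \<rho> powi \<bar>r\<bar>"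
proof (cases "0 \<le> r")
  case True
  thus ?thesis using assms by (simp add: norm_power_int power_int_mono)
next
  case False
  have z: "0 < norm z" using assms by (meson divide_pos_pos less_le_trans zero_less_one)
  have "norm (z powi r) = (1 / norm z) powi (- r)"
    using z by (simp add: norm_power_int power_int_minus power_int_divide_distrib field_simps)
  also have "\<dots> \<le> \<rho> powi (- r)"
    using False assms z by (intro power_int_mono) (auto simp: field_simps)
  finally show ?thesis using False by simp
qed

text \<open>The general coefficient \<open>b\<close> covers both the bilateral theta series (\<open>b = 1\<close>) and the
  numerator of the Appell function (\<open>b r = 1 / (1 - q^(r - 1) y)\<close>).\<close>

definition theta_series :: "(int \<Rightarrow> complex) \<Rightarrow> complex \<Rightarrow> complex \<Rightarrow> complex" where
  "theta_series b q z =
     (\<Sum>\<^sub>\<infinity>r. (-1) powi r * q powi (r * (r - 1) div 2) * z powi r * b r)"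

lemma theta_series_term_bound:
  assumes q: "nome q" and b: "\<And>r. norm (b r) \<le> B" and "1 / \<rho> \<le> norm z" "norm z \<le> \<rho>" "0 < \<rho>"
  shows "norm ((-1) powi r * q powi (r * (r - 1) div 2) * z powi r * b r) \<le>
    norm q powi (r * (r - 1) div 2) * \<rho> powi \<bar>r\<bar> * B"
proof -
  have "norm ((-1) powi r * q powi (r * (r - 1) div 2) * z powi r * b r) =
      norm q powi (r * (r - 1) div 2) * norm (z powi r) * norm (b r)"
    by (simp add: norm_mult norm_power_int)
  also have "\<dots> \<le> norm q powi (r * (r - 1) div 2) * \<rho> powi \<bar>r\<bar> * B"
    using b[of r] norm_powi_le[OF assms(3-5), of r] assms(5)
    by (intro mult_mono mult_nonneg_nonneg) auto
  finally show ?thesis .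
qed

lemma theta_series_summable:
  assumes q: "nome q" and b: "\<And>r. norm (b r) \<le> B" and z: "z \<noteq> 0"
  shows "(\<lambda>r. (-1) powi r * q powi (r * (r - 1) div 2) * z powi r * b r) summable_on UNIV"
proof -
  define \<rho> where "\<rho> = max (norm z) (1 / norm z)"
  have \<rho>: "1 / \<rho> \<le> norm z" "norm z \<le> \<rho>" "0 < \<rho>"
    using z by (auto simp: \<rho>_def max_def field_simps split: if_splits)
  have "(\<lambda>r. norm q powi (r * (r - 1) div 2) * \<rho> powi \<bar>r\<bar> * B) summable_on UNIV"
    using q \<rho> by (intro summable_on_cmult_left summable_on_gaussian) (auto simp: nome_def)
  thus ?thesis
    by (rule abs_summable_summable[OF summable_on_comparison_test])
      (use theta_series_term_bound[OF q b \<rho>] in auto)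
qed

lemma theta_series_holomorphic:
  assumes q: "nome q" and b: "\<And>r. norm (b r) \<le> B"
  shows "theta_series b q holomorphic_on - {0}"
  unfolding theta_series_def[abs_def]
proof (rule infsum_holomorphic)
  fix z :: complex assume "z \<in> - {0}"
  hence z: "norm z > 0" by simp
  define \<rho> where "\<rho> = max (2 * norm z) (2 / norm z)"
  have \<rho>: "1 / \<rho> \<le> norm w" "norm w \<le> \<rho>" "0 < \<rho>" if "w \<in> cball z (norm z / 2)" for w
  proof -
    have "norm z / 2 \<le> norm w" "norm w \<le> 2 * norm z"
      using that norm_triangle_ineq2[of z w] norm_triangle_ineq2[of w z]
      by (auto simp: dist_norm norm_minus_commute)
    moreover have "1 / \<rho> \<le> norm z / 2" "2 * norm z \<le> \<rho>" "0 < \<rho>"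
      using z by (auto simp: \<rho>_def max_def field_simps split: if_splits)
    ultimately show "1 / \<rho> \<le> norm w" "norm w \<le> \<rho>" "0 < \<rho>" by linarith+
  qed
  let ?M = "\<lambda>r. norm q powi (r * (r - 1) div 2) * \<rho> powi \<bar>r\<bar> * B"
  have "?M summable_on UNIV"
    using q \<rho>(3)[of z] by (intro summable_on_cmult_left summable_on_gaussian) (auto simp: nome_def)
  moreover have "cball z (norm z / 2) \<subseteq> - {0}" using z by (auto simp: dist_norm)
  ultimately show "\<exists>e M. 0 < e \<and> cball z e \<subseteq> - {0} \<and> M summable_on UNIV \<and>
      (\<forall>r\<in>UNIV. \<forall>w\<in>cball z e. norm ((-1) powi r * q powi (r * (r - 1) div 2) * w powi r * b r) \<le> M r)"
    using z theta_series_term_bound[OF q b \<rho>]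
    by (intro exI[of _ "norm z / 2"] exI[of _ ?M]) auto
qed (auto intro!: holomorphic_intros)


lemma power_powi: "(x ^ numeral n) powi k = x powi (numeral n * k)" for x :: complex
  using power_int_mult[of x "numeral n" k] by simp

lemma triangular_int_succ: "(r + 1) * r div 2 = r * (r - 1) div 2 + (r :: int)"
proof -
  have "(r + 1) * r = r * (r - 1) + r * 2" by (simp add: algebra_simps)
  thus ?thesis by (simp only: div_mult_self1[OF zero_neq_numeral[symmetric]] add.commute)
qed

lemma triangular_int_double: "2 * (r * (r - 1) div 2) = r * (r - (1 :: int))"
proof -
  have "2 dvd r * (r - 1)" by simp
  thus ?thesis by (rule dvd_mult_div_cancel)
qed

text \<open>Shift the summation index by one.\<close>

lemma theta_series_shift:
  assumes q: "nome q" and z: "z \<noteq> 0"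
  shows "theta_series b q (q * z) = - theta_series (\<lambda>r. b (r - 1)) q z / z"
proof -
  have q0: "q \<noteq> 0" using nome_nonzero[OF q] .
  let ?c = "\<lambda>r::int. (-1) powi r * q powi (r * (r - 1) div 2) :: complex"
  have c: "?c (r + 1) = - (?c r * q powi r)" for r
    using q0 by (simp add: triangular_int_succ power_int_add)
  have "bij_betw (\<lambda>r. r + 1) (UNIV :: int set) UNIV"
    by (rule bij_betwI[of _ _ _ "\<lambda>r. r - 1"]) auto
  from infsum_reindex_bij_betw[OF this, of "\<lambda>r. ?c r * z powi r * b (r - 1)"]
  have "theta_series (\<lambda>r. b (r - 1)) q z = (\<Sum>\<^sub>\<infinity>r. ?c (r + 1) * z powi (r + 1) * b r)"
    by (simp add: theta_series_def)
  also have "\<dots> = (\<Sum>\<^sub>\<infinity>r. (- z) * (?c r * (q * z) powi r * b r))"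
    unfolding c using z by (intro infsum_cong) (simp add: power_int_add power_int_mult_distrib mult_ac)
  also have "\<dots> = - z * theta_series b q (q * z)"
    by (simp only: theta_series_def infsum_cmult_right')
  finally show ?thesis using z by (simp add: field_simps)
qed

definition bilateral_theta :: "complex \<Rightarrow> complex \<Rightarrow> complex" where
  "bilateral_theta = theta_series (\<lambda>_. 1)"

lemma bilateral_theta_shift:
  "nome q \<Longrightarrow> z \<noteq> 0 \<Longrightarrow> bilateral_theta q (q * z) = - bilateral_theta q z / z"
  unfolding bilateral_theta_def by (rule theta_series_shift)

lemma bilateral_theta_holomorphic: "nome q \<Longrightarrow> bilateral_theta q holomorphic_on - {0}"
  unfolding bilateral_theta_def by (rule theta_series_holomorphic[of _ _ 1]) auto

text \<open>The terms with indices \<open>r\<close> and \<open>1 - r\<close> cancel.\<close>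

lemma bilateral_theta_1:
  assumes "nome q" shows "bilateral_theta q 1 = 0"
proof -
  let ?c = "\<lambda>r::int. (-1) powi r * q powi (r * (r - 1) div 2) :: complex"
  have "bij_betw (\<lambda>r. 1 - r) (UNIV :: int set) UNIV"
    by (rule bij_betwI[of _ _ _ "\<lambda>r. 1 - r"]) auto
  from infsum_reindex_bij_betw[OF this, of ?c]
  have "bilateral_theta q 1 = (\<Sum>\<^sub>\<infinity>r. ?c (1 - r))"
    by (simp add: bilateral_theta_def theta_series_def)
  also have "\<dots> = (\<Sum>\<^sub>\<infinity>r. - ?c r)"
  proof (rule infsum_cong)
    fix r :: int
    have "(-1) powi r * (-1) powi r = (1 :: complex)"
      by (simp flip: power_int_mult_distrib)
    hence "(-1) powi (1 - r) = - ((-1) powi r :: complex)"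
      by (simp add: power_int_diff field_simps)
    moreover have "(1 - r) * (1 - r - 1) = r * (r - 1)" by (simp add: algebra_simps)
    ultimately show "?c (1 - r) = - ?c r" by (simp only: mult_minus_left)
  qed
  also have "\<dots> = - bilateral_theta q 1"
    by (simp add: infsum_uminus bilateral_theta_def theta_series_def)
  finally show ?thesis by simp
qed

text \<open>The bilateral series is a constant multiple of the product, and this is the constant, read
  off at \<open>-1\<close>, where the product does not vanish. (Jacobi's triple product says that it is \<open>1\<close>.)\<close>

definition theta_ratio :: "complex \<Rightarrow> complex" where
  "theta_ratio q = bilateral_theta q (- 1) / Theta (- 1) q"

lemma bilateral_theta_eq:
  assumes q: "nome q" and z: "z \<noteq> 0"
  shows "bilateral_theta q z = theta_ratio q * Theta z q"
proof -
  have nz: "Theta (- 1) q \<noteq> 0" by (rule Theta_unit_circle_nonzero[OF q]) auto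
  define f where "f = (\<lambda>z. bilateral_theta q z - theta_ratio q * Theta z q)"
  have "f z = 0"
  proof (rule theta_space_eq_0[OF q, where f = f and n = 1 and C = "- 1" and as = "[1, - 1]"])
    show "f holomorphic_on - {0}"
      unfolding f_def by (intro holomorphic_intros Theta_holomorphic bilateral_theta_holomorphic q)
    show "x ^ 1 * f (q * x) = - 1 * f x" if "x \<noteq> 0" for x
      using that by (simp add: f_def Theta_shift[OF q that] bilateral_theta_shift[OF q that] field_simps)
    show "a \<noteq> 0 \<and> f a = 0" if "a \<in> set [1, - 1]" for a
      using that q nz bilateral_theta_1[OF q] by (auto simp: f_def theta_ratio_def nome_def)
  qed (use z nz in auto)
  thus ?thesis by (simp add: f_def)
qed

text \<open>Split the sum into even and odd indices.\<close>

lemma bilateral_theta_even_odd_parts: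
  assumes q: "nome q" and w: "w \<noteq> 0"
  shows "bilateral_theta q w =
    bilateral_theta (q ^ 4) (- (q * w\<^sup>2)) - w * bilateral_theta (q ^ 4) (- (q ^ 3 * w\<^sup>2))"
proof -
  have q0: "q \<noteq> 0" using nome_nonzero[OF q] .
  define F where "F = (\<lambda>r::int. (-1) powi r * q powi (r * (r - 1) div 2) * w powi r * 1 :: complex)"
  have F: "F summable_on UNIV"
    unfolding F_def by (rule theta_series_summable[OF q _ w, of _ 1]) auto
  have E: "range (\<lambda>m::int. 2 * m) \<union> range (\<lambda>m. 2 * m + 1) = UNIV"
  proof -
    have "r \<in> range (\<lambda>m::int. 2 * m) \<union> range (\<lambda>m. 2 * m + 1)" for r
      by (cases "even r") (auto elim!: evenE oddE)
    thus ?thesis by blast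
  qed
  have ne: "2 * m \<noteq> 2 * n + 1" for m n :: int by presburger
  have disj: "range (\<lambda>m::int. 2 * m) \<inter> range (\<lambda>m. 2 * m + 1) = {}"
    unfolding disjoint_iff image_iff using ne by metis
  have "infsum F UNIV = infsum F (range (\<lambda>m. 2 * m)) + infsum F (range (\<lambda>m. 2 * m + 1))"
    using infsum_Un_disjoint[OF summable_on_subset_banach[OF F subset_UNIV]
        summable_on_subset_banach[OF F subset_UNIV] disj] by (simp only: E)
  also have "infsum F (range (\<lambda>m. 2 * m)) = (\<Sum>\<^sub>\<infinity>m. F (2 * m))"
    by (subst infsum_reindex) (auto simp: inj_on_def o_def)
  also have "\<dots> = bilateral_theta (q ^ 4) (- (q * w\<^sup>2))"
    unfolding bilateral_theta_def theta_series_def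
  proof (rule infsum_cong)
    fix m :: int
    have "(2 * m) * (2 * m - 1) div 2 = m * (2 * m - 1)"
      by (simp only: mult.assoc nonzero_mult_div_cancel_left[OF zero_neq_numeral[symmetric]])
    moreover have "4 * (m * (m - 1) div 2) = 2 * (m * (m - 1))"
      using triangular_int_double[of m] by simp
    ultimately have e: "(2 * m) * (2 * m - 1) div 2 = 4 * (m * (m - 1) div 2) + m"
      by (simp add: algebra_simps)
    have p4: "(q ^ 4) powi k = q powi (4 * k)" for k by (rule power_powi)
    have w2: "(w\<^sup>2) powi k = w powi (2 * k)" for k by (rule power_powi)
    have "(- (q * w\<^sup>2)) powi m = (-1) powi m * q powi m * w powi (2 * m)"
      using power_int_mult_distrib[of "- 1" "q * w\<^sup>2" m] by (simp add: power_int_mult_distrib w2)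
    moreover have "(-1) powi m * (-1) powi m = (1 :: complex)"
      by (simp flip: power_int_mult_distrib)
    ultimately show "F (2 * m) = (-1) powi m * (q ^ 4) powi (m * (m - 1) div 2) * (- (q * w\<^sup>2)) powi m * 1"
      unfolding F_def e p4 using q0 by (simp add: power_int_add power_int_mult)
  qed
  also have "infsum F (range (\<lambda>m. 2 * m + 1)) = (\<Sum>\<^sub>\<infinity>m. F (2 * m + 1))"
    by (subst infsum_reindex) (auto simp: inj_on_def o_def)
  also have "\<dots> = (\<Sum>\<^sub>\<infinity>m. (- w) * ((-1) powi m * (q ^ 4) powi (m * (m - 1) div 2) * (- (q ^ 3 * w\<^sup>2)) powi m * 1))"
  proof (rule infsum_cong)
    fix m :: int
    have "(2 * m + 1) * ((2 * m + 1) - 1) div 2 = (2 * m + 1) * m"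
    proof -
      have "(2 * m + 1) * ((2 * m + 1) - 1) = 2 * ((2 * m + 1) * m)" by (simp add: algebra_simps)
      thus ?thesis by (simp only: nonzero_mult_div_cancel_left[OF zero_neq_numeral[symmetric]])
    qed
    moreover have "4 * (m * (m - 1) div 2) = 2 * (m * (m - 1))"
      using triangular_int_double[of m] by simp
    ultimately have e: "(2 * m + 1) * ((2 * m + 1) - 1) div 2 = 4 * (m * (m - 1) div 2) + 3 * m"
      by (simp add: algebra_simps)
    have p4: "(q ^ 4) powi k = q powi (4 * k)" for k by (rule power_powi)
    have p3: "(q ^ 3) powi k = q powi (3 * k)" for k by (rule power_powi)
    have w2: "(w\<^sup>2) powi k = w powi (2 * k)" for k by (rule power_powi)
    have "(- (q ^ 3 * w\<^sup>2)) powi m = (-1) powi m * q powi (3 * m) * w powi (2 * m)"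
      using power_int_mult_distrib[of "- 1" "q ^ 3 * w\<^sup>2" m] by (simp add: power_int_mult_distrib w2 p3)
    moreover have "(-1) powi m * (-1) powi m = (1 :: complex)"
      by (simp flip: power_int_mult_distrib)
    ultimately show "F (2 * m + 1) =
        (- w) * ((-1) powi m * (q ^ 4) powi (m * (m - 1) div 2) * (- (q ^ 3 * w\<^sup>2)) powi m * 1)"
      unfolding F_def e p4 using q0 w by (simp add: power_int_add power_int_mult)
  qed
  also have "\<dots> = - w * bilateral_theta (q ^ 4) (- (q ^ 3 * w\<^sup>2))"
    unfolding bilateral_theta_def theta_series_def by (rule infsum_cmult_right')
  finally show ?thesis by (simp add: bilateral_theta_def theta_series_def F_def)
qed

text \<open>The bilateral series and the product satisfy the same even-odd splitting.\<close>

lemma theta_ratio_power_4: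
  assumes q: "nome q"
  shows "theta_ratio (q ^ 4) = theta_ratio q"
proof -
  have q0: "q \<noteq> 0" using nome_nonzero[OF q] .
  have q4: "nome (q ^ 4)" by (rule nome_power[OF q]) simp
  have nz: "Theta (- 1) q \<noteq> 0" by (rule Theta_unit_circle_nonzero[OF q]) auto
  have "theta_ratio q * Theta (- 1) q = theta_ratio (q ^ 4) * Theta (- 1) q"
    using bilateral_theta_even_odd_parts[OF q, of "- 1"] Theta_even_odd_parts[OF q, of "- 1"] q0
    by (simp add: bilateral_theta_eq[OF q] bilateral_theta_eq[OF q4] algebra_simps)
  thus ?thesis using nz by simp
qed

section \<open>Appell series\<close>

text \<open>The quotient \<open>|1 - q^(r - 1) y| / (1 + |q^(r - 1)|)\<close> tends to \<open>1\<close> or to \<open>|y|\<close> as \<open>r\<close> tends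
  to infinity in either direction, so only finitely many \<open>r\<close> need individual attention. The
  summand with \<open>q^(r - 1)\<close> in the bound makes it stable under small changes of \<open>y\<close>.\<close>

lemma appell_denominator_bound:
  assumes q: "nome q" and y: "y \<noteq> 0" and I: "\<And>r. r \<in> I \<Longrightarrow> q powi (r - 1) * y \<noteq> 1"
  obtains \<delta> where "0 < \<delta>" "\<And>r. r \<in> I \<Longrightarrow> \<delta> * (1 + norm (q powi (r - 1))) \<le> norm (1 - q powi (r - 1) * y)"
proof -
  define u where "u = (\<lambda>r. norm (q powi (r - 1)))"
  have q': "0 < norm q" "norm q < 1" "ln (norm q) < 0" using q by (auto simp: nome_def)
  have u_pos: "0 < u r" for r using q' by (auto simp: u_def)
  define a where "a = norm y"
  have a: "0 < a" using y by (simp add: a_def)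
  have ln_u: "ln (u r) = of_int (r - 1) * ln (norm q)" for r
  proof -
    have "u r = norm q powr of_int (r - 1)"
      using powr_real_of_int'[of "norm q" "r - 1"] q' by (simp add: u_def norm_power_int)
    thus ?thesis using q' by (simp add: ln_powr)
  qed
  define F where "F = {r \<in> I. 1 / (2 * a) < u r \<and> u r < 2 / a}"
  have "F \<subseteq> {\<lfloor>ln (2 / a) / ln (norm q)\<rfloor>..\<lceil>ln (1 / (2 * a)) / ln (norm q)\<rceil> + 1}"
  proof
    fix r assume "r \<in> F"
    hence "1 / (2 * a) < u r" "u r < 2 / a" by (auto simp: F_def)
    hence "ln (1 / (2 * a)) < ln (u r)" "ln (u r) < ln (2 / a)"
      using a u_pos[of r] by (subst ln_less_cancel_iff; simp)+
    hence "of_int (r - 1) < ln (1 / (2 * a)) / ln (norm q)" "ln (2 / a) / ln (norm q) < of_int (r - 1)"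
      unfolding ln_u using q' by (simp_all add: field_simps)
    thus "r \<in> {\<lfloor>ln (2 / a) / ln (norm q)\<rfloor>..\<lceil>ln (1 / (2 * a)) / ln (norm q)\<rceil> + 1}"
      unfolding atLeastAtMost_iff by linarith
  qed
  hence F: "finite F" by (rule finite_subset) auto
  define g where "g = (\<lambda>r. norm (1 - q powi (r - 1) * y) / (1 + u r))"
  have g_pos: "0 < g r" if "r \<in> I" for r
    using I[OF that] u_pos[of r] by (simp add: g_def add_pos_pos)
  \<comment> \<open>The three explicit values serve small \<open>u r\<close>, where the denominator is near \<open>1\<close>, and large \<open>u r\<close>.\<close>
  define \<delta> where "\<delta> = Min ({(1 / 2) / (1 + 1 / (2 * a)), a / 4, 1 / 2} \<union> g ` F)"
  have fin: "finite ({(1 / 2) / (1 + 1 / (2 * a)), a / 4, 1 / 2} \<union> g ` F)" using F by simp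
  have "0 < (1 / 2) / (1 + 1 / (2 * a))" using a by (intro divide_pos_pos add_pos_pos) auto
  hence "0 < \<delta>"
    unfolding \<delta>_def using fin a g_pos by (subst Min_gr_iff) (auto simp: F_def)
  moreover have "\<delta> * (1 + norm (q powi (r - 1))) \<le> norm (1 - q powi (r - 1) * y)" if r: "r \<in> I" for r
  proof -
    have n: "norm (q powi (r - 1) * y) = u r * a" by (simp add: u_def a_def norm_mult)
    have \<delta>: "\<delta> \<le> (1 / 2) / (1 + 1 / (2 * a))" "\<delta> \<le> a / 4" "\<delta> \<le> 1 / 2"
      unfolding \<delta>_def by (rule Min_le[OF fin]; simp)+
    consider "u r \<le> 1 / (2 * a)" | "2 / a \<le> u r" | "r \<in> F" using r by (fastforce simp: F_def)
    thus ?thesis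
    proof cases
      case 1
      have "\<delta> * (1 + u r) \<le> (1 / 2) / (1 + 1 / (2 * a)) * (1 + 1 / (2 * a))"
        using \<delta>(1) 1 \<open>0 < \<delta>\<close> u_pos[of r] a by (intro mult_mono) auto
      also have "\<dots> = 1 / 2"
        using a by (simp add: add_pos_pos less_imp_neq[symmetric])
      also have "\<dots> \<le> 1 - u r * a" using 1 a by (simp add: field_simps)
      also have "\<dots> \<le> norm (1 - q powi (r - 1) * y)"
        using norm_triangle_ineq2[of 1 "q powi (r - 1) * y"] by (simp add: n)
      finally show ?thesis by (simp add: u_def)
    next
      case 2
      have "\<delta> * (1 + u r) \<le> 1 / 2 + a / 4 * u r"
        unfolding distrib_left mult_1_right
        by (intro add_mono mult_right_mono \<delta> less_imp_le[OF u_pos])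
      also have "\<dots> \<le> u r * a - 1" using 2 a by (simp add: field_simps)
      also have "\<dots> \<le> norm (1 - q powi (r - 1) * y)"
        using norm_triangle_ineq2[of "q powi (r - 1) * y" 1] by (simp add: n norm_minus_commute)
      finally show ?thesis by (simp add: u_def)
    next
      case 3
      hence "\<delta> \<le> g r" unfolding \<delta>_def by (intro Min_le[OF fin]) auto
      thus ?thesis using u_pos[of r] by (simp add: g_def u_def field_simps add_pos_pos)
    qed
  qed
  ultimately show ?thesis using that by blast
qed

definition appell_coeff :: "complex \<Rightarrow> complex \<Rightarrow> int \<Rightarrow> complex" where
  "appell_coeff y q r = 1 / (1 - q powi (r - 1) * y)"

definition appell_series :: "complex \<Rightarrow> complex \<Rightarrow> complex \<Rightarrow> complex" where
  "appell_series y q = theta_series (appell_coeff y q) q"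

lemma appell_m_eq: "appell_m x z q = appell_series (x * z) q z / Theta z q"
  by (simp add: appell_m_def appell_series_def theta_series_def appell_coeff_def mult.assoc)

lemma appell_denominator_nonzero:
  assumes "nome q" "y \<noteq> 0" "Theta y q \<noteq> 0"
  shows "q powi k * y \<noteq> 1"
proof
  assume "q powi k * y = 1"
  hence "y = q powi (- k)" using nome_nonzero[OF assms(1)] by (simp add: power_int_minus field_simps)
  thus False using Theta_eq_0_iff[OF assms(1,2)] assms(3) by blast
qed

lemma appell_coeff_bounded:
  assumes "nome q" "y \<noteq> 0" "Theta y q \<noteq> 0"
  obtains B where "\<And>r. norm (appell_coeff y q r) \<le> B"
proof -
  obtain \<delta> where \<delta>: "0 < \<delta>" "\<And>r. \<delta> * (1 + norm (q powi (r - 1))) \<le> norm (1 - q powi (r - 1) * y)"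
    using appell_denominator_bound[OF assms(1,2), of UNIV] appell_denominator_nonzero[OF assms] by auto
  have "norm (appell_coeff y q r) \<le> 1 / \<delta>" for r
  proof -
    have "\<delta> * 1 \<le> \<delta> * (1 + norm (q powi (r - 1)))" using \<delta>(1) by (intro mult_left_mono) auto
    hence "\<delta> \<le> norm (1 - q powi (r - 1) * y)" using \<delta>(2)[of r] by linarith
    thus ?thesis using \<delta>(1) by (simp add: appell_coeff_def norm_divide frac_le)
  qed
  thus ?thesis using that by blast
qed

lemma appell_series_holomorphic:
  assumes "nome q" "y \<noteq> 0" "Theta y q \<noteq> 0"
  shows "appell_series y q holomorphic_on - {0}"
  unfolding appell_series_def
  using appell_coeff_bounded[OF assms] theta_series_holomorphic[OF assms(1)] by metis

text \<open>Since \<open>q^r (y/q) = q^(r - 1) y\<close>, the combination \<open>f_y(z) - (y/q) f_y(qz)\<close> cancels all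
  denominators.\<close>

lemma appell_series_shift:
  assumes q: "nome q" and y: "y \<noteq> 0" "Theta y q \<noteq> 0" and z: "z \<noteq> 0"
  shows "appell_series y q (q * z) = q / y * (appell_series y q z - bilateral_theta q z)"
proof -
  have q0: "q \<noteq> 0" using nome_nonzero[OF q] .
  let ?c = "\<lambda>r::int. (-1) powi r * q powi (r * (r - 1) div 2) :: complex"
  let ?b = "appell_coeff y q"
  obtain B where B: "\<And>r. norm (?b r) \<le> B" using appell_coeff_bounded[OF q y] by blast
  have s1: "(\<lambda>r. ?c r * z powi r * ?b r) summable_on UNIV"
    by (rule theta_series_summable[OF q B z])
  have s2: "(\<lambda>r. ?c r * (q * z) powi r * ?b r) summable_on UNIV"
    by (rule theta_series_summable[OF q B]) (use z q0 in auto)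
  have "appell_series y q z + (- (y / q)) * appell_series y q (q * z) =
      (\<Sum>\<^sub>\<infinity>r. ?c r * z powi r * ?b r + (- (y / q)) * (?c r * (q * z) powi r * ?b r))"
    unfolding appell_series_def theta_series_def infsum_cmult_right'[symmetric]
    by (rule infsum_add[symmetric, OF s1 summable_on_cmult_right[OF s2]])
  also have "\<dots> = bilateral_theta q z"
    unfolding bilateral_theta_def theta_series_def
  proof (rule infsum_cong)
    fix r :: int
    have nz: "1 - q powi (r - 1) * y \<noteq> 0" using appell_denominator_nonzero[OF q y, of "r - 1"] by simp
    have "?c r * z powi r * ?b r + (- (y / q)) * (?c r * (q * z) powi r * ?b r) =
        ?c r * z powi r * ((1 - q powi (r - 1) * y) * ?b r)"
      using q0 by (simp add: power_int_mult_distrib power_int_diff algebra_simps)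
    thus "?c r * z powi r * ?b r + (- (y / q)) * (?c r * (q * z) powi r * ?b r) = ?c r * z powi r * 1"
      using nz by (simp add: appell_coeff_def)
  qed
  finally show ?thesis using q0 y(1) by (simp add: field_simps)
qed

text \<open>Shift the index and use \<open>1/(d (1 - d y)) = 1/d + y/(1 - d y)\<close> with \<open>d = q^(r - 1)\<close>; the
  part without denominators is the bilateral theta series at \<open>1/q\<close>, which vanishes.\<close>

lemma appell_series_1_shift:
  assumes q: "nome q" and y: "y \<noteq> 0" "Theta y q \<noteq> 0"
  shows "appell_series (q * y) q 1 = - y * appell_series y q 1"
proof -
  have q0: "q \<noteq> 0" using nome_nonzero[OF q] .
  let ?c = "\<lambda>r::int. (-1) powi r * q powi (r * (r - 1) div 2) :: complex"
  let ?b = "appell_coeff y q"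
  obtain B where B: "\<And>r. norm (?b r) \<le> B" using appell_coeff_bounded[OF q y] by blast
  have s1: "(\<lambda>r. ?c r * 1 powi r * ?b r) summable_on UNIV"
    by (rule theta_series_summable[OF q B]) auto
  have s2: "(\<lambda>r. ?c r * (1 / q) powi r * 1) summable_on UNIV"
    by (rule theta_series_summable[OF q, of _ 1]) (use q0 in auto)
  have b_shift: "appell_coeff (q * y) q r = ?b (r + 1)" for r
    using q0 by (simp add: appell_coeff_def power_int_diff field_simps)
  have "appell_series (q * y) q 1 = theta_series (\<lambda>r. ?b (r + 1)) q (q * (1 / q))"
    using q0 by (simp add: appell_series_def theta_series_def b_shift)
  also have "\<dots> = - theta_series ?b q (1 / q) / (1 / q)"
    using theta_series_shift[OF q, of "1 / q" "\<lambda>r. ?b (r + 1)"] q0 by simp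
  also have "\<dots> = - q * theta_series ?b q (1 / q)" by simp
  also have "\<dots> = (\<Sum>\<^sub>\<infinity>r. (- q) * (?c r * (1 / q) powi r * ?b r))"
    by (simp only: theta_series_def infsum_cmult_right')
  also have "\<dots> = (\<Sum>\<^sub>\<infinity>r. (- q) * (?c r * (1 / q) powi r * 1) + (- y) * (?c r * 1 powi r * ?b r))"
  proof (rule infsum_cong)
    fix r :: int
    have nz: "1 - q powi (r - 1) * y \<noteq> 0" using appell_denominator_nonzero[OF q y, of "r - 1"] by simp
    have "(1 / q) powi r * q powi r = 1" using q0 by (simp flip: power_int_mult_distrib)
    hence iq: "q * (1 / q) powi r * q powi (r - 1) = 1" using q0 by (simp add: power_int_diff)
    have "q * (1 / q) powi r * ?b r - y * ?b r = q * (1 / q) powi r * ((1 - q powi (r - 1) * y) * ?b r) +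
        (q * (1 / q) powi r * q powi (r - 1) - 1) * y * ?b r"
      by (simp add: algebra_simps)
    also have "\<dots> = q * (1 / q) powi r"
      using nz unfolding iq by (simp add: appell_coeff_def)
    finally have "q * (1 / q) powi r * ?b r = q * (1 / q) powi r + y * ?b r" by (simp add: diff_eq_eq)
    hence "?c r * (q * (1 / q) powi r * ?b r) = ?c r * (q * (1 / q) powi r + y * ?b r)" by simp
    thus "(- q) * (?c r * (1 / q) powi r * ?b r) =
        (- q) * (?c r * (1 / q) powi r * 1) + (- y) * (?c r * 1 powi r * ?b r)"
      by (simp add: algebra_simps)
  qed
  also have "\<dots> = - q * bilateral_theta q (1 / q) + - y * appell_series y q 1"
    unfolding bilateral_theta_def appell_series_def theta_series_def infsum_cmult_right'[symmetric]
    by (rule infsum_add[OF summable_on_cmult_right[OF s2] summable_on_cmult_right[OF s1]])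
  also have "bilateral_theta q (1 / q) = 0"
    using bilateral_theta_shift[OF q, of "1 / q"] bilateral_theta_1[OF q] q0 by simp
  finally show ?thesis by simp
qed


text \<open>As a function of \<open>y\<close>, the left-hand side is invariant under \<open>y \<mapsto> qy\<close>. Its only possible
  singularities are the powers of \<open>q\<close>, and by invariance it suffices to look at \<open>y = 1\<close>: there
  only the summand \<open>r = 1\<close>, which is \<open>-1/(1 - y)\<close>, is singular, and the zero of \<open>\<theta>\<close> cancels it.
  So the function extends holomorphically, is constant by \<open>multiplicative_Liouville\<close>, and its
  value is the one at \<open>1\<close>.\<close>

lemma appell_series_1:
  assumes q: "nome q" and y: "y \<noteq> 0" "Theta y q \<noteq> 0"
  shows "Theta y q * appell_series y q 1 = - (qpoch_inf q q ^ 3)"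
proof -
  have q': "0 < norm q" "norm q < 1" "q \<noteq> 0" using q by (auto simp: nome_def)
  define c where "c = (\<lambda>r::int. (-1) powi r * q powi (r * (r - 1) div 2))"
  define p where "p = (\<lambda>I y. \<Sum>\<^sub>\<infinity>r\<in>I. c r / (1 - q powi (r - 1) * y))"
  have p: "appell_series y q 1 = p UNIV y" for y
    by (simp add: appell_series_def theta_series_def appell_coeff_def p_def c_def)
  have "(\<lambda>r::int. norm q powi (r * (r - 1) div 2) * 1 powi \<bar>r\<bar>) summable_on UNIV"
    using q' by (intro summable_on_gaussian) auto
  hence c_summable: "(\<lambda>r. norm (c r)) summable_on I" for I
    using summable_on_subset_banach[of _ UNIV I] by (simp add: c_def norm_mult norm_power_int)
  \<comment> \<open>On the ball of radius \<open>\<delta>\<close> about \<open>w\<close> all denominators are at least \<open>\<delta>\<close>, so the series converges uniformly.\<close>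
  have p_diff: "p I field_differentiable at w"
    if w: "w \<noteq> 0" and I: "\<And>r. r \<in> I \<Longrightarrow> q powi (r - 1) * w \<noteq> 1" for I w
  proof -
    obtain \<delta> where \<delta>: "0 < \<delta>"
      "\<And>r. r \<in> I \<Longrightarrow> \<delta> * (1 + norm (q powi (r - 1))) \<le> norm (1 - q powi (r - 1) * w)"
      using appell_denominator_bound[OF q w I] by blast
    have den: "\<delta> \<le> norm (1 - q powi (r - 1) * v)" if v: "v \<in> ball w \<delta>" and r: "r \<in> I" for v r
    proof -
      have "1 - q powi (r - 1) * w = (1 - q powi (r - 1) * v) + q powi (r - 1) * (v - w)"
        by (simp add: algebra_simps)
      hence "norm (1 - q powi (r - 1) * w) \<le>
          norm (1 - q powi (r - 1) * v) + norm (q powi (r - 1) * (v - w))"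
        using norm_triangle_ineq by metis
      also have "norm (q powi (r - 1) * (v - w)) \<le> norm (q powi (r - 1)) * \<delta>"
        using v by (auto simp: norm_mult dist_norm norm_minus_commute intro!: mult_left_mono)
      finally show ?thesis using \<delta>(2)[OF r] by (simp add: algebra_simps)
    qed
    have "p I holomorphic_on ball w \<delta>"
      unfolding p_def
    proof (rule infsum_holomorphic)
      show "(\<lambda>v. c r / (1 - q powi (r - 1) * v)) holomorphic_on ball w \<delta>" if "r \<in> I" for r
        using den[OF _ that] \<delta>(1) by (intro holomorphic_intros) force
      fix v assume v: "v \<in> ball w \<delta>"
      then obtain e where e: "0 < e" "cball v e \<subseteq> ball w \<delta>"
        using open_contains_cball_eq[OF open_ball] by blast
      have "norm (c r / (1 - q powi (r - 1) * v')) \<le> norm (c r) / \<delta>" if "r \<in> I" "v' \<in> cball v e" for r v'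
      proof -
        have "v' \<in> ball w \<delta>" using e(2) that(2) by blast
        from den[OF this that(1)] show ?thesis
          using \<delta>(1) by (simp add: norm_divide frac_le)
      qed
      moreover have "(\<lambda>r. norm (c r) / \<delta>) summable_on I"
        using summable_on_cmult_left[OF c_summable, of "inverse \<delta>"] by (simp add: divide_inverse)
      ultimately show "\<exists>e M. 0 < e \<and> cball v e \<subseteq> ball w \<delta> \<and> M summable_on I \<and>
          (\<forall>r\<in>I. \<forall>v'\<in>cball v e. norm (c r / (1 - q powi (r - 1) * v')) \<le> M r)"
        using e by (intro exI[of _ e] exI[of _ "\<lambda>r. norm (c r) / \<delta>"]) auto
    qed auto
    thus ?thesis using \<delta>(1) by (intro holomorphic_on_imp_differentiable_at[of _ "ball w \<delta>"]) auto
  qed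
  \<comment> \<open>The value at the removable singularities is the limit \<open>-\<psi>(1)\<close> found in \<open>g_1\<close>.\<close>
  define g where "g = (\<lambda>y. if Theta y q = 0 then - (qpoch_inf q q ^ 3) else Theta y q * p UNIV y)"
  have g_shift: "g (q * w) = g w" if "w \<noteq> 0" for w
    using Theta_shift[OF q that] appell_series_1_shift[OF q that] that by (simp add: g_def p)
  have T_diff: "(\<lambda>y. Theta y q) field_differentiable at w" if "w \<noteq> 0" for w
    using Theta_holomorphic[OF q] that by (intro holomorphic_on_imp_differentiable_at[of _ "- {0}"]) auto
  have nz: "\<forall>\<^sub>F v in nhds w. u v \<noteq> 0" if "u field_differentiable at w" "u w \<noteq> 0"
    for u :: "complex \<Rightarrow> complex" and w
    using tendsto_imp_eventually_ne[OF isContD[OF field_differentiable_imp_continuous_at[OF that(1)]] that(2)] that(2)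
    by (simp add: eventually_nhds_conv_at)
  have cong: "v field_differentiable at w"
    if "u field_differentiable at w" "\<forall>\<^sub>F y in nhds w. u y = v y" for u v :: "complex \<Rightarrow> complex" and w
    using that(1) DERIV_cong_ev[OF refl that(2) refl] by (simp add: field_differentiable_def)
  have g_regular: "g field_differentiable at w" if w: "w \<noteq> 0" "Theta w q \<noteq> 0" for w
  proof (rule cong)
    show "(\<lambda>y. Theta y q * p UNIV y) field_differentiable at w"
      using appell_denominator_nonzero[OF q w]
      by (intro field_differentiable_mult T_diff p_diff w) auto
    show "\<forall>\<^sub>F y in nhds w. Theta y q * p UNIV y = g y"
      using nz[OF T_diff[OF w(1)] w(2)] by eventually_elim (simp add: g_def)
  qed
  have g_1: "g field_differentiable at 1"
  proof -
    obtain \<psi> where \<psi>: "\<psi> holomorphic_on - {0}" "\<psi> 1 = qpoch_inf q q ^ 3"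
        "\<And>x. Theta x q = (1 - x) * \<psi> x"
      using Theta_factor_1[OF q] by blast
    have \<psi>_diff: "\<psi> field_differentiable at 1"
      by (rule holomorphic_on_imp_differentiable_at[OF \<psi>(1)]) auto
    show ?thesis
    proof (rule cong)
      have "q powi (r - 1) * 1 \<noteq> 1" if "r \<in> - {1}" for r
        using nome_powi_norm_eq_1[OF q, of "r - 1"] that by auto
      thus "(\<lambda>y. - \<psi> y + Theta y q * p (- {1}) y) field_differentiable at 1"
        by (intro field_differentiable_add field_differentiable_mult field_differentiable_minus
            \<psi>_diff T_diff p_diff) auto
      have "\<forall>\<^sub>F y in nhds 1. \<psi> y \<noteq> 0"
        by (rule nz[OF \<psi>_diff]) (simp add: \<psi>(2) qpoch_self_nonzero[OF q])
      moreover have "\<forall>\<^sub>F y in nhds 1. y \<noteq> (0 :: complex)" by (rule t1_space_nhds) simp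
      ultimately show "\<forall>\<^sub>F y in nhds 1. - \<psi> y + Theta y q * p (- {1}) y = g y"
      proof eventually_elim
        case (elim y)
        show ?case
        proof (cases "y = 1")
          case True
          thus ?thesis using \<psi>(2) q' by (simp add: g_def)
        next
          case False
          hence T: "Theta y q \<noteq> 0" using \<psi>(3) elim by simp
          obtain B where B: "\<And>r. norm (appell_coeff y q r) \<le> B"
            using appell_coeff_bounded[OF q elim(2) T] by blast
          have "(\<lambda>r. c r / (1 - q powi (r - 1) * y)) summable_on UNIV"
            using theta_series_summable[OF q B, of 1] by (simp add: c_def appell_coeff_def)
          hence "(\<lambda>r. c r / (1 - q powi (r - 1) * y)) summable_on - {1}"
            by (rule summable_on_subset_banach) auto
          moreover have "insert 1 (- {1 :: int}) = UNIV" by auto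
          ultimately
          have "p UNIV y = - 1 / (1 - y) + p (- {1}) y"
            using infsum_insert[of "\<lambda>r. c r / (1 - q powi (r - 1) * y)" "- {1}" 1]
            by (simp add: p_def c_def)
          hence "Theta y q * p UNIV y = (1 - y) * \<psi> y * (- 1 / (1 - y)) + Theta y q * p (- {1}) y"
            by (simp only: \<psi>(3) distrib_left)
          also have "(1 - y) * \<psi> y * (- 1 / (1 - y)) = - \<psi> y" using False by simp
          finally show ?thesis using T by (simp add: g_def)
        qed
      qed
    qed
  qed
  have g_powers: "g field_differentiable at (q powi k)" for k :: int
  proof (induction k rule: int_induct[of _ 0])
    case base show ?case using g_1 by simp
  next
    case (step1 i)
    show ?case
    proof (rule cong)
      have "g field_differentiable at (q powi (i + 1) / q)"
        using step1 q' by (simp add: power_int_add)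
      thus "(\<lambda>w. g (w / q)) field_differentiable at (q powi (i + 1))"
        using field_differentiable_compose[of "\<lambda>w. w / q" "q powi (i + 1)" g] q'
        by (simp add: o_def field_differentiable_divide field_differentiable_ident)
      have "\<forall>\<^sub>F w in nhds (q powi (i + 1)). w \<noteq> 0" using q' by (intro t1_space_nhds) simp
      thus "\<forall>\<^sub>F w in nhds (q powi (i + 1)). g (w / q) = g w"
      proof eventually_elim
        case (elim w)
        thus ?case using g_shift[of "w / q"] q' by simp
      qed
    qed
  next
    case (step2 i)
    show ?case
    proof (rule cong)
      have "g field_differentiable at (q * q powi (i - 1))"
        using step2 q' by (simp add: power_int_diff)
      thus "(\<lambda>w. g (q * w)) field_differentiable at (q powi (i - 1))"
        using field_differentiable_compose[of "\<lambda>w. q * w" "q powi (i - 1)" g]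
        by (simp add: o_def field_differentiable_mult field_differentiable_ident)
      have "\<forall>\<^sub>F w in nhds (q powi (i - 1)). w \<noteq> 0" using q' by (intro t1_space_nhds) simp
      thus "\<forall>\<^sub>F w in nhds (q powi (i - 1)). g (q * w) = g w"
        by eventually_elim (rule g_shift)
    qed
  qed
  have "g field_differentiable at w" if "w \<noteq> 0" for w
    using g_regular[OF that] g_powers Theta_eq_0_iff[OF q that] by metis
  hence "g holomorphic_on - {0}"
    unfolding holomorphic_on_def by (auto intro: field_differentiable_at_within)
  moreover have "g (q * w) = 1 * g w" if "w \<noteq> 0" for w using g_shift[OF that] by simp
  ultimately obtain C k where C: "\<And>w. w \<noteq> 0 \<Longrightarrow> g w = C * w powi k" "C = 0 \<or> 1 = q powi k"
    using multiplicative_Liouville[OF q, of g 1] by metis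
  have g1: "g 1 = - (qpoch_inf q q ^ 3)" using q' by (simp add: g_def)
  hence "C = - (qpoch_inf q q ^ 3)" using C(1)[of 1] by simp
  moreover have "k = 0"
    using C(2) calculation qpoch_self_nonzero[OF q] nome_powi_norm_eq_1[OF q, of k]
    by (metis neg_equal_0_iff_equal norm_one power_not_zero)
  ultimately have "g y = - (qpoch_inf q q ^ 3)" using C(1)[OF y(1)] by simp
  thus ?thesis using y by (simp add: g_def p)
qed

section \<open>The general formula for D2\<close>

text \<open>The rational identity behind the quasi-periodicity of \<open>H\<close> in \<open>appell_series_quadratic\<close>,
  isolated so that the values of the special functions are variables. The terms containing \<open>k\<close>,
  which stem from the bilateral theta series, cancel.\<close>

lemma theta_quotient_shift_algebra:
  fixes q y t w :: complex
  assumes nz: "q \<noteq> 0" "y \<noteq> 0" "t \<noteq> 0" "w \<noteq> 0" and Y: "Y = - (q * t * y\<^sup>2)"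
  shows "w\<^sup>2 * (A * (q / y * (q / y * (f - k * \<theta>) - k * (- \<theta> / w)) * (- \<tau> / (t * w\<^sup>2)) -
      - (- \<theta> / w) / (q * w) *
        (q ^ 4 / Y * (a - k * \<tau>) - y / (q * (q\<^sup>2 * w)) * (q ^ 4 / (Y / q\<^sup>2) * (b - k * \<tau>)))) -
      t * (q\<^sup>2 * w)\<^sup>2 * J *
        (- T1 / (Y * w) * P * (- T2 / (q * w)) - y * (- T3 / (q * Y * w)) * R * (- T4 / w))) =
    q ^ 3 / Y * (A * (f * \<tau> - \<theta> * (a - y / (q * w) * b)) -
      t * w\<^sup>2 * J * (T1 * P * T2 - y * T3 * R * T4))"
proof -
  have Y0: "Y \<noteq> 0" using nz Y by simp
  have t: "t = - Y / (q * y\<^sup>2)" using nz Y by (simp add: field_simps)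
  show ?thesis
    unfolding t using nz Y0 by (simp add: field_simps power_numeral_reduce)
qed

text \<open>The identity for \<open>D_2\<close> with denominators cleared, in the variable \<open>z\<close> with \<open>y = xz\<close> and \<open>t
  = z'/z\<^sup>2\<close> held fixed.\<close>

lemma appell_series_quadratic:
  assumes q: "nome q" and y: "y \<noteq> 0" "Theta y q \<noteq> 0" and t: "t \<noteq> 0" and z: "z \<noteq> 0"
    and Y: "Y = - (q * t * y\<^sup>2)" "Theta Y (q ^ 4) \<noteq> 0" "Theta (Y / q\<^sup>2) (q ^ 4) \<noteq> 0" "Theta Y (q\<^sup>2) \<noteq> 0"
  shows "Theta y q * Theta Y (q\<^sup>2) *
      (appell_series y q z * Theta (t * z\<^sup>2) (q ^ 4) -
       Theta z q * (appell_series Y (q ^ 4) (t * z\<^sup>2) -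
         y / (q * z) * appell_series (Y / q\<^sup>2) (q ^ 4) (t * z\<^sup>2))) =
    t * z\<^sup>2 * (qpoch_inf q q * qpoch_inf (q\<^sup>2) (q\<^sup>2)) *
      (Theta (Y * z) (q\<^sup>2) * Theta (1 / t) (q ^ 4) * Theta (q * z) (q\<^sup>2) -
       y * Theta (q * Y * z) (q\<^sup>2) * Theta (q\<^sup>2 / t) (q ^ 4) * Theta z (q\<^sup>2))"
proof -
  have q0: "q \<noteq> 0" using nome_nonzero[OF q] .
  have q2: "nome (q\<^sup>2)" and q4: "nome (q ^ 4)" by (rule nome_power[OF q], simp)+
  have Y0: "Y \<noteq> 0" using Y q0 t y by simp
  define A where "A = Theta y q * Theta Y (q\<^sup>2)"
  define J where "J = qpoch_inf q q * qpoch_inf (q\<^sup>2) (q\<^sup>2)"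
  have J2: "Theta q (q\<^sup>2) * qpoch_inf (q\<^sup>2) (q\<^sup>2) = qpoch_inf q q ^ 2"
    by (rule Theta_nome_square[OF q])
  define H where "H = (\<lambda>w. A * (appell_series y q w * Theta (t * w\<^sup>2) (q ^ 4) -
       Theta w q * (appell_series Y (q ^ 4) (t * w\<^sup>2) -
         y / (q * w) * appell_series (Y / q\<^sup>2) (q ^ 4) (t * w\<^sup>2))) -
    t * w\<^sup>2 * J *
      (Theta (Y * w) (q\<^sup>2) * Theta (1 / t) (q ^ 4) * Theta (q * w) (q\<^sup>2) -
       y * Theta (q * Y * w) (q\<^sup>2) * Theta (q\<^sup>2 / t) (q ^ 4) * Theta w (q\<^sup>2)))"
  have comp: "(\<lambda>w. F (t * w\<^sup>2)) holomorphic_on - {0}" if "F holomorphic_on - {0}" for F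
  proof -
    have "(F \<circ> (\<lambda>w. t * w\<^sup>2)) holomorphic_on - {0}"
      by (rule holomorphic_on_compose_gen[OF _ that]) (use t in \<open>auto intro!: holomorphic_intros\<close>)
    thus ?thesis by (simp add: o_def)
  qed
  have H_hol: "H holomorphic_on - {0}"
    unfolding H_def
    by (intro holomorphic_intros Theta_holomorphic_compose comp appell_series_holomorphic q q2 q4)
      (use q0 t Y0 y Y in auto)
  have H_shift: "w ^ Suc 1 * H (q\<^sup>2 * w) = q ^ 3 / Y * H w" if w: "w \<noteq> 0" for w
  proof -
    let ?k = "theta_ratio q"
    have tw: "t * w\<^sup>2 \<noteq> 0" using t w by simp
    have a1: "t * (q\<^sup>2 * w)\<^sup>2 = q ^ 4 * (t * w\<^sup>2)" by (simp add: power_mult_distrib flip: power_mult)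
    have e1: "appell_series y q (q\<^sup>2 * w) =
        q / y * (q / y * (appell_series y q w - ?k * Theta w q) - ?k * (- Theta w q / w))"
    proof -
      have qq: "q\<^sup>2 * w = q * (q * w)" by (simp add: power2_eq_square)
      show ?thesis
        unfolding qq
        using appell_series_shift[OF q y, of "q * w"] appell_series_shift[OF q y w]
          bilateral_theta_eq[OF q w] bilateral_theta_eq[OF q, of "q * w"] Theta_shift[OF q w] w q0
        by simp
    qed
    have e2: "Theta (q ^ 4 * (t * w\<^sup>2)) (q ^ 4) = - Theta (t * w\<^sup>2) (q ^ 4) / (t * w\<^sup>2)"
      by (rule Theta_shift[OF q4 tw])
    have e3: "Theta (q\<^sup>2 * w) q = - (- Theta w q / w) / (q * w)"
      using Theta_shift[OF q, of "q * w"] Theta_shift[OF q w] w q0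
      by (simp add: power2_eq_square mult.assoc)
    have bt: "bilateral_theta (q ^ 4) (t * w\<^sup>2) = ?k * Theta (t * w\<^sup>2) (q ^ 4)"
      using bilateral_theta_eq[OF q4 tw] theta_ratio_power_4[OF q] by simp
    have e4: "appell_series Y (q ^ 4) (q ^ 4 * (t * w\<^sup>2)) =
        q ^ 4 / Y * (appell_series Y (q ^ 4) (t * w\<^sup>2) - ?k * Theta (t * w\<^sup>2) (q ^ 4))"
      using appell_series_shift[OF q4 Y0 Y(2) tw] bt by simp
    have e5: "appell_series (Y / q\<^sup>2) (q ^ 4) (q ^ 4 * (t * w\<^sup>2)) =
        q ^ 4 / (Y / q\<^sup>2) * (appell_series (Y / q\<^sup>2) (q ^ 4) (t * w\<^sup>2) - ?k * Theta (t * w\<^sup>2) (q ^ 4))"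
      using appell_series_shift[OF q4 _ Y(3) tw] bt Y0 q0 by simp
    have e6: "Theta (Y * (q\<^sup>2 * w)) (q\<^sup>2) = - Theta (Y * w) (q\<^sup>2) / (Y * w)"
      by (rule Theta_shiftI[OF q2]) (use Y0 w in auto)
    have e7: "Theta (q * (q\<^sup>2 * w)) (q\<^sup>2) = - Theta (q * w) (q\<^sup>2) / (q * w)"
      by (rule Theta_shiftI[OF q2]) (use q0 w in auto)
    have e8: "Theta (q * Y * (q\<^sup>2 * w)) (q\<^sup>2) = - Theta (q * Y * w) (q\<^sup>2) / (q * Y * w)"
      by (rule Theta_shiftI[OF q2]) (use q0 Y0 w in auto)
    have e9: "Theta (q\<^sup>2 * w) (q\<^sup>2) = - Theta w (q\<^sup>2) / w"
      by (rule Theta_shift[OF q2 w])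
    have H_shifted: "H (q\<^sup>2 * w) = A * (appell_series y q (q\<^sup>2 * w) * Theta (q ^ 4 * (t * w\<^sup>2)) (q ^ 4) -
       Theta (q\<^sup>2 * w) q * (appell_series Y (q ^ 4) (q ^ 4 * (t * w\<^sup>2)) -
         y / (q * (q\<^sup>2 * w)) * appell_series (Y / q\<^sup>2) (q ^ 4) (q ^ 4 * (t * w\<^sup>2)))) -
      t * (q\<^sup>2 * w)\<^sup>2 * J *
      (Theta (Y * (q\<^sup>2 * w)) (q\<^sup>2) * Theta (1 / t) (q ^ 4) * Theta (q * (q\<^sup>2 * w)) (q\<^sup>2) -
       y * Theta (q * Y * (q\<^sup>2 * w)) (q\<^sup>2) * Theta (q\<^sup>2 / t) (q ^ 4) * Theta (q\<^sup>2 * w) (q\<^sup>2))"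
      unfolding H_def a1 ..
    show ?thesis
      unfolding H_shifted e1 e2 e3 e4 e5 e6 e7 e8 e9
      unfolding H_def numeral_2_eq_2[symmetric] One_nat_def[symmetric] Suc_1
      by (rule theta_quotient_shift_algebra[OF q0 y(1) t w Y(1)])
  qed
  have p: "Theta y q * appell_series y q 1 = - (qpoch_inf q q ^ 3)"
    by (rule appell_series_1[OF q y])
  have n1: "Theta 1 q = 0" "Theta 1 (q\<^sup>2) = 0" using q q2 by (auto simp: nome_def)
  have H1: "H 1 = 0"
  proof -
    have "Theta (1 / t) (q ^ 4) = - Theta t (q ^ 4) / t" by (rule Theta_inverse[OF q4 t])
    hence "H 1 = Theta Y (q\<^sup>2) * Theta t (q ^ 4) *
        (Theta y q * appell_series y q 1 + qpoch_inf q q * (Theta q (q\<^sup>2) * qpoch_inf (q\<^sup>2) (q\<^sup>2)))"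
      using t n1 by (simp add: H_def A_def J_def algebra_simps)
    thus ?thesis unfolding p J2 by (simp add: power2_eq_square power3_eq_cube)
  qed
  have Hq: "H q = 0"
  proof -
    have f: "appell_series y q q = q / y * appell_series y q 1"
      using appell_series_shift[OF q y, of 1] bilateral_theta_1[OF q] by simp
    have T: "Theta (t * q\<^sup>2) (q ^ 4) = Theta (q\<^sup>2 / t) (q ^ 4)"
      by (rule Theta_flipI[OF q4]) (use q0 t in \<open>auto simp: power_numeral_reduce\<close>)
    have TY: "Theta (q * Y * q) (q\<^sup>2) = - Theta Y (q\<^sup>2) / Y"
      by (rule Theta_shiftI[OF q2 Y0]) (simp add: power2_eq_square)
    have z1: "Theta (q * q) (q\<^sup>2) = 0" using Theta_self[OF q2] by (simp add: power2_eq_square)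
    have "H q = Theta Y (q\<^sup>2) * Theta (q\<^sup>2 / t) (q ^ 4) * (q / y) *
        (Theta y q * appell_series y q 1 + qpoch_inf q q * (Theta q (q\<^sup>2) * qpoch_inf (q\<^sup>2) (q\<^sup>2)))"
      unfolding H_def f T TY z1 Theta_self[OF q] A_def J_def unfolding Y(1) using q0 t y(1)
      by (simp add: field_simps power2_eq_square)
    thus ?thesis unfolding p J2 by (simp add: power2_eq_square power3_eq_cube)
  qed
  \<comment> \<open>Divide out the zeros \<open>1\<close> and \<open>q\<close>; they are inequivalent for the nome \<open>q\<^sup>2\<close>.\<close>
  obtain h where h: "h holomorphic_on - {0}" "\<And>w. w \<noteq> 0 \<Longrightarrow> H w = Theta (w / 1) (q\<^sup>2) * h w"
    "\<And>w. w \<noteq> 0 \<Longrightarrow> w ^ 1 * h (q\<^sup>2 * w) = - (q ^ 3 / Y / 1) * h w"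
    using theta_division[OF q2 H_hol H_shift one_neq_zero H1] by metis
  have "h q = 0" using h(2)[of q] Hq q0 Theta_power_nonzero[OF q, of 1 2 1] by simp
  moreover have "w ^ Suc 0 * h (q\<^sup>2 * w) = - (q ^ 3 / Y) * h w" if "w \<noteq> 0" for w
    using h(3)[OF that] by simp
  ultimately obtain h' where h': "h' holomorphic_on - {0}"
    "\<And>w. w \<noteq> 0 \<Longrightarrow> h w = Theta (w / q) (q\<^sup>2) * h' w"
    "\<And>w. w \<noteq> 0 \<Longrightarrow> w ^ 0 * h' (q\<^sup>2 * w) = - (- (q ^ 3 / Y) / q) * h' w"
    using theta_division[OF q2 h(1) _ q0, of 0 "- (q ^ 3 / Y)"] by metis
  have "h' (q\<^sup>2 * w) = q\<^sup>2 / Y * h' w" if "w \<noteq> 0" for w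
    using h'(3)[OF that] q0 by (simp add: power_numeral_reduce)
  then obtain C k where C: "\<And>w. w \<noteq> 0 \<Longrightarrow> h' w = C * w powi k" "C = 0 \<or> q\<^sup>2 / Y = (q\<^sup>2) powi k"
    using multiplicative_Liouville[OF q2 h'(1)] by metis
  have "q\<^sup>2 / Y \<noteq> (q\<^sup>2) powi k"
  proof
    assume "q\<^sup>2 / Y = (q\<^sup>2) powi k"
    hence "Y = (q\<^sup>2) powi (1 - k)" using q0 Y0 by (simp add: power_int_diff field_simps)
    thus False using Theta_eq_0_iff[OF q2 Y0] Y(4) by blast
  qed
  hence "H z = 0" using C h'(2)[OF z] h(2)[OF z] z by simp
  thus ?thesis by (simp add: H_def A_def J_def)
qed

text \<open>Put \<open>Y = -q x\<^sup>2 z'\<close>. The definedness conditions say that \<open>Y\<close> and \<open>Y/q\<^sup>2\<close> are not powers of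
  \<open>q^4\<close>; together this means that \<open>Y\<close> is not a power of \<open>q\<^sup>2\<close>, as the dissection of \<open>\<theta>(Y;q\<^sup>2)\<close>
  shows.\<close>

theorem D2_eq:
  assumes q: "nome q" and x: "x \<noteq> 0" and z: "z \<noteq> 0" and z': "z' \<noteq> 0"
    and defined: "D2_defined x z z' q"
  shows "D2 x z z' q * (Theta (x * z) q * Theta z' (q ^ 4) * Theta (- (q * x\<^sup>2 * z')) (q\<^sup>2) * Theta z q) =
    z' * (qpoch_inf q q * qpoch_inf (q\<^sup>2) (q\<^sup>2)) *
      (Theta (- (q * x\<^sup>2 * z * z')) (q\<^sup>2) * Theta (z\<^sup>2 / z') (q ^ 4) * Theta (q * z) (q\<^sup>2) -
       x * z * Theta (- (q\<^sup>2 * x\<^sup>2 * z * z')) (q\<^sup>2) * Theta (q\<^sup>2 * z\<^sup>2 / z') (q ^ 4) * Theta z (q\<^sup>2))"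
proof -
  have q0: "q \<noteq> 0" using nome_nonzero[OF q] .
  have q2: "nome (q\<^sup>2)" and q4: "nome (q ^ 4)" by (rule nome_power[OF q], simp)+
  define y where "y = x * z"
  define t where "t = z' / z\<^sup>2"
  define Y where "Y = - (q * x\<^sup>2 * z')"
  have nz: "y \<noteq> 0" "t \<noteq> 0" "Y \<noteq> 0" using q0 x z z' by (auto simp: y_def t_def Y_def)
  have Y: "Y = - (q * t * y\<^sup>2)" using z by (simp add: Y_def t_def y_def power_mult_distrib)
  have args: "- q * x\<^sup>2 * z' = Y" "- inverse q * x\<^sup>2 * z' = Y / q\<^sup>2"
    using q0 by (simp_all add: Y_def field_simps power2_eq_square)
  have T: "Theta z q \<noteq> 0" "Theta y q \<noteq> 0" "Theta z' (q ^ 4) \<noteq> 0" "Theta Y (q ^ 4) \<noteq> 0"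
    "Theta (Y / q\<^sup>2) (q ^ 4) \<noteq> 0"
    using defined nz x z z' q0 unfolding D2_defined_def appell_defined_def args
    by (auto simp: Theta_eq_0_iff[OF q] Theta_eq_0_iff[OF q4] y_def)
  have "Theta (q\<^sup>2 * Y) (q ^ 4) = - Theta (Y / q\<^sup>2) (q ^ 4) / (Y / q\<^sup>2)"
    by (rule Theta_shiftI[OF q4]) (use nz q0 in \<open>auto simp: power_numeral_reduce\<close>)
  hence "Theta (q\<^sup>2 * Y) (q ^ 4) \<noteq> 0" using T nz q0 by simp
  moreover have "Theta Y (q\<^sup>2) * qpoch_inf (q ^ 4) (q ^ 4) ^ 2 =
      Theta Y (q ^ 4) * Theta (q\<^sup>2 * Y) (q ^ 4) * qpoch_inf (q\<^sup>2) (q\<^sup>2)"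
    using Theta_dissection_2[OF q2 nz(3)] by (simp flip: power_mult)
  ultimately have TY: "Theta Y (q\<^sup>2) \<noteq> 0"
    using T qpoch_self_nonzero[OF q2] by auto
  have tz: "t * z\<^sup>2 = z'" using z by (simp add: t_def)
  have D: "D2 x z z' q = appell_series y q z / Theta z q - appell_series Y (q ^ 4) z' / Theta z' (q ^ 4) +
      inverse q * x * (appell_series (Y / q\<^sup>2) (q ^ 4) z' / Theta z' (q ^ 4))"
    unfolding D2_def appell_m_eq args y_def by simp
  have xq: "inverse q * x = y / (q * z)" using z q0 by (simp add: y_def field_simps)
  have arg1: "Y * z = - (q * x\<^sup>2 * z * z')" "q * Y * z = - (q\<^sup>2 * x\<^sup>2 * z * z')"
    "1 / t = z\<^sup>2 / z'" "q\<^sup>2 / t = q\<^sup>2 * z\<^sup>2 / z'"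
    by (simp_all add: Y_def t_def power2_eq_square)
  have "D2 x z z' q * (Theta y q * Theta z' (q ^ 4) * Theta Y (q\<^sup>2) * Theta z q) =
     Theta y q * Theta Y (q\<^sup>2) *
      (appell_series y q z * Theta z' (q ^ 4) -
       Theta z q * (appell_series Y (q ^ 4) z' - y / (q * z) * appell_series (Y / q\<^sup>2) (q ^ 4) z'))"
    unfolding D xq using T by (simp add: field_simps)
  also have "\<dots> = z' * (qpoch_inf q q * qpoch_inf (q\<^sup>2) (q\<^sup>2)) *
      (Theta (Y * z) (q\<^sup>2) * Theta (1 / t) (q ^ 4) * Theta (q * z) (q\<^sup>2) -
       y * Theta (q * Y * z) (q\<^sup>2) * Theta (q\<^sup>2 / t) (q ^ 4) * Theta z (q\<^sup>2))"
    using appell_series_quadratic[OF q nz(1) T(2) nz(2) z Y T(4,5) TY] unfolding tz .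
  finally show ?thesis unfolding arg1 unfolding Y_def y_def .
qed

section \<open>The eight specialisations\<close>

lemma D2_definedD:
  assumes q: "nome q" and "x \<noteq> 0" "z \<noteq> 0" "z' \<noteq> 0" and "D2_defined x z z' q"
  shows "Theta z q \<noteq> 0" "Theta z' (q ^ 4) \<noteq> 0" "Theta z (q\<^sup>2) \<noteq> 0" "Theta (q * z) (q\<^sup>2) \<noteq> 0"
proof -
  have q0: "q \<noteq> 0" using nome_nonzero[OF q] .
  have q4: "nome (q ^ 4)" and q2: "nome (q\<^sup>2)" by (rule nome_power[OF q], simp)+
  show 1: "Theta z q \<noteq> 0" "Theta z' (q ^ 4) \<noteq> 0"
    using assms unfolding D2_defined_def appell_defined_def
    by (auto simp: Theta_eq_0_iff[OF q] Theta_eq_0_iff[OF q4])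
  show "Theta z (q\<^sup>2) \<noteq> 0" "Theta (q * z) (q\<^sup>2) \<noteq> 0"
    using Theta_dissection_2[OF q assms(3)] 1 qpoch_self_nonzero[OF q2] by auto
qed

text \<open>In several specialisations the right-hand side acquires a factor \<open>\<theta>(z;q\<^sup>2)\<close> or
  \<open>\<theta>(qz;q\<^sup>2)\<close>; dissecting \<open>\<theta>(z;q)\<close> makes it cancel against the left-hand side.\<close>

lemma D2_eq':
  assumes q: "nome q" and x: "x \<noteq> 0" and z: "z \<noteq> 0" and z': "z' \<noteq> 0"
    and defined: "D2_defined x z z' q"
  shows "D2 x z z' q * (Theta (x * z) q * Theta z' (q ^ 4) * Theta (- (q * x\<^sup>2 * z')) (q\<^sup>2)) *
      (Theta z (q\<^sup>2) * Theta (q * z) (q\<^sup>2)) =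
    z' * qpoch_inf (q\<^sup>2) (q\<^sup>2) ^ 3 *
      (Theta (- (q * x\<^sup>2 * z * z')) (q\<^sup>2) * Theta (z\<^sup>2 / z') (q ^ 4) * Theta (q * z) (q\<^sup>2) -
       x * z * Theta (- (q\<^sup>2 * x\<^sup>2 * z * z')) (q\<^sup>2) * Theta (q\<^sup>2 * z\<^sup>2 / z') (q ^ 4) * Theta z (q\<^sup>2))"
    (is "?D * ?E * ?T = z' * _ * ?N")
proof -
  have "qpoch_inf q q * (?D * ?E * ?T) = ?D * ?E * (Theta z q * qpoch_inf (q\<^sup>2) (q\<^sup>2) ^ 2)"
    unfolding Theta_dissection_2[OF q z] by (simp only: mult_ac)
  also have "\<dots> = (?D * (?E * Theta z q)) * qpoch_inf (q\<^sup>2) (q\<^sup>2) ^ 2" by (simp only: mult_ac)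
  also have "\<dots> = qpoch_inf q q * (z' * qpoch_inf (q\<^sup>2) (q\<^sup>2) ^ 3 * ?N)"
    unfolding D2_eq[OF assms] by (simp add: power2_eq_square power3_eq_cube mult_ac)
  finally show ?thesis using qpoch_self_nonzero[OF q] mult_left_cancel by blast
qed

text \<open>The first product contains \<open>\<theta>(z\<^sup>2/z';q^4) = \<theta>(1;q^4) = 0\<close>.\<close>

lemma D2_square:
  assumes q: "nome q" and x: "x \<noteq> 0" and z: "z \<noteq> 0" and defined: "D2_defined x z (z\<^sup>2) q"
  shows "D2 x z (z\<^sup>2) q *
      (Theta (x * z) q * Theta (z\<^sup>2) (q ^ 4) * Theta (- (q * x\<^sup>2 * z\<^sup>2)) (q\<^sup>2) * Theta (q * z) (q\<^sup>2)) =
    - (x * z ^ 3 * qpoch_inf (q\<^sup>2) (q\<^sup>2) ^ 3 * Theta (- (q\<^sup>2 * x\<^sup>2 * z ^ 3)) (q\<^sup>2) * Theta (q\<^sup>2) (q ^ 4))"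
    (is "?D * (?E * ?Tq) = - ?R")
proof -
  have q4: "nome (q ^ 4)" by (rule nome_power[OF q]) simp
  have z2: "z\<^sup>2 \<noteq> 0" using z by simp
  have e: "z\<^sup>2 / z\<^sup>2 = 1" "q\<^sup>2 * z\<^sup>2 / z\<^sup>2 = q\<^sup>2" "q\<^sup>2 * x\<^sup>2 * z * z\<^sup>2 = q\<^sup>2 * x\<^sup>2 * z ^ 3"
    "Theta 1 (q ^ 4) = 0"
    using z q4 by (auto simp: power2_eq_square power3_eq_cube nome_def)
  have "Theta z (q\<^sup>2) * (?D * (?E * ?Tq)) = ?D * ?E * (Theta z (q\<^sup>2) * ?Tq)" by (simp only: mult_ac)
  also have "\<dots> = Theta z (q\<^sup>2) * (- ?R)"
    unfolding D2_eq'[OF q x z z2 defined] e by (simp add: power2_eq_square power3_eq_cube mult_ac)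
  finally show ?thesis using D2_definedD(3)[OF q x z z2 defined] mult_left_cancel by blast
qed

text \<open>The functions \<open>\<theta>(z\<^sup>2;q^4)\<close> and \<open>\<theta>(q\<^sup>2z\<^sup>2;q^4)\<close> split off \<open>\<theta>(z;q\<^sup>2)\<close> and \<open>\<theta>(qz;q\<^sup>2)\<close>, which
  cancel; what is left is the product formula for \<open>a = -x z\<^sup>2\<close> and \<open>b = -x z\<^sup>3\<close>.\<close>

lemma D2_fourth_power:
  assumes q: "nome q" and x: "x \<noteq> 0" and z: "z \<noteq> 0" and defined: "D2_defined x z (z ^ 4) q"
  shows "D2 x z (z ^ 4) q *
      (x * Theta (x * z) q * Theta (z ^ 4) (q ^ 4) * Theta (- (q * x\<^sup>2 * z ^ 4)) (q\<^sup>2)) =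
    - (qpoch_inf (q\<^sup>2) (q\<^sup>2) * qpoch_inf (q ^ 4) (q ^ 4) * Theta (- (x * z\<^sup>2)) q * Theta (- (x * z ^ 3)) q)"
proof -
  have q0: "q \<noteq> 0" using nome_nonzero[OF q] .
  have q4: "nome (q ^ 4)" and q2: "nome (q\<^sup>2)" by (rule nome_power[OF q], simp)+
  have z4: "z ^ 4 \<noteq> 0" using z by simp
  define X where "X = D2 x z (z ^ 4) q * (Theta (x * z) q * Theta (z ^ 4) (q ^ 4) * Theta (- (q * x\<^sup>2 * z ^ 4)) (q\<^sup>2))"
  define J2 J4 where "J2 = qpoch_inf (q\<^sup>2) (q\<^sup>2)" and "J4 = qpoch_inf (q ^ 4) (q ^ 4)"
  define T T' where "T = Theta z (q\<^sup>2)" and "T' = Theta (q * z) (q\<^sup>2)"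
  define U U' where "U = Theta (- z) (q\<^sup>2)" and "U' = Theta (- (q * z)) (q\<^sup>2)"
  define V V' where "V = Theta (- (q * x\<^sup>2 * z ^ 5)) (q\<^sup>2)" and "V' = Theta (- (x\<^sup>2 * z ^ 5)) (q\<^sup>2)"
  have nz: "J2 \<noteq> 0" "T \<noteq> 0" "T' \<noteq> 0"
    using qpoch_self_nonzero[OF q2] D2_definedD(3,4)[OF q x z z4 defined]
    by (auto simp: J2_def T_def T'_def)
  have e1: "q * x\<^sup>2 * z * z ^ 4 = q * x\<^sup>2 * z ^ 5" "q\<^sup>2 * x\<^sup>2 * z * z ^ 4 = q\<^sup>2 * (x\<^sup>2 * z ^ 5)"
    by (simp_all add: power_numeral_reduce)
  have e2: "Theta (- (q\<^sup>2 * (x\<^sup>2 * z ^ 5))) (q\<^sup>2) = - V' / (- (x\<^sup>2 * z ^ 5))"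
    unfolding V'_def by (rule Theta_shiftI[OF q2]) (use x z in auto)
  have e3: "Theta (z\<^sup>2 / z ^ 4) (q ^ 4) = - Theta (z\<^sup>2) (q ^ 4) / z\<^sup>2"
    by (rule Theta_inverseI[OF q4]) (use z in \<open>auto simp: power_numeral_reduce\<close>)
  have e4: "Theta (q\<^sup>2 * z\<^sup>2 / z ^ 4) (q ^ 4) = Theta ((q * z)\<^sup>2) (q ^ 4)"
    by (rule Theta_flipI[OF q4]) (use z q0 in \<open>auto simp: power_numeral_reduce\<close>)
  have d1: "Theta (z\<^sup>2) (q ^ 4) = T * U * J4 / J2\<^sup>2"
    using Theta_times_Theta_minus[OF q2 z] nz by (simp add: T_def U_def J2_def J4_def field_simps flip: power_mult)
  have d2: "Theta ((q * z)\<^sup>2) (q ^ 4) = T' * U' * J4 / J2\<^sup>2"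
    using Theta_times_Theta_minus[OF q2, of "q * z"] nz z q0
    by (simp add: T'_def U'_def J2_def J4_def field_simps flip: power_mult)
  have "X * (T * T') = z ^ 4 * J2 ^ 3 *
      (V * (- (T * U * J4 / J2\<^sup>2) / z\<^sup>2) * T' - x * z * (- V' / (- (x\<^sup>2 * z ^ 5))) * (T' * U' * J4 / J2\<^sup>2) * T)"
    using D2_eq'[OF q x z z4 defined] unfolding e1 e2 e3 e4 d1 d2
    unfolding X_def[symmetric] V_def[symmetric] T_def[symmetric] T'_def[symmetric] J2_def[symmetric] .
  also have "\<dots> = (- (J2 * J4) * (V' * U' + x * z\<^sup>2 * V * U) / x) * (T * T')"
    using nz x z by (simp add: field_simps power_numeral_reduce)
  finally have eq: "X * (T * T') = (- (J2 * J4) * (V' * U' + x * z\<^sup>2 * V * U) / x) * (T * T')" .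
  have "T * T' \<noteq> 0" using nz by simp
  from mult_right_cancel[THEN iffD1, OF this eq]
  have "X = - (J2 * J4) * (V' * U' + x * z\<^sup>2 * V * U) / x" .
  moreover have "V' * U' + x * z\<^sup>2 * V * U = Theta (- (x * z\<^sup>2)) q * Theta (- (x * z ^ 3)) q"
  proof -
    have eqs: "- (- (x * z\<^sup>2) * - (x * z ^ 3)) = - (x\<^sup>2 * z ^ 5)" "- (q * - (x * z ^ 3) / - (x * z\<^sup>2)) = - (q * z)"
      "- (q * - (x * z\<^sup>2) * - (x * z ^ 3)) = - (q * x\<^sup>2 * z ^ 5)" "- (- (x * z ^ 3) / - (x * z\<^sup>2)) = - z"
      using x z by (simp_all add: field_simps power_numeral_reduce)
    show ?thesis
      using Theta_product[OF q, of "- (x * z\<^sup>2)" "- (x * z ^ 3)"] x z unfolding eqs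
      by (simp add: V_def V'_def U_def U'_def)
  qed
  ultimately have "x * X = - (J2 * J4) * (Theta (- (x * z\<^sup>2)) q * Theta (- (x * z ^ 3)) q)"
    using x by simp
  thus ?thesis by (simp add: X_def J2_def J4_def mult_ac)
qed

text \<open>The difference of the two products is the left-hand side of \<open>Theta_mixed_nome_relation\<close>;
  the factor \<open>\<theta>(x;q^4)\<close> of its right-hand side cancels against \<open>\<theta>(z';q^4)\<close>.\<close>

lemma D2_inverse:
  assumes q: "nome q" and x: "x \<noteq> 0" and z: "z \<noteq> 0" and defined: "D2_defined x z (inverse x) q"
    and nz: "Theta (- (q * x)) (q\<^sup>2) \<noteq> 0"
  shows "D2 x z (inverse x) q * (Theta (x * z) q * Theta (- (q * x)) (q\<^sup>2) * Theta z q) =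
    - (z * qpoch_inf q q ^ 3 * Theta (- (q * x * z\<^sup>2)) (q\<^sup>2))"
proof -
  have q0: "q \<noteq> 0" using nome_nonzero[OF q] .
  have q4: "nome (q ^ 4)" and q2: "nome (q\<^sup>2)" by (rule nome_power[OF q], simp)+
  have x': "inverse x \<noteq> 0" using x by simp
  define X where "X = D2 x z (inverse x) q * (Theta (x * z) q * Theta (- (q * x)) (q\<^sup>2) * Theta z q)"
  have e1: "q * x\<^sup>2 * inverse x = q * x" "q * x\<^sup>2 * z * inverse x = q * x * z"
    "q\<^sup>2 * x\<^sup>2 * z * inverse x = q\<^sup>2 * (x * z)" "z\<^sup>2 / inverse x = x * z\<^sup>2"
    "q\<^sup>2 * z\<^sup>2 / inverse x = q\<^sup>2 * x * z\<^sup>2"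
    using x by (simp_all add: field_simps power2_eq_square)
  have e2: "Theta (- (q\<^sup>2 * (x * z))) (q\<^sup>2) = - Theta (- (x * z)) (q\<^sup>2) / (- (x * z))"
    by (rule Theta_shiftI[OF q2]) (use x z in auto)
  have e3: "Theta (inverse x) (q ^ 4) = - Theta x (q ^ 4) / x"
    by (rule Theta_inverseI[OF q4 x]) (use x in auto)
  have Tx: "Theta x (q ^ 4) \<noteq> 0" using D2_definedD(2)[OF q x z x' defined] e3 by simp
  have "X * (- Theta x (q ^ 4) / x) = D2 x z (inverse x) q *
      (Theta (x * z) q * (- Theta x (q ^ 4) / x) * Theta (- (q * x)) (q\<^sup>2) * Theta z q)"
    by (simp only: X_def mult_ac)
  also have "\<dots> = inverse x * (qpoch_inf q q * qpoch_inf (q\<^sup>2) (q\<^sup>2)) *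
      (Theta (- (q * x * z)) (q\<^sup>2) * Theta (x * z\<^sup>2) (q ^ 4) * Theta (q * z) (q\<^sup>2) -
       x * z * (- Theta (- (x * z)) (q\<^sup>2) / (- (x * z))) * Theta (q\<^sup>2 * x * z\<^sup>2) (q ^ 4) * Theta z (q\<^sup>2))"
    using D2_eq[OF q x z x' defined] unfolding e1 e2 e3 .
  also have "x * z * (- Theta (- (x * z)) (q\<^sup>2) / (- (x * z))) = Theta (- (x * z)) (q\<^sup>2)"
    using x z by simp
  also have "Theta (- (q * x * z)) (q\<^sup>2) * Theta (x * z\<^sup>2) (q ^ 4) * Theta (q * z) (q\<^sup>2) -
       Theta (- (x * z)) (q\<^sup>2) * Theta (q\<^sup>2 * x * z\<^sup>2) (q ^ 4) * Theta z (q\<^sup>2) =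
      z * Theta q (q\<^sup>2) * Theta x (q ^ 4) * Theta (- (q * x * z\<^sup>2)) (q\<^sup>2)"
    by (rule Theta_mixed_nome_relation[OF q x z nz])
  finally have eq: "X * (- Theta x (q ^ 4) / x) = inverse x * (qpoch_inf q q * qpoch_inf (q\<^sup>2) (q\<^sup>2)) *
      (z * Theta q (q\<^sup>2) * Theta x (q ^ 4) * Theta (- (q * x * z\<^sup>2)) (q\<^sup>2))" .
  have "X * Theta x (q ^ 4) = - x * (X * (- Theta x (q ^ 4) / x))" using x by simp
  also have "\<dots> = - (z * qpoch_inf q q * (Theta q (q\<^sup>2) * qpoch_inf (q\<^sup>2) (q\<^sup>2)) *
      Theta (- (q * x * z\<^sup>2)) (q\<^sup>2)) * Theta x (q ^ 4)"
    unfolding eq using x by (simp add: mult_ac)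
  finally have "X = - (z * qpoch_inf q q * (Theta q (q\<^sup>2) * qpoch_inf (q\<^sup>2) (q\<^sup>2)) * Theta (- (q * x * z\<^sup>2)) (q\<^sup>2))"
    using Tx mult_right_cancel by blast
  thus ?thesis
    unfolding X_def Theta_nome_square[OF q] by (simp add: power2_eq_square power3_eq_cube mult_ac)
qed

text \<open>Since \<open>z\<^sup>2/z' = (xz)\<^sup>2\<close> is a square, the functions for the nome \<open>q^4\<close> split, and
  \<open>Theta_three_term_relation\<close> applies.\<close>

lemma D2_inverse_square:
  assumes q: "nome q" and x: "x \<noteq> 0" and z: "z \<noteq> 0" and defined: "D2_defined x z (x powi (-2)) q"
  shows "D2 x z (x powi (-2)) q * (Theta (x * z) q * Theta (- x) (q\<^sup>2) * Theta z q) =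
    - (qpoch_inf q q ^ 3 * Theta (- (x * z\<^sup>2)) (q\<^sup>2))"
proof -
  have q0: "q \<noteq> 0" using nome_nonzero[OF q] .
  have q4: "nome (q ^ 4)" and q2: "nome (q\<^sup>2)" by (rule nome_power[OF q], simp)+
  have p: "x powi (-2) = 1 / x\<^sup>2" by (simp add: power_int_minus field_simps)
  have x': "1 / x\<^sup>2 \<noteq> 0" using x by simp
  define X where "X = D2 x z (1 / x\<^sup>2) q * (Theta (x * z) q * Theta (- x) (q\<^sup>2) * Theta z q)"
  define J1 J2 J4 where "J1 = qpoch_inf q q" and "J2 = qpoch_inf (q\<^sup>2) (q\<^sup>2)" and "J4 = qpoch_inf (q ^ 4) (q ^ 4)"
  have J: "J2 \<noteq> 0" "J4 \<noteq> 0"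
    using qpoch_self_nonzero[OF q2] qpoch_self_nonzero[OF q4] by (auto simp: J2_def J4_def)
  have square: "Theta (w\<^sup>2) (q ^ 4) = Theta w (q\<^sup>2) * Theta (- w) (q\<^sup>2) * J4 / J2\<^sup>2" if "w \<noteq> 0" for w
    using Theta_times_Theta_minus[OF q2 that] J by (simp add: J2_def J4_def field_simps flip: power_mult)
  have e1: "q * x\<^sup>2 * (1 / x\<^sup>2) = q" "q * x\<^sup>2 * z * (1 / x\<^sup>2) = q * z"
    "q\<^sup>2 * x\<^sup>2 * z * (1 / x\<^sup>2) = q\<^sup>2 * z" "z\<^sup>2 / (1 / x\<^sup>2) = (x * z)\<^sup>2"
    "q\<^sup>2 * z\<^sup>2 / (1 / x\<^sup>2) = (q * x * z)\<^sup>2"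
    using x by (simp_all add: field_simps power2_eq_square)
  have e2: "Theta (- (q\<^sup>2 * z)) (q\<^sup>2) = - Theta (- z) (q\<^sup>2) / (- z)"
    by (rule Theta_shiftI[OF q2]) (use z in auto)
  have e3: "Theta (1 / x\<^sup>2) (q ^ 4) = - Theta (x\<^sup>2) (q ^ 4) / x\<^sup>2"
    by (rule Theta_inverse[OF q4]) (use x in auto)
  have s1: "Theta ((x * z)\<^sup>2) (q ^ 4) = Theta (x * z) (q\<^sup>2) * Theta (- (x * z)) (q\<^sup>2) * J4 / J2\<^sup>2"
    by (rule square) (use x z in auto)
  have s2: "Theta ((q * x * z)\<^sup>2) (q ^ 4) = Theta (q * x * z) (q\<^sup>2) * Theta (- (q * x * z)) (q\<^sup>2) * J4 / J2\<^sup>2"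
    by (rule square) (use x z q0 in auto)
  have "Theta (x\<^sup>2) (q ^ 4) \<noteq> 0" using D2_definedD(2)[OF q x z x'] defined e3 unfolding p by simp
  hence Tx: "Theta x (q\<^sup>2) \<noteq> 0" using square[OF x] by auto
  have Tq: "Theta (- q) (q\<^sup>2) \<noteq> 0" using Theta_power_nonzero[OF q, of "- 1" 2 1] by simp
  have "D2 x z (1 / x\<^sup>2) q * (Theta (x * z) q * (- (Theta x (q\<^sup>2) * Theta (- x) (q\<^sup>2) * J4 / J2\<^sup>2) / x\<^sup>2) *
        Theta (- q) (q\<^sup>2) * Theta z q) = 1 / x\<^sup>2 * (J1 * J2) *
      (Theta (- (q * z)) (q\<^sup>2) * (Theta (x * z) (q\<^sup>2) * Theta (- (x * z)) (q\<^sup>2) * J4 / J2\<^sup>2) * Theta (q * z) (q\<^sup>2) -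
       x * z * (- Theta (- z) (q\<^sup>2) / (- z)) *
         (Theta (q * x * z) (q\<^sup>2) * Theta (- (q * x * z)) (q\<^sup>2) * J4 / J2\<^sup>2) * Theta z (q\<^sup>2))"
    using D2_eq[OF q x z x' defined[unfolded p]] unfolding e1 e2 e3 square[OF x] s1 s2 J1_def J2_def[symmetric] .
  hence "X * (Theta x (q\<^sup>2) * Theta (- q) (q\<^sup>2) * J4) = - (J1 * J2) * J4 *
      (Theta (- (q * z)) (q\<^sup>2) * Theta (q * z) (q\<^sup>2) * Theta (x * z) (q\<^sup>2) * Theta (- (x * z)) (q\<^sup>2) -
      x * Theta (- z) (q\<^sup>2) * Theta z (q\<^sup>2) * Theta (q * x * z) (q\<^sup>2) * Theta (- (q * x * z)) (q\<^sup>2))"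
    using x z J by (simp add: X_def field_simps)
  also have "\<dots> = - (J1 * (Theta q (q\<^sup>2) * J2) * Theta (- (x * z\<^sup>2)) (q\<^sup>2)) * (Theta x (q\<^sup>2) * Theta (- q) (q\<^sup>2) * J4)"
    unfolding Theta_three_term_relation[OF q x z] by (simp only: mult_ac mult_minus_left mult_minus_right)
  finally have eq: "X * (Theta x (q\<^sup>2) * Theta (- q) (q\<^sup>2) * J4) =
      - (J1 * (Theta q (q\<^sup>2) * J2) * Theta (- (x * z\<^sup>2)) (q\<^sup>2)) * (Theta x (q\<^sup>2) * Theta (- q) (q\<^sup>2) * J4)" .
  have "Theta x (q\<^sup>2) * Theta (- q) (q\<^sup>2) * J4 \<noteq> 0" using Tx Tq J by simp
  from mult_right_cancel[THEN iffD1, OF this eq]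
  have "X = - (J1 * (Theta q (q\<^sup>2) * J2) * Theta (- (x * z\<^sup>2)) (q\<^sup>2))" .
  thus ?thesis
    unfolding X_def p J1_def J2_def Theta_nome_square[OF q] by (simp add: power2_eq_square power3_eq_cube mult_ac)
qed


text \<open>With \<open>v = u\<^sup>2z\<close>, both products contain \<open>\<theta>(-v;q\<^sup>2) \<theta>(-qv;q\<^sup>2)\<close>, a multiple of \<open>\<theta>(-v;q)\<close>;
  the rest is the product formula for \<open>a = u\<close> and \<open>b = -uz\<close>.\<close>

lemma D2_cube_inverse_fourth_power:
  assumes q: "nome q" and u: "u \<noteq> 0" and z: "z \<noteq> 0" and defined: "D2_defined (u ^ 3) z (u powi (-4)) q"
  shows "D2 (u ^ 3) z (u powi (-4)) q *
      (Theta (u ^ 3 * z) q * Theta (u ^ 4) (q ^ 4) * Theta (- (q * u\<^sup>2)) (q\<^sup>2) * Theta z q) =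
    - (qpoch_inf (q\<^sup>2) (q\<^sup>2) * qpoch_inf (q ^ 4) (q ^ 4) * Theta (- (u\<^sup>2 * z)) q * Theta u q * Theta (- (z * u)) q)"
proof -
  have q0: "q \<noteq> 0" using nome_nonzero[OF q] .
  have q4: "nome (q ^ 4)" and q2: "nome (q\<^sup>2)" by (rule nome_power[OF q], simp)+
  have p: "u powi (-4) = 1 / u ^ 4" by (simp add: power_int_minus field_simps)
  have u3: "u ^ 3 \<noteq> 0" and u4: "1 / u ^ 4 \<noteq> 0" using u by auto
  define X where "X = D2 (u ^ 3) z (1 / u ^ 4) q *
    (Theta (u ^ 3 * z) q * Theta (u ^ 4) (q ^ 4) * Theta (- (q * u\<^sup>2)) (q\<^sup>2) * Theta z q)"
  define J1 J2 J4 where "J1 = qpoch_inf q q" and "J2 = qpoch_inf (q\<^sup>2) (q\<^sup>2)" and "J4 = qpoch_inf (q ^ 4) (q ^ 4)"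
  have J: "J1 \<noteq> 0" "J2 \<noteq> 0" "J4 \<noteq> 0"
    using qpoch_self_nonzero[OF q] qpoch_self_nonzero[OF q2] qpoch_self_nonzero[OF q4]
    by (auto simp: J1_def J2_def J4_def)
  have square: "Theta (w\<^sup>2) (q ^ 4) = Theta w (q\<^sup>2) * Theta (- w) (q\<^sup>2) * J4 / J2\<^sup>2" if "w \<noteq> 0" for w
    using Theta_times_Theta_minus[OF q2 that] J by (simp add: J2_def J4_def field_simps flip: power_mult)
  define v where "v = u\<^sup>2 * z"
  have v: "v \<noteq> 0" "q * v \<noteq> 0" using u z q0 by (auto simp: v_def)
  have e1: "q * (u ^ 3)\<^sup>2 * (1 / u ^ 4) = q * u\<^sup>2" "q * (u ^ 3)\<^sup>2 * z * (1 / u ^ 4) = q * v"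
    "q\<^sup>2 * (u ^ 3)\<^sup>2 * z * (1 / u ^ 4) = q\<^sup>2 * v" "z\<^sup>2 / (1 / u ^ 4) = v\<^sup>2"
    "q\<^sup>2 * z\<^sup>2 / (1 / u ^ 4) = (q * v)\<^sup>2"
    using u by (simp_all add: v_def power_mult_distrib power_numeral_reduce)
  have e2: "Theta (- (q\<^sup>2 * v)) (q\<^sup>2) = - Theta (- v) (q\<^sup>2) / (- v)"
    by (rule Theta_shiftI[OF q2]) (use v in auto)
  have e3: "Theta (1 / u ^ 4) (q ^ 4) = - Theta (u ^ 4) (q ^ 4) / u ^ 4"
    by (rule Theta_inverse[OF q4]) (use u in auto)
  have d: "Theta (- v) q = Theta (- v) (q\<^sup>2) * Theta (- (q * v)) (q\<^sup>2) * J1 / J2\<^sup>2"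
    using Theta_dissection_2[OF q, of "- v"] v J by (simp add: J1_def J2_def field_simps)
  have prod: "Theta u q * Theta (- (z * u)) q =
      Theta v (q\<^sup>2) * Theta (q * z) (q\<^sup>2) - u * Theta (q * v) (q\<^sup>2) * Theta z (q\<^sup>2)"
  proof -
    have eqs: "- (u * - (z * u)) = v" "- (q * - (z * u) / u) = q * z" "- (q * u * - (z * u)) = q * v"
      "- (- (z * u) / u) = z"
      using u by (simp_all add: v_def power2_eq_square)
    show ?thesis using Theta_product[OF q u, of "- (z * u)"] u z unfolding eqs by simp
  qed
  have uz: "u ^ 3 * z = u * v" by (simp add: v_def power_numeral_reduce)
  have "X * (- 1 / u ^ 4) = D2 (u ^ 3) z (1 / u ^ 4) q *
      (Theta (u ^ 3 * z) q * (- Theta (u ^ 4) (q ^ 4) / u ^ 4) * Theta (- (q * u\<^sup>2)) (q\<^sup>2) * Theta z q)"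
    by (simp add: X_def mult_ac)
  also have "\<dots> = 1 / u ^ 4 * (J1 * J2) *
      (Theta (- (q * v)) (q\<^sup>2) * (Theta v (q\<^sup>2) * Theta (- v) (q\<^sup>2) * J4 / J2\<^sup>2) * Theta (q * z) (q\<^sup>2) -
       u ^ 3 * z * (- Theta (- v) (q\<^sup>2) / (- v)) *
         (Theta (q * v) (q\<^sup>2) * Theta (- (q * v)) (q\<^sup>2) * J4 / J2\<^sup>2) * Theta z (q\<^sup>2))"
    using D2_eq[OF q u3 z u4 defined[unfolded p]]
    unfolding e1 e2 e3 square[OF v(1)] square[OF v(2)] J1_def J2_def[symmetric] .
  also have "\<dots> = 1 / u ^ 4 * (J2 * J4 * Theta (- v) q *
      (Theta v (q\<^sup>2) * Theta (q * z) (q\<^sup>2) - u * Theta (q * v) (q\<^sup>2) * Theta z (q\<^sup>2)))"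
    unfolding d uz using v J by (simp add: algebra_simps)
  finally have "X * (- 1 / u ^ 4) = 1 / u ^ 4 * (J2 * J4 * Theta (- v) q * (Theta u q * Theta (- (z * u)) q))"
    unfolding prod .
  note eq = this
  have "X = - (u ^ 4) * (X * (- 1 / u ^ 4))" using u by simp
  also have "\<dots> = - (J2 * J4 * Theta (- v) q * Theta u q * Theta (- (z * u)) q)"
    unfolding eq using u by (simp add: mult_ac)
  finally show ?thesis unfolding X_def p v_def J2_def J4_def .
qed

text \<open>The relation for the nome \<open>q^12\<close> in the form in which it occurs in both identities for the
  nome \<open>q\<^sup>3\<close>.\<close>

lemma Theta_nome_6_12_relation:
  assumes q: "nome q" and z: "z \<noteq> 0"
  shows "qpoch_inf q q *
      (q * Theta (- q) (q ^ 6) * Theta z (q ^ 12) * Theta (q ^ 3 * z) (q ^ 6) +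
       Theta (- (q\<^sup>2)) (q ^ 6) * Theta (q ^ 6 * z) (q ^ 12) * Theta z (q ^ 6)) =
    qpoch_inf (q ^ 3) (q ^ 3) ^ 3 * Theta z (q ^ 4)"
proof -
  have q0: "q \<noteq> 0" using nome_nonzero[OF q] .
  have q6: "nome (q ^ 6)" and q4: "nome (q ^ 4)" and q12: "nome (q ^ 12)" by (rule nome_power[OF q], simp)+
  define J1 J3 J4 where "J1 = qpoch_inf q q" and "J3 = qpoch_inf (q ^ 3) (q ^ 3)" and "J4 = qpoch_inf (q ^ 4) (q ^ 4)"
  define J6 J12 where "J6 = qpoch_inf (q ^ 6) (q ^ 6)" and "J12 = qpoch_inf (q ^ 12) (q ^ 12)"
  define T where "T = (\<lambda>k. Theta (q ^ k * z) (q ^ 12))"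
  have J: "J4 \<noteq> 0" "J6 \<noteq> 0" "J12 \<noteq> 0"
    using qpoch_self_nonzero[OF q4] qpoch_self_nonzero[OF q6] qpoch_self_nonzero[OF q12]
    by (auto simp: J4_def J6_def J12_def)
  have d1: "Theta z (q ^ 6) = T 0 * T 6 * J6 / J12\<^sup>2"
    using Theta_dissection_2[OF q6 z] J by (simp add: T_def J6_def J12_def field_simps flip: power_mult)
  have d2: "Theta (q ^ 3 * z) (q ^ 6) = T 3 * T 9 * J6 / J12\<^sup>2"
  proof -
    have "q ^ 6 * (q ^ 3 * z) = q ^ 9 * z" by (simp add: mult.assoc[symmetric] flip: power_add)
    thus ?thesis
      using Theta_dissection_2[OF q6, of "q ^ 3 * z"] J z q0
      by (simp add: T_def J6_def J12_def field_simps flip: power_mult)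
  qed
  have d3: "Theta z (q ^ 4) = T 0 * T 4 * T 8 * J4 / J12 ^ 3"
  proof -
    have *: "(\<Prod>j<3. f j) = f 0 * f 1 * f (2::nat)" for f :: "nat \<Rightarrow> complex"
      by (simp add: eval_nat_numeral)
    have "(q ^ 4) ^ 0 * z = q ^ 0 * z" "(q ^ 4) ^ 1 * z = q ^ 4 * z" "(q ^ 4) ^ 2 * z = q ^ 8 * z" "(q ^ 4) ^ 3 = q ^ 12"
      by (simp_all flip: power_mult)
    hence "Theta z (q ^ 4) * J12 ^ 3 = T 0 * T 4 * T 8 * J4"
      using Theta_dissection[OF q4 z, of 3] unfolding * by (simp add: T_def J4_def J12_def)
    thus ?thesis using J by (simp add: field_simps)
  qed
  have T0: "Theta z (q ^ 12) = T 0" by (simp add: T_def)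
  have "J1 * J6 * J12 * (q * Theta (- q) (q ^ 6) * T 3 * T 9 + Theta (- (q\<^sup>2)) (q ^ 6) * T 6 ^ 2) =
      J3 ^ 3 * J4 * T 4 * T 8"
    using Theta_nome_12_relation[OF q z] by (simp add: T_def J1_def J3_def J4_def J6_def J12_def)
  note cubic = this
  have "J1 * (q * Theta (- q) (q ^ 6) * T 0 * (T 3 * T 9 * J6 / J12\<^sup>2) +
       Theta (- (q\<^sup>2)) (q ^ 6) * T 6 * (T 0 * T 6 * J6 / J12\<^sup>2)) =
     T 0 / J12 ^ 3 * (J1 * J6 * J12 * (q * Theta (- q) (q ^ 6) * T 3 * T 9 + Theta (- (q\<^sup>2)) (q ^ 6) * T 6 ^ 2))"
    using J by (simp add: field_simps power2_eq_square power3_eq_cube)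
  also have "\<dots> = J3 ^ 3 * Theta z (q ^ 4)"
    unfolding cubic d3 by simp
  finally show ?thesis
    unfolding d1 d2 T0 T_def[symmetric] J1_def J3_def by (simp add: T_def)
qed

text \<open>Here \<open>x\<^sup>2 z z' = q\<^sup>2\<close>, so the theta functions with this argument do not involve \<open>z\<close>, and
  the difference of the two products is the left-hand side of \<open>Theta_nome_6_12_relation\<close> up to
  an elementary factor.\<close>

lemma D2_cubed_nome_q:
  assumes q: "nome q" and z: "z \<noteq> 0" and defined: "D2_defined (q * z powi (-2)) z (z ^ 3) (q ^ 3)"
  shows "D2 (q * z powi (-2)) z (z ^ 3) (q ^ 3) *
      (qpoch_inf q q * Theta (q\<^sup>2 * z) (q ^ 3) * Theta (z ^ 3) (q ^ 12) * Theta (- (q * z)) (q ^ 6) * Theta z (q ^ 3)) =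
    - (inverse q * z\<^sup>2 * qpoch_inf (q ^ 3) (q ^ 3) ^ 4 * qpoch_inf (q ^ 6) (q ^ 6) * Theta z (q ^ 4))"
proof -
  have q0: "q \<noteq> 0" using nome_nonzero[OF q] .
  have q3: "nome (q ^ 3)" and q6: "nome (q ^ 6)" and q12: "nome (q ^ 12)" by (rule nome_power[OF q], simp)+
  have p: "q * z powi (-2) = q / z\<^sup>2" by (simp add: power_int_minus field_simps)
  have x: "q / z\<^sup>2 \<noteq> 0" and z3: "z ^ 3 \<noteq> 0" using q0 z by auto
  have Q: "(q ^ 3)\<^sup>2 = q ^ 6" "(q ^ 3) ^ 4 = q ^ 12" by (simp_all flip: power_mult)
  have e1: "q / z\<^sup>2 * z = q / z" "q ^ 3 * (q / z\<^sup>2)\<^sup>2 * z ^ 3 = q ^ 5 / z" "q ^ 3 * (q / z\<^sup>2)\<^sup>2 * z * z ^ 3 = q ^ 5"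
    "q ^ 6 * (q / z\<^sup>2)\<^sup>2 * z * z ^ 3 = q ^ 6 * q\<^sup>2" "z\<^sup>2 / z ^ 3 = 1 / z" "q ^ 6 * z\<^sup>2 / z ^ 3 = q ^ 6 / z"
    using z by (simp_all add: field_simps power_numeral_reduce)
  have t1: "Theta (q / z) (q ^ 3) = Theta (q\<^sup>2 * z) (q ^ 3)"
    by (rule Theta_flipI[OF q3]) (use q0 z in \<open>auto simp: power_numeral_reduce\<close>)
  have t2: "Theta (- (q ^ 5 / z)) (q ^ 6) = Theta (- (q * z)) (q ^ 6)"
    by (rule Theta_flipI[OF q6]) (use q0 z in \<open>auto simp: power_numeral_reduce\<close>)
  have t3: "Theta (- (q ^ 5)) (q ^ 6) = Theta (- q) (q ^ 6)"
    by (rule Theta_flipI[OF q6]) (use q0 in \<open>auto simp: power_numeral_reduce\<close>)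
  have t4: "Theta (- (q ^ 6 * q\<^sup>2)) (q ^ 6) = - Theta (- (q\<^sup>2)) (q ^ 6) / (- (q\<^sup>2))"
    by (rule Theta_shiftI[OF q6]) (use q0 in auto)
  have t5: "Theta (1 / z) (q ^ 12) = - Theta z (q ^ 12) / z"
    by (rule Theta_inverse[OF q12 z])
  have t6: "Theta (q ^ 6 / z) (q ^ 12) = Theta (q ^ 6 * z) (q ^ 12)"
    by (rule Theta_flipI[OF q12]) (use q0 z in \<open>auto simp flip: power_add\<close>)
  define X where "X = D2 (q / z\<^sup>2) z (z ^ 3) (q ^ 3) *
    (Theta (q\<^sup>2 * z) (q ^ 3) * Theta (z ^ 3) (q ^ 12) * Theta (- (q * z)) (q ^ 6) * Theta z (q ^ 3))"
  have "X = z ^ 3 * (qpoch_inf (q ^ 3) (q ^ 3) * qpoch_inf (q ^ 6) (q ^ 6)) *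
      (Theta (- q) (q ^ 6) * (- Theta z (q ^ 12) / z) * Theta (q ^ 3 * z) (q ^ 6) -
       q / z * (- Theta (- (q\<^sup>2)) (q ^ 6) / (- (q\<^sup>2))) * Theta (q ^ 6 * z) (q ^ 12) * Theta z (q ^ 6))"
    using D2_eq[OF q3 x z z3 defined[unfolded p]] unfolding Q e1 t1 t2 t3 t4 t5 t6 X_def .
  also have "\<dots> = - (inverse q * z\<^sup>2 * (qpoch_inf (q ^ 3) (q ^ 3) * qpoch_inf (q ^ 6) (q ^ 6)) *
      (q * Theta (- q) (q ^ 6) * Theta z (q ^ 12) * Theta (q ^ 3 * z) (q ^ 6) +
       Theta (- (q\<^sup>2)) (q ^ 6) * Theta (q ^ 6 * z) (q ^ 12) * Theta z (q ^ 6)))"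
    using q0 z by (simp add: field_simps power2_eq_square power3_eq_cube)
  finally have "qpoch_inf q q * X = - (inverse q * z\<^sup>2 * (qpoch_inf (q ^ 3) (q ^ 3) * qpoch_inf (q ^ 6) (q ^ 6)) *
      (qpoch_inf (q ^ 3) (q ^ 3) ^ 3 * Theta z (q ^ 4)))"
    unfolding Theta_nome_6_12_relation[OF q z, symmetric] by (simp only: mult_ac mult_minus_left mult_minus_right)
  thus ?thesis unfolding p X_def by (simp add: power_numeral_reduce mult_ac)
qed

lemma D2_cubed_nome_q_square:
  assumes q: "nome q" and z: "z \<noteq> 0" and defined: "D2_defined (q\<^sup>2 * z powi (-2)) z (z ^ 3) (q ^ 3)"
  shows "D2 (q\<^sup>2 * z powi (-2)) z (z ^ 3) (q ^ 3) *
      (qpoch_inf q q * Theta (q * z) (q ^ 3) * Theta (z ^ 3) (q ^ 12) * Theta (- (q ^ 5 * z)) (q ^ 6) * Theta z (q ^ 3)) =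
    - (inverse q * z * qpoch_inf (q ^ 3) (q ^ 3) ^ 4 * qpoch_inf (q ^ 6) (q ^ 6) * Theta z (q ^ 4))"
proof -
  have q0: "q \<noteq> 0" using nome_nonzero[OF q] .
  have q3: "nome (q ^ 3)" and q6: "nome (q ^ 6)" and q12: "nome (q ^ 12)" by (rule nome_power[OF q], simp)+
  have p: "q\<^sup>2 * z powi (-2) = q\<^sup>2 / z\<^sup>2" by (simp add: power_int_minus field_simps)
  have x: "q\<^sup>2 / z\<^sup>2 \<noteq> 0" and z3: "z ^ 3 \<noteq> 0" using q0 z by auto
  have Q: "(q ^ 3)\<^sup>2 = q ^ 6" "(q ^ 3) ^ 4 = q ^ 12" by (simp_all flip: power_mult)
  have e1: "q\<^sup>2 / z\<^sup>2 * z = q\<^sup>2 / z" "q ^ 3 * (q\<^sup>2 / z\<^sup>2)\<^sup>2 * z ^ 3 = q ^ 6 * (q / z)"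
    "q ^ 3 * (q\<^sup>2 / z\<^sup>2)\<^sup>2 * z * z ^ 3 = q ^ 6 * q"
    "q ^ 6 * (q\<^sup>2 / z\<^sup>2)\<^sup>2 * z * z ^ 3 = q ^ 6 * q ^ 4" "z\<^sup>2 / z ^ 3 = 1 / z" "q ^ 6 * z\<^sup>2 / z ^ 3 = q ^ 6 / z"
    using z by (simp_all add: field_simps power_numeral_reduce)
  have t1: "Theta (q\<^sup>2 / z) (q ^ 3) = Theta (q * z) (q ^ 3)"
    by (rule Theta_flipI[OF q3]) (use q0 z in \<open>auto simp: power_numeral_reduce\<close>)
  have t2': "Theta (- (q ^ 6 * (q / z))) (q ^ 6) = - Theta (- (q / z)) (q ^ 6) / (- (q / z))"
    by (rule Theta_shiftI[OF q6]) (use q0 z in auto)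
  have t2'': "Theta (- (q / z)) (q ^ 6) = Theta (- (q ^ 5 * z)) (q ^ 6)"
    by (rule Theta_flipI[OF q6]) (use q0 z in \<open>auto simp: power_numeral_reduce\<close>)
  have t2: "Theta (- (q ^ 6 * (q / z))) (q ^ 6) = z / q * Theta (- (q ^ 5 * z)) (q ^ 6)"
    unfolding t2' t2'' using q0 z by (simp add: field_simps)
  have t3: "Theta (- (q ^ 6 * q)) (q ^ 6) = - Theta (- q) (q ^ 6) / (- q)"
    by (rule Theta_shiftI[OF q6]) (use q0 in auto)
  have t4': "Theta (- (q ^ 6 * q ^ 4)) (q ^ 6) = - Theta (- (q ^ 4)) (q ^ 6) / (- (q ^ 4))"
    by (rule Theta_shiftI[OF q6]) (use q0 in auto)
  have t4'': "Theta (- (q ^ 4)) (q ^ 6) = Theta (- (q\<^sup>2)) (q ^ 6)"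
    by (rule Theta_flipI[OF q6]) (use q0 in \<open>auto simp flip: power_add\<close>)
  have t4: "Theta (- (q ^ 6 * q ^ 4)) (q ^ 6) = Theta (- (q\<^sup>2)) (q ^ 6) / q ^ 4"
    unfolding t4' t4'' by simp
  have t5: "Theta (1 / z) (q ^ 12) = - Theta z (q ^ 12) / z"
    by (rule Theta_inverse[OF q12 z])
  have t6: "Theta (q ^ 6 / z) (q ^ 12) = Theta (q ^ 6 * z) (q ^ 12)"
    by (rule Theta_flipI[OF q12]) (use q0 z in \<open>auto simp flip: power_add\<close>)
  define X where "X = D2 (q\<^sup>2 / z\<^sup>2) z (z ^ 3) (q ^ 3) *
    (Theta (q * z) (q ^ 3) * Theta (z ^ 3) (q ^ 12) * Theta (- (q ^ 5 * z)) (q ^ 6) * Theta z (q ^ 3))"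
  have "X = q / z * (D2 (q\<^sup>2 / z\<^sup>2) z (z ^ 3) (q ^ 3) *
    (Theta (q * z) (q ^ 3) * Theta (z ^ 3) (q ^ 12) * (z / q * Theta (- (q ^ 5 * z)) (q ^ 6)) * Theta z (q ^ 3)))"
    using q0 z by (simp add: X_def)
  also have "\<dots> = q / z * (z ^ 3 * (qpoch_inf (q ^ 3) (q ^ 3) * qpoch_inf (q ^ 6) (q ^ 6)) *
      (- Theta (- q) (q ^ 6) / (- q) * (- Theta z (q ^ 12) / z) * Theta (q ^ 3 * z) (q ^ 6) -
       q\<^sup>2 / z * (Theta (- (q\<^sup>2)) (q ^ 6) / q ^ 4) * Theta (q ^ 6 * z) (q ^ 12) * Theta z (q ^ 6)))"
    using D2_eq[OF q3 x z z3 defined[unfolded p]] unfolding Q e1 t1 t2 t3 t4 t5 t6 by (rule arg_cong)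
  also have "\<dots> = - (inverse q * z * (qpoch_inf (q ^ 3) (q ^ 3) * qpoch_inf (q ^ 6) (q ^ 6)) *
      (q * Theta (- q) (q ^ 6) * Theta z (q ^ 12) * Theta (q ^ 3 * z) (q ^ 6) +
       Theta (- (q\<^sup>2)) (q ^ 6) * Theta (q ^ 6 * z) (q ^ 12) * Theta z (q ^ 6)))"
    using q0 z by (simp add: field_simps power_numeral_reduce)
  finally have "qpoch_inf q q * X = - (inverse q * z * (qpoch_inf (q ^ 3) (q ^ 3) * qpoch_inf (q ^ 6) (q ^ 6)) *
      (qpoch_inf (q ^ 3) (q ^ 3) ^ 3 * Theta z (q ^ 4)))"
    unfolding Theta_nome_6_12_relation[OF q z, symmetric] by (simp only: mult_ac mult_minus_left mult_minus_right)
  thus ?thesis unfolding p X_def by (simp add: power_numeral_reduce mult_ac)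
qed

text \<open>Here \<open>\<theta>(-q x\<^sup>2 z z';q\<^sup>2) = \<theta>(q\<^sup>2/z;q\<^sup>2) = \<theta>(z;q\<^sup>2)\<close>, and similarly in the second term, so
  \<open>\<theta>(z;q\<^sup>2) \<theta>(qz;q\<^sup>2)\<close> factors out; what remains is the even-odd splitting of \<open>\<theta>(w;q)\<close> at \<open>w =
  -x z\<^sup>2/q\<close>.\<close>

lemma D2_minus_inverse_squares:
  assumes q: "nome q" and x: "x \<noteq> 0" and z: "z \<noteq> 0"
    and defined: "D2_defined x z (- (q * x powi (-2) * z powi (-2))) q"
  shows "D2 x z (- (q * x powi (-2) * z powi (-2))) q *
      (Theta (x * z) q * Theta (- (q ^ 3 * x\<^sup>2 * z\<^sup>2)) (q ^ 4) * Theta (z\<^sup>2) (q\<^sup>2)) =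
    - (inverse x * qpoch_inf (q\<^sup>2) (q\<^sup>2) ^ 3 * Theta (- (x * z\<^sup>2)) q)"
proof -
  have q0: "q \<noteq> 0" using nome_nonzero[OF q] .
  have q4: "nome (q ^ 4)" and q2: "nome (q\<^sup>2)" by (rule nome_power[OF q], simp)+
  define z' where "z' = - q / (x\<^sup>2 * z\<^sup>2)"
  have p: "- (q * x powi (-2) * z powi (-2)) = z'"
    by (simp add: z'_def power_int_minus field_simps)
  have z': "z' \<noteq> 0" using q0 x z by (simp add: z'_def)
  have e1: "- (q * x\<^sup>2 * z') = q\<^sup>2 / z\<^sup>2" "- (q * x\<^sup>2 * z * z') = q\<^sup>2 / z" "- (q\<^sup>2 * x\<^sup>2 * z * z') = q\<^sup>2 * (q / z)"
    "z\<^sup>2 / z' = - (q * (- (x * z\<^sup>2 / q))\<^sup>2)" "q\<^sup>2 * z\<^sup>2 / z' = - (q ^ 3 * (- (x * z\<^sup>2 / q))\<^sup>2)"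
    using q0 x z by (simp_all add: z'_def field_simps power_numeral_reduce)
  have t1: "Theta (q\<^sup>2 / z\<^sup>2) (q\<^sup>2) = Theta (z\<^sup>2) (q\<^sup>2)" "Theta (q\<^sup>2 / z) (q\<^sup>2) = Theta z (q\<^sup>2)"
    by (rule Theta_flip[OF q2]; use z in simp)+
  have t2': "Theta (q\<^sup>2 * (q / z)) (q\<^sup>2) = - Theta (q / z) (q\<^sup>2) / (q / z)"
    by (rule Theta_shift[OF q2]) (use q0 z in auto)
  have t2'': "Theta (q / z) (q\<^sup>2) = Theta (q * z) (q\<^sup>2)"
    by (rule Theta_flipI[OF q2]) (use q0 z in \<open>auto simp: power2_eq_square\<close>)
  have t2: "Theta (q\<^sup>2 * (q / z)) (q\<^sup>2) = - (z / q) * Theta (q * z) (q\<^sup>2)"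
    unfolding t2' t2'' by simp
  have t3: "Theta z' (q ^ 4) = Theta (- (q ^ 3 * x\<^sup>2 * z\<^sup>2)) (q ^ 4)"
    by (rule Theta_flipI[OF q4]) (use q0 x z in \<open>auto simp: z'_def power_numeral_reduce\<close>)
  define w where "w = - (x * z\<^sup>2 / q)"
  have w: "w \<noteq> 0" "- (x * z\<^sup>2) = q * w" using q0 x z by (auto simp: w_def)
  define X where "X = D2 x z z' q *
    (Theta (x * z) q * Theta (- (q ^ 3 * x\<^sup>2 * z\<^sup>2)) (q ^ 4) * Theta (z\<^sup>2) (q\<^sup>2))"
  define J where "J = qpoch_inf (q\<^sup>2) (q\<^sup>2)"
  define T where "T = Theta z (q\<^sup>2) * Theta (q * z) (q\<^sup>2)"
  have "X * T = z' * J ^ 3 *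
      (Theta z (q\<^sup>2) * Theta (- (q * w\<^sup>2)) (q ^ 4) * Theta (q * z) (q\<^sup>2) -
       x * z * (- (z / q) * Theta (q * z) (q\<^sup>2)) * Theta (- (q ^ 3 * w\<^sup>2)) (q ^ 4) * Theta z (q\<^sup>2))"
    using D2_eq'[OF q x z z' defined[unfolded p]] unfolding e1 t1 t2 t3 X_def T_def J_def w_def .
  also have "\<dots> = z' * J ^ 3 * (Theta (- (q * w\<^sup>2)) (q ^ 4) - w * Theta (- (q ^ 3 * w\<^sup>2)) (q ^ 4)) * T"
    using q0 by (simp add: T_def w_def algebra_simps power2_eq_square)
  finally have eq: "X * T = z' * J ^ 3 * Theta w q * T"
    unfolding Theta_even_odd_parts[OF q w(1), symmetric] .
  have "T \<noteq> 0" using D2_definedD(3,4)[OF q x z z' defined[unfolded p]] by (simp add: T_def)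
  from mult_right_cancel[THEN iffD1, OF this eq] have X: "X = z' * J ^ 3 * Theta w q" .
  have "Theta w q = - w * Theta (- (x * z\<^sup>2)) q"
    unfolding w(2) using Theta_shift[OF q w(1)] w(1) by simp
  hence "X = - (inverse x * J ^ 3 * Theta (- (x * z\<^sup>2)) q)"
    unfolding X using q0 x z by (simp add: z'_def w_def field_simps power2_eq_square)
  thus ?thesis unfolding X_def p J_def .
qed

theorem theorem2p2:
  fixes q x z u :: complex
  assumes "0 < norm q" and "norm q < 1"
    and "x \<noteq> 0" and "z \<noteq> 0" and "u \<noteq> 0"
  shows "
    (D2_defined x z (z^2) q \<and>
     Theta (x * z) q * Theta (z^2) (q^4) * Theta (- (q * x^2 * z^2)) (q^2) * Theta (q * z) (q^2) \<noteq> 0 \<longrightarrow>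
     D2 x z (z^2) q =
       - (x * z^3 * qpoch_inf (q^2) (q^2) ^ 3 * Theta (- (q^2 * x^2 * z^3)) (q^2) * Theta (q^2) (q^4)) /
         (Theta (x * z) q * Theta (z^2) (q^4) * Theta (- (q * x^2 * z^2)) (q^2) * Theta (q * z) (q^2))) \<and>
    (D2_defined x z (z^4) q \<and>
     x * Theta (x * z) q * Theta (z^4) (q^4) * Theta (- (q * x^2 * z^4)) (q^2) \<noteq> 0 \<longrightarrow>
     D2 x z (z^4) q =
       - (qpoch_inf (q^2) (q^2) * qpoch_inf (q^4) (q^4) * Theta (- (x * z^2)) q * Theta (- (x * z^3)) q) /
         (x * Theta (x * z) q * Theta (z^4) (q^4) * Theta (- (q * x^2 * z^4)) (q^2))) \<and>
    (D2_defined x z (inverse x) q \<and>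
     Theta (x * z) q * Theta (- (q * x)) (q^2) * Theta z q \<noteq> 0 \<longrightarrow>
     D2 x z (inverse x) q =
       - (z * qpoch_inf q q ^ 3 * Theta (- (q * x * z^2)) (q^2)) /
         (Theta (x * z) q * Theta (- (q * x)) (q^2) * Theta z q)) \<and>
    (D2_defined x z (x powi (-2)) q \<and>
     Theta (x * z) q * Theta (- x) (q^2) * Theta z q \<noteq> 0 \<longrightarrow>
     D2 x z (x powi (-2)) q =
       - (qpoch_inf q q ^ 3 * Theta (- (x * z^2)) (q^2)) /
         (Theta (x * z) q * Theta (- x) (q^2) * Theta z q)) \<and>
    (D2_defined (u^3) z (u powi (-4)) q \<and>
     Theta (u^3 * z) q * Theta (u^4) (q^4) * Theta (- (q * u^2)) (q^2) * Theta z q \<noteq> 0 \<longrightarrow>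
     D2 (u^3) z (u powi (-4)) q =
       - (qpoch_inf (q^2) (q^2) * qpoch_inf (q^4) (q^4) * Theta (- (u^2 * z)) q * Theta u q * Theta (- (z * u)) q) /
         (Theta (u^3 * z) q * Theta (u^4) (q^4) * Theta (- (q * u^2)) (q^2) * Theta z q)) \<and>
    (D2_defined (q * z powi (-2)) z (z^3) (q^3) \<and>
     qpoch_inf q q * Theta (q^2 * z) (q^3) * Theta (z^3) (q^12) * Theta (- (q * z)) (q^6) * Theta z (q^3) \<noteq> 0 \<longrightarrow>
     D2 (q * z powi (-2)) z (z^3) (q^3) =
       - (inverse q * z^2 * qpoch_inf (q^3) (q^3) ^ 4 * qpoch_inf (q^6) (q^6) * Theta z (q^4)) /
         (qpoch_inf q q * Theta (q^2 * z) (q^3) * Theta (z^3) (q^12) * Theta (- (q * z)) (q^6) * Theta z (q^3))) \<and>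
    (D2_defined (q^2 * z powi (-2)) z (z^3) (q^3) \<and>
     qpoch_inf q q * Theta (q * z) (q^3) * Theta (z^3) (q^12) * Theta (- (q^5 * z)) (q^6) * Theta z (q^3) \<noteq> 0 \<longrightarrow>
     D2 (q^2 * z powi (-2)) z (z^3) (q^3) =
       - (inverse q * z * qpoch_inf (q^3) (q^3) ^ 4 * qpoch_inf (q^6) (q^6) * Theta z (q^4)) /
         (qpoch_inf q q * Theta (q * z) (q^3) * Theta (z^3) (q^12) * Theta (- (q^5 * z)) (q^6) * Theta z (q^3))) \<and>
    (D2_defined x z (- (q * x powi (-2) * z powi (-2))) q \<and>
     Theta (x * z) q * Theta (- (q^3 * x^2 * z^2)) (q^4) * Theta (z^2) (q^2) \<noteq> 0 \<longrightarrow>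
     D2 x z (- (q * x powi (-2) * z powi (-2))) q =
       - (inverse x * qpoch_inf (q^2) (q^2) ^ 3 * Theta (- (x * z^2)) q) /
         (Theta (x * z) q * Theta (- (q^3 * x^2 * z^2)) (q^4) * Theta (z^2) (q^2)))"
proof -
  have q: "nome q" using assms by (simp add: nome_def)
  have divide: "a = b / c" if "a * c = b" "c \<noteq> 0" for a b c :: complex
    using that by (simp add: field_simps)
  show ?thesis
    by (intro conjI impI; elim conjE; rule divide; (assumption | (rule
        D2_square[OF q assms(3,4)]
        D2_fourth_power[OF q assms(3,4)]
        D2_inverse[OF q assms(3,4)]
        D2_inverse_square[OF q assms(3,4)]
        D2_cube_inverse_fourth_power[OF q assms(5,4)]
        D2_cubed_nome_q[OF q assms(4)]
        D2_cubed_nome_q_square[OF q assms(4)]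
        D2_minus_inverse_squares[OF q assms(3,4)]; simp)))
qed

end
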